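(* Let $M$ be a smooth Riemannian manifold, let $X$ be a real valued z-KROK random field on $M$ and let $Z:=X^{-1}(0)$. Let $\gamma:[0,1]\to M$ be a smooth curve such that $\gamma$ is transverse to $Z$ almost surely. Then $$\mathbb{E}\,\#(\gamma\cap Z)=2\,\ell^{F^X}(\gamma).$$
   Context: Random fields. $M$ is a smooth manifold, possibly non-compact, with Riemannian metric $g$. $C^1(M,\mathbb{R}^k)$ carries the weak Whitney topology; a random field $X$ is a measurable map from a probability space into it; $[Y]$ denotes the law of a random element $Y$. For $f\in C^1(M,\mathbb{R}^k)$ let $J_pf:=\|d_pf^1\wedge\cdots\wedge d_pf^k\|$ (for $k=1$, $J_pf=\|d_pf\|$). A regular conditional probability of $X$ given $X(p)$ is a map $(x,B)\mapsto\mu(p,x)(B)$ ($x\in\mathbb{R}^k$, $B\subset C^1(M,\mathbb{R}^k)$ Borel) such that each $\mu(p,x)$ is a Borel probability measure, $x\mapsto\mu(p,x)(B)$ is Borel, and $\mathbb{P}\{X\in B,\,X(p)\in V\}=\int_V\mu(p,x)(B)\,d[X(p)](x)$ for all Borel $B$ and $V\subset\mathbb{R}^k$. $X$ is z-KROK if: (i) $X$ is a random element of $C^1(M,\mathbb{R}^k)$; (ii) almost surely $0$ is a regular value of $X$; (iii) for every $p\in M$ the law of $X(p)$ is absolutely continuous with density $\rho_{X(p)}:\mathbb{R}^k\to[0,+\infty)$; (iv) $(p,x)\mapsto\rho_{X(p)}(x)$ on $M\times\mathbb{R}^k$ is continuous at $(p,0)$ for all $p\in M$; (v) there are regular conditional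 probabilities $\mu(p,\cdot)$ of $X$ given $X(p)$, $p\in M$, such that the measures $J_p\cdot\mu(p,x)$, $B\mapsto\int_BJ_pf\,d\mu(p,x)(f)$, are finite and $(p,x)\mapsto J_p\cdot\mu(p,x)$, with values in the finite positive Borel measures on $C^1(M,\mathbb{R}^k)$ with the weak topology (tested on bounded continuous functions), is continuous at $(p,0)$ for all $p\in M$. With this $\mu$, write $\mathbb{E}\{\Phi(X)\,|\,X(p)=0\}:=\int\Phi\,d\mu(p,0)$. Semi Finsler structure. A semi Finsler structure on $M$ is a choice of a semi-norm $F_p:T_pM\to\mathbb{R}$ for each $p$ depending continuously on $p$. For $X$ scalar z-KROK, $F^X$ is the semi Finsler structure $F^X_p(v):=\frac{\rho_{X(p)}(0)}2\mathbb{E}\{|d_pX(v)|\,|\,X(p)=0\}$, $v\in T_pM$. For a semi Finsler structure $F$ and a smooth curve $\gamma:[0,1]\to M$, $\ell^F(\gamma):=\int_0^1F_{\gamma(t)}(\dot\gamma(t))\,dt$. The number $\#(\gamma\cap Z)$ is the number of parameters $t\in[0,1]$ with $\gamma(t)\in Z$. *)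

theory Defs
  imports "HOL-Probability.Probability" "HOL-Library.Extended_Nat"
begin

section \<open>Differentiability classes\<close>

text \<open>For open \<open>S\<close> and finite-dimensional domain this is the class \<open>C\<^sup>n\<close> on \<open>S\<close>: all iterated
  directional derivatives up to order \<open>n\<close> exist and are continuous.\<close>

fun n_times_cont_diff_on ::
    "nat \<Rightarrow> 'a::real_normed_vector set \<Rightarrow> ('a \<Rightarrow> 'b::real_normed_vector) \<Rightarrow> bool" where
  "n_times_cont_diff_on 0 S f \<longleftrightarrow> continuous_on S f"
| "n_times_cont_diff_on (Suc n) S f \<longleftrightarrow>
     (\<forall>x\<in>S. f differentiable (at x)) \<and>
     (\<forall>v. n_times_cont_diff_on n S (\<lambda>x. frechet_derivative f (at x) v))"

definition Ck_on ::
    "enat \<Rightarrow> 'a::real_normed_vector set \<Rightarrow> ('a \<Rightarrow> 'b::real_normed_vector) \<Rightarrow> bool" where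
  "Ck_on k S f \<longleftrightarrow> (\<forall>n. enat n \<le> k \<longrightarrow> n_times_cont_diff_on n S f)"

section \<open>Smooth manifolds\<close>

text \<open>The points of the manifold are the elements of a Hausdorff, second countable type \<open>'m\<close>,
  and the smooth structure is given by an atlas modelled on a Euclidean space \<open>'e\<close>.  A chart is
  a pair \<open>(U, \<phi>)\<close>; the values of \<open>\<phi>\<close> outside \<open>U\<close> carry no meaning.  The atlas
  need not be maximal: the notions below depend only on the smooth structure it determines.\<close>

type_synonym ('m, 'e) chart = "'m set \<times> ('m \<Rightarrow> 'e)"

abbreviation dom_chart :: "('m, 'e) chart \<Rightarrow> 'm set" where
  "dom_chart c \<equiv> fst c"

abbreviation coord :: "('m, 'e) chart \<Rightarrow> 'm \<Rightarrow> 'e" where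
  "coord c \<equiv> snd c"

definition inv_chart :: "('m, 'e) chart \<Rightarrow> 'e \<Rightarrow> 'm" where
  "inv_chart c = inv_into (dom_chart c) (coord c)"

definition is_chart :: "('m::topological_space, 'e::euclidean_space) chart \<Rightarrow> bool" where
  "is_chart c \<longleftrightarrow> open (dom_chart c) \<and> open (coord c ` dom_chart c) \<and>
     homeomorphism (dom_chart c) (coord c ` dom_chart c) (coord c) (inv_chart c)"

definition smooth_atlas ::
    "('m::{t2_space,second_countable_topology}, 'e::euclidean_space) chart set \<Rightarrow> bool" where
  "smooth_atlas A \<longleftrightarrow>
     (\<forall>c\<in>A. is_chart c) \<and> (\<Union>c\<in>A. dom_chart c) = UNIV \<and>
     (\<forall>c\<in>A. \<forall>d\<in>A. Ck_on \<infinity> (coord c ` (dom_chart c \<inter> dom_chart d)) (coord d \<circ> inv_chart c))"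

section \<open>Tangent vectors, differentials, curves\<close>

text \<open>A tangent vector at \<open>p\<close> is the family of its coordinates in the charts around \<open>p\<close>,
  which transform by the derivatives of the transition maps; it is set to \<open>0\<close> on all other
  arguments, so that it is determined by its coordinates in any one chart around \<open>p\<close>.\<close>

type_synonym ('m, 'e) tangent_vector = "('m, 'e) chart \<Rightarrow> 'e"

definition tangent_space ::
    "('m, 'e::euclidean_space) chart set \<Rightarrow> 'm \<Rightarrow> ('m, 'e) tangent_vector set" where
  "tangent_space A p = {v.
     (\<forall>c\<in>A. \<forall>d\<in>A. p \<in> dom_chart c \<and> p \<in> dom_chart d \<longrightarrow>
        v d = frechet_derivative (coord d \<circ> inv_chart c) (at (coord c p)) (v c)) \<and>
     (\<forall>c. \<not> (c \<in> A \<and> p \<in> dom_chart c) \<longrightarrow> v c = 0)}"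

definition coordinate_vector ::
    "('m, 'e::euclidean_space) chart set \<Rightarrow> ('m, 'e) chart \<Rightarrow> 'm \<Rightarrow> 'e \<Rightarrow> ('m, 'e) tangent_vector"
  where
  "coordinate_vector A c p e = (\<lambda>d. if d \<in> A \<and> p \<in> dom_chart d
      then frechet_derivative (coord d \<circ> inv_chart c) (at (coord c p)) e else 0)"

definition chart_at :: "('m, 'e) chart set \<Rightarrow> 'm \<Rightarrow> ('m, 'e) chart" where
  "chart_at A p = (SOME c. c \<in> A \<and> p \<in> dom_chart c)"

text \<open>For \<open>v\<close> in the tangent space at \<open>p\<close> the value does not depend on the chart chosen.\<close>

definition differential ::
    "('m, 'e::euclidean_space) chart set \<Rightarrow> ('m \<Rightarrow> real) \<Rightarrow> 'm \<Rightarrow> ('m, 'e) tangent_vector \<Rightarrow> real"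
  where
  "differential A f p v =
     frechet_derivative (f \<circ> inv_chart (chart_at A p)) (at (coord (chart_at A p) p))
       (v (chart_at A p))"

text \<open>As \<open>S\<close> may be the closed interval \<open>[0,1]\<close>, regularity in a chart means having local
  \<open>C\<^sup>k\<close> extensions to open sets of parameters.\<close>

definition Ck_curve_on ::
    "enat \<Rightarrow> ('m::topological_space, 'e::euclidean_space) chart set \<Rightarrow> real set \<Rightarrow> (real \<Rightarrow> 'm) \<Rightarrow> bool"
  where
  "Ck_curve_on k A S \<gamma> \<longleftrightarrow> continuous_on S \<gamma> \<and>
     (\<forall>t\<in>S. \<forall>c\<in>A. \<gamma> t \<in> dom_chart c \<longrightarrow>
        (\<exists>J h. open J \<and> t \<in> J \<and> \<gamma> ` (J \<inter> S) \<subseteq> dom_chart c \<and> Ck_on k J h \<and>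
               (\<forall>s\<in>J \<inter> S. h s = coord c (\<gamma> s))))"

definition velocity ::
    "('m, 'e::euclidean_space) chart set \<Rightarrow> real set \<Rightarrow> (real \<Rightarrow> 'm) \<Rightarrow> real \<Rightarrow> ('m, 'e) tangent_vector"
  where
  "velocity A S \<gamma> t = (\<lambda>c. if c \<in> A \<and> \<gamma> t \<in> dom_chart c
      then vector_derivative (coord c \<circ> \<gamma>) (at t within S) else 0)"

text \<open>Tangent vectors to a subset \<open>Z\<close> are the velocities of \<open>C\<^sup>1\<close> curves in \<open>Z\<close>; if \<open>Z\<close> is
  a \<open>C\<^sup>1\<close> submanifold (such as a regular level set of a \<open>C\<^sup>1\<close> function) this is its usual
  tangent space.\<close>

definition tangent_space_of_subset ::
    "('m::topological_space, 'e::euclidean_space) chart set \<Rightarrow> 'm set \<Rightarrow> 'm \<Rightarrow> ('m, 'e) tangent_vector set"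
  where
  "tangent_space_of_subset A Z p =
     {velocity A {-1<..<1} \<sigma> 0 | \<sigma>.
        Ck_curve_on 1 A {-1<..<1} \<sigma> \<and> \<sigma> ` {-1<..<1} \<subseteq> Z \<and> \<sigma> 0 = p}"

text \<open>Transversality of a curve \<open>[0,1] \<rightarrow> M\<close> to \<open>Z\<close>: at every parameter \<open>t\<close> with
  \<open>\<gamma>(t) \<in> Z\<close>, the image of the differential of \<open>\<gamma>\<close> and the tangent space of \<open>Z\<close> together
  span the tangent space of \<open>M\<close>.\<close>

definition curve_transverse ::
    "('m::topological_space, 'e::euclidean_space) chart set \<Rightarrow> (real \<Rightarrow> 'm) \<Rightarrow> 'm set \<Rightarrow> bool" where
  "curve_transverse A \<gamma> Z \<longleftrightarrow>
     (\<forall>t\<in>{0..1}. \<gamma> t \<in> Z \<longrightarrow>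
        {(\<lambda>c. s *\<^sub>R velocity A {0..1} \<gamma> t c + w c) | s w. w \<in> tangent_space_of_subset A Z (\<gamma> t)}
        = tangent_space A (\<gamma> t))"

section \<open>Riemannian metrics\<close>

definition riemannian_metric ::
    "('m, 'e::euclidean_space) chart set
      \<Rightarrow> ('m \<Rightarrow> ('m, 'e) tangent_vector \<Rightarrow> ('m, 'e) tangent_vector \<Rightarrow> real) \<Rightarrow> bool" where
  "riemannian_metric A g \<longleftrightarrow>
     (\<forall>p. \<forall>u\<in>tangent_space A p. \<forall>v\<in>tangent_space A p. \<forall>w\<in>tangent_space A p. \<forall>a b.
        g p u v = g p v u \<and>
        g p (\<lambda>c. a *\<^sub>R u c + b *\<^sub>R v c) w = a * g p u w + b * g p v w \<and>
        (u \<noteq> (\<lambda>c. 0) \<longrightarrow> g p u u > 0)) \<and>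
     (\<forall>c\<in>A. \<forall>e e'. Ck_on \<infinity> (coord c ` dom_chart c)
        (\<lambda>x. g (inv_chart c x) (coordinate_vector A c (inv_chart c x) e)
               (coordinate_vector A c (inv_chart c x) e')))"

text \<open>\<open>J\<^sub>p f = \<parallel>d\<^sub>p f\<parallel>\<close> for scalar \<open>f\<close>, the norm being dual to the one given by \<open>g\<close>.\<close>

definition jacobian ::
    "('m, 'e::euclidean_space) chart set
      \<Rightarrow> ('m \<Rightarrow> ('m, 'e) tangent_vector \<Rightarrow> ('m, 'e) tangent_vector \<Rightarrow> real)
      \<Rightarrow> 'm \<Rightarrow> ('m \<Rightarrow> real) \<Rightarrow> real" where
  "jacobian A g p f = (SUP v \<in> {v \<in> tangent_space A p. g p v v \<le> 1}. \<bar>differential A f p v\<bar>)"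

section \<open>The space of continuously differentiable functions\<close>

definition C1_functions :: "('m, 'e::euclidean_space) chart set \<Rightarrow> ('m \<Rightarrow> real) set" where
  "C1_functions A = {f. \<forall>c\<in>A. Ck_on 1 (coord c ` dom_chart c) (f \<circ> inv_chart c)}"

text \<open>The weak Whitney (compact-open \<open>C\<^sup>1\<close>) topology, by its usual subbasis.\<close>

definition C1_subbasic ::
    "('m::topological_space, 'e::euclidean_space) chart set
      \<Rightarrow> ('m \<Rightarrow> real) \<Rightarrow> ('m, 'e) chart \<Rightarrow> 'm set \<Rightarrow> real \<Rightarrow> ('m \<Rightarrow> real) set" where
  "C1_subbasic A f c K \<epsilon> = {h \<in> C1_functions A. \<forall>p\<in>K.
      \<bar>h p - f p\<bar> < \<epsilon> \<and>
      onorm (\<lambda>v. frechet_derivative (h \<circ> inv_chart c) (at (coord c p)) v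
                - frechet_derivative (f \<circ> inv_chart c) (at (coord c p)) v) < \<epsilon>}"

definition C1_topology ::
    "('m::topological_space, 'e::euclidean_space) chart set \<Rightarrow> ('m \<Rightarrow> real) topology" where
  "C1_topology A = topology_generated_by
     {C1_subbasic A f c K \<epsilon> | f c K \<epsilon>.
        f \<in> C1_functions A \<and> c \<in> A \<and> compact K \<and> K \<subseteq> dom_chart c \<and> \<epsilon> > 0}"

definition C1_borel ::
    "('m::topological_space, 'e::euclidean_space) chart set \<Rightarrow> ('m \<Rightarrow> real) measure" where
  "C1_borel A = sigma (C1_functions A) {U. openin (C1_topology A) U}"

section \<open>Scalar z-KROK random fields\<close>

definition zero_set :: "('m \<Rightarrow> real) \<Rightarrow> 'm set" where
  "zero_set f = {p. f p = 0}"

definition zero_regular_value ::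
    "('m, 'e::euclidean_space) chart set \<Rightarrow> ('m \<Rightarrow> real) \<Rightarrow> bool" where
  "zero_regular_value A f \<longleftrightarrow> (\<forall>p\<in>zero_set f. differential A f p ` tangent_space A p = UNIV)"

definition regular_conditional_prob ::
    "('m::topological_space, 'e::euclidean_space) chart set \<Rightarrow> 'w measure \<Rightarrow> ('w \<Rightarrow> 'm \<Rightarrow> real) \<Rightarrow> 'm
      \<Rightarrow> (real \<Rightarrow> ('m \<Rightarrow> real) measure) \<Rightarrow> bool" where
  "regular_conditional_prob A P X p \<nu> \<longleftrightarrow>
     (\<forall>x. prob_space (\<nu> x) \<and> space (\<nu> x) = C1_functions A \<and> sets (\<nu> x) = sets (C1_borel A)) \<and>
     (\<forall>B\<in>sets (C1_borel A). (\<lambda>x. emeasure (\<nu> x) B) \<in> borel_measurable borel) \<and>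
     (\<forall>B\<in>sets (C1_borel A). \<forall>V\<in>sets borel.
        emeasure P {\<omega>\<in>space P. X \<omega> \<in> B \<and> X \<omega> p \<in> V}
        = (\<integral>\<^sup>+x\<in>V. emeasure (\<nu> x) B \<partial>distr P borel (\<lambda>\<omega>. X \<omega> p)))"

definition J_measure ::
    "('m, 'e::euclidean_space) chart set
      \<Rightarrow> ('m \<Rightarrow> ('m, 'e) tangent_vector \<Rightarrow> ('m, 'e) tangent_vector \<Rightarrow> real)
      \<Rightarrow> 'm \<Rightarrow> ('m \<Rightarrow> real) measure \<Rightarrow> ('m \<Rightarrow> real) measure" where
  "J_measure A g p \<nu> = density \<nu> (\<lambda>f. ennreal (jacobian A g p f))"

text \<open>The densities \<open>\<rho>\<close> and the conditional laws \<open>\<mu>\<close> are explicit arguments because the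
  expectations conditional on \<open>X(p) = 0\<close> refer to them.\<close>

definition zKROK ::
    "('m::{t2_space,second_countable_topology}, 'e::euclidean_space) chart set
      \<Rightarrow> ('m \<Rightarrow> ('m, 'e) tangent_vector \<Rightarrow> ('m, 'e) tangent_vector \<Rightarrow> real)
      \<Rightarrow> 'w measure \<Rightarrow> ('w \<Rightarrow> 'm \<Rightarrow> real)
      \<Rightarrow> ('m \<Rightarrow> real \<Rightarrow> real) \<Rightarrow> ('m \<Rightarrow> real \<Rightarrow> ('m \<Rightarrow> real) measure) \<Rightarrow> bool" where
  "zKROK A g P X \<rho> \<mu> \<longleftrightarrow>
     prob_space P \<and> X \<in> measurable P (C1_borel A) \<and>
     (AE \<omega> in P. zero_regular_value A (X \<omega>)) \<and>
     (\<forall>p. (\<forall>x. 0 \<le> \<rho> p x) \<and> distributed P lborel (\<lambda>\<omega>. X \<omega> p) (\<lambda>x. ennreal (\<rho> p x))) \<and>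
     (\<forall>p. isCont (\<lambda>(q, x). \<rho> q x) (p, 0)) \<and>
     (\<forall>p. regular_conditional_prob A P X p (\<mu> p)) \<and>
     (\<forall>p x. finite_measure (J_measure A g p (\<mu> p x))) \<and>
     (\<forall>\<Phi>. continuous_map (C1_topology A) euclideanreal \<Phi> \<and> bounded (\<Phi> ` C1_functions A) \<longrightarrow>
        (\<forall>p. isCont (\<lambda>(q, x). \<integral>f. \<Phi> f \<partial>J_measure A g q (\<mu> q x)) (p, 0)))"

section \<open>The semi Finsler structure and length\<close>

definition finsler_of_field ::
    "('m, 'e::euclidean_space) chart set \<Rightarrow> ('m \<Rightarrow> real \<Rightarrow> real)
      \<Rightarrow> ('m \<Rightarrow> real \<Rightarrow> ('m \<Rightarrow> real) measure) \<Rightarrow> 'm \<Rightarrow> ('m, 'e) tangent_vector \<Rightarrow> real" where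
  "finsler_of_field A \<rho> \<mu> p v = \<rho> p 0 / 2 * (\<integral>f. \<bar>differential A f p v\<bar> \<partial>\<mu> p 0)"

definition finsler_length ::
    "('m, 'e::euclidean_space) chart set \<Rightarrow> ('m \<Rightarrow> ('m, 'e) tangent_vector \<Rightarrow> real)
      \<Rightarrow> (real \<Rightarrow> 'm) \<Rightarrow> real" where
  "finsler_length A F \<gamma> = (LINT t:{0..1}|lborel. F (\<gamma> t) (velocity A {0..1} \<gamma> t))"

text \<open>The number, possibly infinite, of parameters at which the curve meets \<open>Z\<close>.\<close>

definition curve_count :: "(real \<Rightarrow> 'm) \<Rightarrow> 'm set \<Rightarrow> ennreal" where
  "curve_count \<gamma> Z = emeasure (count_space UNIV) {t\<in>{0..1}. \<gamma> t \<in> Z}"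

end

theory Submission
  imports Defs
begin

text \<open>
  Put \<open>h(t) = X(\<gamma>(t))\<close>.  Transversality and regularity of \<open>0\<close> make \<open>h'\<close> nonzero at the zeros of \<open>h\<close>,
  almost surely, so the zeros are counted by the limit of \<open>(1/2\<delta>) \<integral> \<bar>h'\<bar> 1{\<bar>h\<bar> < \<delta>} dt\<close>, whose expectation
  disintegrates over the values of \<open>h(t)\<close>.  To interchange limit and expectation, a zero is weighted
  by a cutoff that is positive at \<open>t\<close> only if \<open>\<bar>h'\<bar> > 1/(n+1)\<close> on the window of radius
  \<open>1/(n+1)\<close> around \<open>t\<close>.  As \<open>h\<close> is injective on such windows, the weighted averages are at most
  \<open>n+1\<close> and dominated convergence applies.  On the other side, \<open>\<bar>h'(t)\<bar>\<close> times the cutoff is \<open>J\<close>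
  times a bounded function which is jointly continuous in \<open>t\<close> and the field, so the weak continuity of
  \<open>J\<^sub>p \<cdot> \<mu>(p,x)\<close> gives the limit at \<open>x = 0\<close>.  Finally \<open>n \<rightarrow> \<infinity>\<close>, by monotone convergence on both sides.
\<close>

section \<open>Crossings of a function on the unit interval\<close>

text \<open>The number of zeros has no evident integrable majorant. Truncating by |h'| > c at the
  zero alone would not bound that number, since steep zeros may be arbitrarily close together; a
  lower bound on a whole window keeps them apart. On the probabilistic side only bounded continuous
  functions may be tested against J \<cdot> \<mu>, while |h'| is unbounded. Its quotient by J is
  bounded, because compactness of [0,1] gives |h'| \<le> L J, but it may be discontinuous where J
  vanishes. The same cutoff repairs this: where it is positive, J > 1/((n+1) L). Continuity of the
  density and of J \<cdot> \<mu> is given only at level 0, so compactness of [0,1] has to supply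
  uniformity in t for values x near 0. The test function moves with t together with the measure,
  which calls for a separate argument on its oscillation. A zero at an endpoint of [0,1] would be
  counted by half; it is excluded almost surely because X(\<gamma>(0)) and X(\<gamma>(1)) have
  densities. The length is a real integral, with default value 0, so its integrand must be shown
  bounded before the two sides can be compared in [0,\<infinity>].\<close>

text \<open>Change of variables and the strict monotonicity criteria below use two-sided
  derivatives, also at the endpoints, whereas \<open>h\<close> is only differentiable within the
  interval. Continuing \<open>d\<close> by constants and integrating supplies them.\<close>

lemma C1_extension:
  fixes h d :: "real \<Rightarrow> real"
  assumes "a \<le> b" and d: "continuous_on {a..b} d"
    and h: "\<And>x. x \<in> {a..b} \<Longrightarrow> (h has_real_derivative d x) (at x within {a..b})"
  obtains H where "\<And>x. x \<in> {a..b} \<Longrightarrow> H x = h x"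
    and "\<And>x. x \<in> {a..b} \<Longrightarrow> (H has_real_derivative d x) (at x)"
proof -
  define D where "D x = d (max a (min b x))" for x
  have contD: "continuous_on {a - 1..b + 1} D"
    unfolding D_def using \<open>a \<le> b\<close>
    by (intro continuous_on_compose2[OF d] continuous_intros) auto
  \<comment> \<open>The primitive starts at a - 1 and \<open>D\<close> is used on [a-1, b+1], so
    that both endpoints of [a,b] become interior points; the additive constants normalise
    \<open>H a = h a\<close>.\<close>
  define H where "H x = integral {a - 1..x} D - integral {a - 1..a} D + h a" for x
  have H: "(H has_real_derivative d x) (at x)" if "x \<in> {a..b}" for x
  proof -
    have "((\<lambda>u. integral {a - 1..u} D) has_vector_derivative D x) (at x within {a - 1..b + 1})"
      using that by (intro integral_has_vector_derivative contD) auto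
    moreover have "at x within {a - 1..b + 1} = at x"
      using that by (intro at_within_interior) auto
    moreover have "D x = d x" using that by (simp add: D_def)
    ultimately show ?thesis unfolding H_def
      by (auto intro!: derivative_eq_intros simp: has_real_derivative_iff_has_vector_derivative[symmetric])
  qed
  have "H x = h x" if "x \<in> {a..b}" for x
  proof -
    have "((\<lambda>x. H x - h x) has_real_derivative 0) (at y within {a..b})" if "y \<in> {a..b}" for y
      using DERIV_diff[OF has_field_derivative_at_within[OF H[OF that]] h[OF that]] by simp
    then have "H x - h x = H a - h a"
      using has_field_derivative_zero_constant[of "{a..b}" "\<lambda>x. H x - h x"] that \<open>a \<le> b\<close>
      by (metis (no_types, lifting) atLeastAtMost_iff convex_real_interval(5) order_refl)
    then show ?thesis by (simp add: H_def)
  qed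
  with H that show thesis by blast
qed

lemma nn_integral_substitution_mono:
  fixes h d :: "real \<Rightarrow> real"
  assumes "a \<le> b" "continuous_on {a..b} d" "\<And>x. x \<in> {a..b} \<Longrightarrow> d x \<ge> 0"
    and "\<And>x. x \<in> {a..b} \<Longrightarrow> (h has_real_derivative d x) (at x within {a..b})"
    and B: "B \<in> sets borel"
  shows "(\<integral>\<^sup>+x. ennreal (d x) * indicator B (h x) * indicator {a..b} x \<partial>lborel)
    = emeasure lborel (B \<inter> {h a..h b})"
proof -
  obtain H where H: "\<And>x. x \<in> {a..b} \<Longrightarrow> H x = h x"
      "\<And>x. x \<in> {a..b} \<Longrightarrow> (H has_real_derivative d x) (at x)"
    using C1_extension[OF assms(1,2,4)] by metis
  have "(\<integral>\<^sup>+x. ennreal (d x) * indicator B (h x) * indicator {a..b} x \<partial>lborel)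
    = (\<integral>\<^sup>+x. ennreal ((indicator B (H x) :: real) * d x * indicator {a..b} x) \<partial>lborel)"
    using H(1) assms(3) by (intro nn_integral_cong) (auto simp: indicator_def)
  also have "\<dots> = (\<integral>\<^sup>+x. ennreal ((indicator B x :: real) * indicator {H a..H b} x) \<partial>lborel)"
    using assms H B
    by (intro nn_integral_substitution[symmetric]) (auto simp: set_borel_measurable_def)
  also have "\<dots> = (\<integral>\<^sup>+x. indicator (B \<inter> {h a..h b}) x \<partial>lborel)"
    using H(1) \<open>a \<le> b\<close> by (intro nn_integral_cong) (auto simp: indicator_def)
  also have "\<dots> = emeasure lborel (B \<inter> {h a..h b})" using B by simp
  finally show ?thesis .
qed

lemma nonvanishing_sign:
  fixes d :: "real \<Rightarrow> real"
  assumes "continuous_on {a..b} d" "\<And>x. x \<in> {a..b} \<Longrightarrow> d x \<noteq> 0"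
  shows "(\<forall>x\<in>{a..b}. d x > 0) \<or> (\<forall>x\<in>{a..b}. d x < 0)"
proof (rule ccontr)
  assume "\<not> ?thesis"
  then obtain x y where xy: "x \<in> {a..b}" "y \<in> {a..b}" "d x < 0" "d y > 0"
    using assms(2) by (metis linorder_neqE_linordered_idom)
  have "connected (d ` {a..b})" by (intro connected_continuous_image assms) auto
  then have "0 \<in> d ` {a..b}"
    using xy connectedD_interval[of "d ` {a..b}" "d x" "d y" 0] by auto
  then show False using assms(2) by auto
qed

text \<open>The area formula on an interval where \<open>h\<close> is strictly monotone. Symmetry of
  \<open>B\<close> lets the decreasing case be read as the increasing case for -h.\<close>

lemma nn_integral_substitution_nonvanishing:
  fixes h d :: "real \<Rightarrow> real"
  assumes ab: "a \<le> b" "continuous_on {a..b} d" "\<And>x. x \<in> {a..b} \<Longrightarrow> d x \<noteq> 0"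
    and h: "\<And>x. x \<in> {a..b} \<Longrightarrow> (h has_real_derivative d x) (at x within {a..b})"
    and B: "B \<in> sets borel" "uminus ` B = B"
  shows "(\<forall>x\<in>{a..b}. d x > 0) \<and>
      (\<integral>\<^sup>+x. ennreal \<bar>d x\<bar> * indicator B (h x) * indicator {a..b} x \<partial>lborel)
      = emeasure lborel (B \<inter> {h a..h b}) \<or>
    (\<forall>x\<in>{a..b}. d x < 0) \<and> (\<integral>\<^sup>+x. ennreal \<bar>d x\<bar> * indicator B (h x) * indicator {a..b} x \<partial>lborel)
      = emeasure lborel (B \<inter> {- h a..- h b})"
  using nonvanishing_sign[OF ab(2,3)]
proof
  assume pos: "\<forall>x\<in>{a..b}. d x > 0"
  have "(\<integral>\<^sup>+x. ennreal \<bar>d x\<bar> * indicator B (h x) * indicator {a..b} x \<partial>lborel)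
      = (\<integral>\<^sup>+x. ennreal (d x) * indicator B (h x) * indicator {a..b} x \<partial>lborel)"
    using pos by (intro nn_integral_cong) (auto simp: indicator_def less_imp_le)
  also have "\<dots> = emeasure lborel (B \<inter> {h a..h b})"
    using pos by (intro nn_integral_substitution_mono ab h B) (auto intro: less_imp_le)
  finally show ?thesis using pos by blast
next
  assume neg: "\<forall>x\<in>{a..b}. d x < 0"
  have *: "x \<in> B \<longleftrightarrow> - x \<in> B" for x using B(2) by (metis imageI minus_minus)
  have "(\<integral>\<^sup>+x. ennreal \<bar>d x\<bar> * indicator B (h x) * indicator {a..b} x \<partial>lborel)
      = (\<integral>\<^sup>+x. ennreal (- d x) * indicator B (- h x) * indicator {a..b} x \<partial>lborel)"
    using neg * by (intro nn_integral_cong) (auto simp: indicator_def abs_of_neg)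
  also have "\<dots> = emeasure lborel (B \<inter> {- h a..- h b})"
    using neg h by (intro nn_integral_substitution_mono ab continuous_intros B)
      (auto intro: less_imp_le intro!: derivative_intros)
  finally show ?thesis using neg by blast
qed

section \<open>Windows and cutoffs\<close>

text \<open>The infimum runs over shifts u, with t + u clamped to [0,1], rather than over the points
  of a window around t: the index set is then one compact interval for all t, which the continuity
  proof relies on.\<close>

definition window_min :: "nat \<Rightarrow> (real \<Rightarrow> real) \<Rightarrow> real \<Rightarrow> real" where
  "window_min n d t = (INF u\<in>{-1/Suc n..1/Suc n}. \<bar>d (max 0 (min 1 (t + u)))\<bar>)"

text \<open>A ramp in the window minimum: it vanishes up to 1/(n+1) and equals 1 from 2/(n+1) on. A
  ramp instead of an indicator keeps the weight continuous.\<close>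

definition cutoff :: "nat \<Rightarrow> (real \<Rightarrow> real) \<Rightarrow> real \<Rightarrow> real" where
  "cutoff n d t = max 0 (min 1 (Suc n * window_min n d t - 1))"

lemma cutoff_bounds: "0 \<le> cutoff n d t" "cutoff n d t \<le> 1"
  by (auto simp: cutoff_def)

lemma window_min_nonneg: "0 \<le> window_min n d t"
  unfolding window_min_def by (rule cINF_greatest) (auto simp: divide_simps)

lemma window_min_le:
  assumes "s \<in> {0..1}" "\<bar>s - t\<bar> \<le> 1 / Suc n"
  shows "window_min n d t \<le> \<bar>d s\<bar>"
proof -
  have "bdd_below ((\<lambda>u. \<bar>d (max 0 (min 1 (t + u)))\<bar>) ` {-1/Suc n..1/Suc n})"
    by (rule bdd_belowI[where m=0]) auto
  then have "window_min n d t \<le> \<bar>d (max 0 (min 1 (t + (s - t))))\<bar>"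
    unfolding window_min_def using assms(2) by (intro cINF_lower) (auto simp: abs_le_iff)
  also have "max 0 (min 1 (t + (s - t))) = s" using assms(1) by auto
  finally show ?thesis .
qed

lemma cutoff_pos_imp:
  assumes "cutoff n d t > 0" "s \<in> {0..1}" "\<bar>s - t\<bar> \<le> 1 / Suc n"
  shows "\<bar>d s\<bar> > 1 / Suc n"
proof -
  have "1 < Suc n * window_min n d t" using assms(1) by (auto simp: cutoff_def max_def min_def split: if_splits)
  then have "1 / Suc n < window_min n d t" by (simp add: field_simps)
  also have "\<dots> \<le> \<bar>d s\<bar>" using assms by (intro window_min_le)
  finally show ?thesis .
qed

text \<open>Raising n shrinks the window, which raises the infimum, and also steepens the ramp; both
  effects increase the weight.\<close>

lemma cutoff_mono: "cutoff n d t \<le> cutoff (Suc n) d t"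
proof -
  have "window_min n d t \<le> window_min (Suc n) d t"
    unfolding window_min_def
  proof (rule cINF_superset_mono)
    have "1 / real (Suc (Suc n)) \<le> 1 / Suc n" by (simp add: field_simps)
    then show "{-1/real (Suc (Suc n))..1/Suc (Suc n)} \<subseteq> {-1/Suc n..1/real (Suc n)}" by auto
  qed (auto simp: divide_simps intro!: bdd_belowI[where m=0])
  then have "Suc n * window_min n d t \<le> Suc (Suc n) * window_min (Suc n) d t"
    by (intro mult_mono window_min_nonneg) auto
  then show ?thesis unfolding cutoff_def by auto
qed

lemma eventually_inverse_Suc_less: "0 < r \<Longrightarrow> eventually (\<lambda>n. 1 / real (Suc n) < r) sequentially"
  using LIMSEQ_inverse_real_of_nat by (auto simp: inverse_eq_divide dest: order_tendstoD)

lemma eventually_cutoff_eq_1: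
  assumes d: "continuous_on {0..1} d" and t: "t \<in> {0..1}" "d t \<noteq> 0"
  shows "eventually (\<lambda>n. cutoff n d t = 1) sequentially"
proof -
  obtain r where r: "r > 0" "\<And>s. s \<in> {0..1} \<Longrightarrow> dist s t < r \<Longrightarrow> dist (d s) (d t) < \<bar>d t\<bar> / 2"
    using d t unfolding continuous_on_iff by (metis half_gt_zero zero_less_abs_iff)
  have "eventually (\<lambda>n. 1 / real (Suc n) < r) sequentially"
    by (rule eventually_inverse_Suc_less[OF r(1)])
  \<comment> \<open>On small windows |d| is at least |d t|/2 by continuity; full weight needs (n+1)
    |d t|/2 \<ge> 2, whence the 4.\<close>
  moreover have "eventually (\<lambda>n. 4 / \<bar>d t\<bar> \<le> real n) sequentially"
    using filterlim_real_sequentially by (auto simp: filterlim_at_top)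
  ultimately show ?thesis
  proof eventually_elim
    case (elim n)
    have "\<bar>d t\<bar> / 2 \<le> \<bar>d (max 0 (min 1 (t + u)))\<bar>" if "u \<in> {-1/Suc n..1/Suc n}" for u
    proof -
      have "\<bar>u\<bar> < r" using that elim by (auto simp: abs_less_iff)
      then have "dist (max 0 (min 1 (t + u))) t < r" using t by (auto simp: dist_real_def)
      then have "dist (d (max 0 (min 1 (t + u)))) (d t) < \<bar>d t\<bar> / 2" by (intro r(2)) auto
      then show ?thesis unfolding dist_real_def by linarith
    qed
    then have "\<bar>d t\<bar> / 2 \<le> window_min n d t"
      unfolding window_min_def by (intro cINF_greatest) (auto simp: divide_simps)
    then have "Suc n * (\<bar>d t\<bar> / 2) \<le> Suc n * window_min n d t" by (intro mult_left_mono) auto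
    moreover have "4 \<le> real n * \<bar>d t\<bar>" using elim(2) t(2) by (simp add: field_simps)
    then have "2 \<le> Suc n * (\<bar>d t\<bar> / 2)" by (simp add: field_simps)
    ultimately have "2 \<le> Suc n * window_min n d t" by linarith
    then show ?case unfolding cutoff_def by linarith
  qed
qed

section \<open>Counting zeros by band averages\<close>

text \<open>Kac's counting integral for a band of half-width \<delta> = 1/(k+1): the prefactor is
  1/(2\<delta>), and \<open>w\<close> is the weight given to a zero.\<close>

definition band_average :: "(real \<Rightarrow> real) \<Rightarrow> (real \<Rightarrow> real) \<Rightarrow> (real \<Rightarrow> real) \<Rightarrow> nat \<Rightarrow> ennreal" where
  "band_average h d w k = ennreal (Suc k / 2) *
     (\<integral>\<^sup>+t. ennreal (\<bar>d t\<bar> * w t) * indicator {-1/Suc k<..<1/Suc k} (h t) * indicator {0..1} t \<partial>lborel)"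

lemma continuous_band_measurable:
  fixes h F :: "real \<Rightarrow> real"
  assumes "continuous_on {0..1} F" "continuous_on {0..1} h" "S \<subseteq> {0..1}" "S \<in> sets borel" "B \<in> sets borel"
  shows "(\<lambda>t. ennreal (F t) * indicator B (h t) * indicator S t) \<in> borel_measurable lborel"
proof -
  have [measurable]: "(\<lambda>t. indicator {0..1} t * F t) \<in> borel_measurable borel"
      "(\<lambda>t. indicator {0..1} t * h t) \<in> borel_measurable borel"
    using borel_measurable_continuous_on_indicator[of "{0..1}" h]
      borel_measurable_continuous_on_indicator[of "{0..1}" F] assms by auto
  have [measurable]: "S \<in> sets borel" "B \<in> sets borel" by fact+
  have "(\<lambda>t. ennreal (indicator {0..1} t * F t) * indicator B (indicator {0..1} t * h t) * indicator S t)
      \<in> borel_measurable lborel"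
    by measurable
  also have "?this \<longleftrightarrow> ?thesis"
    using assms(3) by (intro measurable_cong) (auto simp: indicator_def)
  finally show ?thesis .
qed

text \<open>Cut [0,1] into n+1 cells of length 1/(n+1). If the cutoff is positive somewhere in a
  cell, the window of that point covers the cell, so \<open>h\<close> is strictly monotone there and
  the cell contributes at most the length 2/(k+1) of the band, which the prefactor cancels. Other
  cells contribute nothing.\<close>

lemma band_average_cutoff_le:
  assumes d: "continuous_on {0..1} d"
    and h: "\<And>t. t \<in> {0..1} \<Longrightarrow> (h has_real_derivative d t) (at t within {0..1})"
  shows "band_average h d (cutoff n d) k \<le> ennreal (Suc n)"
proof -
  define B :: "real set" where "B = {-1/Suc k<..<1/Suc k}"
  have B: "B \<in> sets borel" "uminus ` B = B" "emeasure lborel B = ennreal (2 / Suc k)"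
    by (auto simp: B_def field_simps)
  define I where "I i = {real i / Suc n..real (Suc i) / Suc n}" for i
  define G where "G = {i. i < Suc n \<and> (\<exists>t\<in>I i. cutoff n d t > 0)}"
  have I: "I i \<subseteq> {0..1}" if "i < Suc n" for i
    using that by (auto simp: I_def field_simps)
  have cover: "\<exists>i<Suc n. t \<in> I i" if "t \<in> {0..1}" for t
  proof (cases "t = 1")
    \<comment> \<open>The floor of t (n+1) is a valid cell index except at t = 1, where it would be
      n+1; that point lies in the last cell, number n.\<close>
    case True then show ?thesis by (intro exI[of _ n]) (auto simp: I_def field_simps)
  next
    case False
    define i where "i = nat \<lfloor>t * Suc n\<rfloor>"
    have "t * real (Suc n) < 1 * real (Suc n)" using False that by (intro mult_strict_right_mono) auto
    have "0 \<le> t * Suc n" using that by simp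
    then have i: "real i \<le> t * Suc n" "t * Suc n \<le> real i + 1"
      unfolding i_def by linarith+
    then have "i < Suc n" using \<open>t * real (Suc n) < 1 * real (Suc n)\<close>
      by (simp only: mult_1 of_nat_less_iff[symmetric, where 'a=real])
    moreover note i
    ultimately show ?thesis by (intro exI[of _ i]) (auto simp: I_def field_simps)
  qed
  have each: "(\<integral>\<^sup>+t. ennreal \<bar>d t\<bar> * indicator B (h t) * indicator (I i) t \<partial>lborel) \<le> ennreal (2 / Suc k)"
    if "i \<in> G" for i
  proof -
    have i: "i < Suc n" using that by (simp add: G_def)
    obtain t where t: "t \<in> I i" "cutoff n d t > 0" using \<open>i \<in> G\<close> by (auto simp: G_def)
    have ne: "d s \<noteq> 0" if "s \<in> I i" for s
    proof -
      have "\<bar>s - t\<bar> \<le> 1 / Suc n" using t(1) that by (auto simp: I_def add_divide_distrib abs_le_iff)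
      then show ?thesis using cutoff_pos_imp[OF t(2), of s] I[OF i] that
        by (metis abs_zero divide_nonneg_nonneg leD of_nat_0_le_iff subsetD zero_le_one)
    qed
    have le: "real i / Suc n \<le> real (Suc i) / Suc n" by (intro divide_right_mono) auto
    have "(h has_real_derivative d t) (at t within I i)" if "t \<in> I i" for t
      using h[of t] I[OF i] that by (meson has_field_derivative_subset subsetD)
    moreover have "continuous_on (I i) d" using continuous_on_subset[OF d I[OF i]] .
    ultimately have "(\<integral>\<^sup>+t. ennreal \<bar>d t\<bar> * indicator B (h t) * indicator (I i) t \<partial>lborel) \<le> emeasure lborel B"
      using nn_integral_substitution_nonvanishing[OF le, of d h B] ne B
        emeasure_mono[of "B \<inter> _" B lborel] unfolding I_def by fastforce
    then show ?thesis using B(3) by simp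
  qed
  have "(\<integral>\<^sup>+t. ennreal (\<bar>d t\<bar> * cutoff n d t) * indicator B (h t) * indicator {0..1} t \<partial>lborel)
    \<le> (\<integral>\<^sup>+t. (\<Sum>i\<in>G. ennreal \<bar>d t\<bar> * indicator B (h t) * indicator (I i) t) \<partial>lborel)"
  proof (rule nn_integral_mono)
    fix t :: real
    show "ennreal (\<bar>d t\<bar> * cutoff n d t) * indicator B (h t) * indicator {0..1} t
      \<le> (\<Sum>i\<in>G. ennreal \<bar>d t\<bar> * indicator B (h t) * indicator (I i) t)"
    proof (cases "t \<in> {0..1} \<and> cutoff n d t > 0")
      case True
      then obtain i where i: "i \<in> G" "t \<in> I i" using cover[of t] unfolding G_def by blast
      have "ennreal (\<bar>d t\<bar> * cutoff n d t) * indicator B (h t) * indicator {0..1} t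
        \<le> ennreal \<bar>d t\<bar> * indicator B (h t) * indicator (I i) t"
        using True i cutoff_bounds[of n d t]
        by (auto simp: indicator_def intro!: ennreal_leI mult_left_le)
      also have "\<dots> \<le> (\<Sum>i\<in>G. ennreal \<bar>d t\<bar> * indicator B (h t) * indicator (I i) t)"
        using i by (intro member_le_sum[of i G]) (auto simp: G_def)
      finally show ?thesis .
    next
      case False
      then show ?thesis using cutoff_bounds[of n d t]
        by (auto simp: indicator_def not_less)
    qed
  qed
  also have "\<dots> = (\<Sum>i\<in>G. \<integral>\<^sup>+t. ennreal \<bar>d t\<bar> * indicator B (h t) * indicator (I i) t \<partial>lborel)"
    using DERIV_continuous_on[OF h] d B(1) I
    by (intro nn_integral_sum continuous_band_measurable) (auto simp: G_def I_def intro!: continuous_intros)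
  also have "\<dots> \<le> (\<Sum>i\<in>G. ennreal (2 / Suc k))" by (intro sum_mono each)
  also have "\<dots> = of_nat (card G) * ennreal (2 / Suc k)" by simp
  also have "\<dots> \<le> of_nat (Suc n) * ennreal (2 / Suc k)"
    using card_mono[of "{..<Suc n}" G] by (intro mult_right_mono of_nat_mono) (auto simp: G_def)
  finally have "band_average h d (cutoff n d) k \<le> ennreal (Suc k / 2) * (of_nat (Suc n) * ennreal (2 / Suc k))"
    unfolding band_average_def B_def by (intro mult_left_mono) auto
  also have "\<dots> = ennreal (Suc k / 2 * (Suc n * (2 / Suc k)))"
    by (simp only: ennreal_of_nat_eq_real_of_nat) (simp add: ennreal_mult[symmetric] del: of_nat_Suc)
  also have "Suc k / 2 * (Suc n * (2 / Suc k)) = real (Suc n)" by (simp add: field_simps)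
  finally show ?thesis .
qed

text \<open>Infinitely many zeros would accumulate at some z in [0,1], again a zero; the difference
  quotient at z vanishes along them although its limit \<open>d z\<close> is not 0.\<close>

lemma finite_nondegenerate_zeros:
  fixes h d :: "real \<Rightarrow> real"
  assumes h: "\<And>t. t \<in> {0..1} \<Longrightarrow> (h has_real_derivative d t) (at t within {0..1})"
    and nz: "\<And>t. t \<in> {0..1} \<Longrightarrow> h t = 0 \<Longrightarrow> d t \<noteq> 0"
  shows "finite {t\<in>{0..1}. h t = 0}"
proof (rule ccontr)
  assume inf: "infinite {t\<in>{0..1}. h t = 0}"
  have "{t\<in>{0..1}. h t = 0} \<subseteq> {0..1}" by auto
  with inf obtain z where z: "z islimpt {t\<in>{0..1}. h t = 0}"
    using compact_eq_Bolzano_Weierstrass[of "{0..1::real}"] compact_Icc by blast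
  have ch: "continuous_on {0..1} h" by (rule DERIV_continuous_on[OF h])
  have "closed {t\<in>{0..1}. h t = 0}"
    by (rule continuous_closed_preimage_constant[OF ch closed_atLeastAtMost])
  with z have "z \<in> {t\<in>{0..1}. h t = 0}" unfolding closed_limpt by blast
  then have zZ: "z \<in> {0..1}" "h z = 0" by auto
  have "((\<lambda>y. (h y - h z) / (y - z)) \<longlongrightarrow> d z) (at z within {0..1})"
    using h[OF zZ(1)] by (simp add: has_field_derivative_iff)
  then have "eventually (\<lambda>y. (h y - h z) / (y - z) \<noteq> 0) (at z within {0..1})"
    using nz[OF zZ] by (rule tendsto_imp_eventually_ne)
  then have "eventually (\<lambda>y. y \<notin> {t\<in>{0..1}. h t = 0}) (at z)"
    unfolding eventually_at_filter by eventually_elim (use zZ in auto)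
  then show False using z by (simp add: islimpt_iff_eventually)
qed

text \<open>On the window \<open>h\<close> is strictly monotone, vanishes at the centre and has
  modulus at least \<delta> at both ends, so it runs through the whole band (-\<delta>,\<delta>)
  exactly once.\<close>

lemma band_average_window:
  fixes h d :: "real \<Rightarrow> real"
  assumes r: "r > 0" and sub: "{z - r..z + r} \<subseteq> {0..1}"
    and d: "continuous_on {0..1} d" "\<And>t. t \<in> {z - r..z + r} \<Longrightarrow> d t \<noteq> 0"
    and h: "\<And>t. t \<in> {0..1} \<Longrightarrow> (h has_real_derivative d t) (at t within {0..1})"
    and z: "h z = 0" and ends: "\<bar>h (z - r)\<bar> \<ge> \<delta>" "\<bar>h (z + r)\<bar> \<ge> \<delta>" and \<delta>: "\<delta> > 0"
  shows "(\<integral>\<^sup>+t. ennreal \<bar>d t\<bar> * indicator {-\<delta><..<\<delta>} (h t) * indicator {z - r..z + r} t \<partial>lborel)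
    = ennreal (2 * \<delta>)"
proof -
  have h': "(h has_real_derivative d t) (at t within {z - r..z + r})" if "t \<in> {z - r..z + r}" for t
    using h[of t] sub that by (meson has_field_derivative_subset subsetD)
  have d': "continuous_on {z - r..z + r} d" using continuous_on_subset[OF d(1) sub] .
  have le: "z - r \<le> z + r" using r by simp
  obtain H where H: "\<And>x. x \<in> {z - r..z + r} \<Longrightarrow> H x = h x"
      "\<And>x. x \<in> {z - r..z + r} \<Longrightarrow> (H has_real_derivative d x) (at x)"
    using C1_extension[OF le d' h'] by metis
  have sym: "{-\<delta><..<\<delta>} \<in> sets borel" "uminus ` {-\<delta><..<\<delta>} = {-\<delta><..<\<delta>}" by auto
  show ?thesis
  proof (rule disjE[OF nn_integral_substitution_nonvanishing[OF le d' d(2) h' sym]], assumption, assumption, goal_cases)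
    case 1
    then have pos: "\<forall>x\<in>{z - r..z + r}. d x > 0"
      and eq: "(\<integral>\<^sup>+t. ennreal \<bar>d t\<bar> * indicator {-\<delta><..<\<delta>} (h t) * indicator {z - r..z + r} t \<partial>lborel)
        = emeasure lborel ({-\<delta><..<\<delta>} \<inter> {h (z - r)..h (z + r)})"
      by blast+
    have "H (z - r) < H z"
    proof (rule DERIV_pos_imp_increasing[of "z - r" z H])
      fix x assume "z - r \<le> x" "x \<le> z"
      then have "x \<in> {z - r..z + r}" using r by auto
      then show "\<exists>y. (H has_real_derivative y) (at x) \<and> 0 < y" using H(2) pos by blast
    qed (use r in simp)
    moreover have "H z < H (z + r)"
    proof (rule DERIV_pos_imp_increasing[of z "z + r" H])
      fix x assume "z \<le> x" "x \<le> z + r"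
      then have "x \<in> {z - r..z + r}" using r by auto
      then show "\<exists>y. (H has_real_derivative y) (at x) \<and> 0 < y" using H(2) pos by blast
    qed (use r in simp)
    ultimately have "h (z - r) \<le> -\<delta>" "\<delta> \<le> h (z + r)"
      using H(1)[of z] H(1)[of "z - r"] H(1)[of "z + r"] r z ends by auto
    then have "{-\<delta><..<\<delta>} \<inter> {h (z - r)..h (z + r)} = {-\<delta><..<\<delta>}" by auto
    then show ?thesis using eq \<delta> by simp
  next
    case 2
    then have neg: "\<forall>x\<in>{z - r..z + r}. d x < 0"
      and eq: "(\<integral>\<^sup>+t. ennreal \<bar>d t\<bar> * indicator {-\<delta><..<\<delta>} (h t) * indicator {z - r..z + r} t \<partial>lborel)
        = emeasure lborel ({-\<delta><..<\<delta>} \<inter> {- h (z - r)..- h (z + r)})"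
      by blast+
    have "H (z - r) > H z"
    proof (rule DERIV_neg_imp_decreasing[of "z - r" z H])
      fix x assume "z - r \<le> x" "x \<le> z"
      then have "x \<in> {z - r..z + r}" using r by auto
      then show "\<exists>y. (H has_real_derivative y) (at x) \<and> y < 0" using H(2) neg by blast
    qed (use r in simp)
    moreover have "H z > H (z + r)"
    proof (rule DERIV_neg_imp_decreasing[of z "z + r" H])
      fix x assume "z \<le> x" "x \<le> z + r"
      then have "x \<in> {z - r..z + r}" using r by auto
      then show "\<exists>y. (H has_real_derivative y) (at x) \<and> y < 0" using H(2) neg by blast
    qed (use r in simp)
    ultimately have "- h (z - r) \<le> -\<delta>" "\<delta> \<le> - h (z + r)"
      using H(1)[of z] H(1)[of "z - r"] H(1)[of "z + r"] r z ends by auto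
    then have "{-\<delta><..<\<delta>} \<inter> {- h (z - r)..- h (z + r)} = {-\<delta><..<\<delta>}" by auto
    then show ?thesis using eq \<delta> by simp
  qed
qed

text \<open>Around the finitely many zeros choose disjoint windows of one radius, inside [0,1], on
  which \<open>d\<close> does not vanish and \<open>w\<close> varies by less than \<epsilon>. Off
  the windows |h| is bounded below, so a thin band meets only the windows, and the window of z
  contributes between w(z) - \<epsilon> and w(z) + \<epsilon>. The maximum with 0 keeps the lower
  bound meaningful in \<open>ennreal\<close>.\<close>

lemma band_average_near_sum:
  fixes h d w :: "real \<Rightarrow> real"
  defines "Z \<equiv> {t\<in>{0..1}. h t = 0}"
  assumes d: "continuous_on {0..1} d"
    and h: "\<And>t. t \<in> {0..1} \<Longrightarrow> (h has_real_derivative d t) (at t within {0..1})"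
    and w: "continuous_on {0..1} w" "\<And>t. t \<in> {0..1} \<Longrightarrow> w t \<ge> 0"
    and ends: "h 0 \<noteq> 0" "h 1 \<noteq> 0"
    and nz: "\<And>t. t \<in> {0..1} \<Longrightarrow> h t = 0 \<Longrightarrow> d t \<noteq> 0"
    and \<epsilon>: "\<epsilon> > 0"
  shows "eventually (\<lambda>k. ennreal (\<Sum>z\<in>Z. max 0 (w z - \<epsilon>)) \<le> band_average h d w k \<and>
    band_average h d w k \<le> ennreal (\<Sum>z\<in>Z. w z + \<epsilon>)) sequentially"
proof -
  have finZ: "finite Z" unfolding Z_def by (rule finite_nondegenerate_zeros[OF h nz])
  have ch: "continuous_on {0..1} h" by (rule DERIV_continuous_on[OF h])
  \<comment> \<open>\<open>P z r\<close> collects what is asked of the radius at z. Staying strictly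
    below half the distance to any other zero makes the closed windows disjoint, not just the open
    ones.\<close>
  define P where "P z r \<longleftrightarrow> {z - r..z + r} \<subseteq> {0..1} \<and>
    (\<forall>t\<in>{z - r..z + r}. d t \<noteq> 0 \<and> \<bar>w t - w z\<bar> < \<epsilon>) \<and> (\<forall>z'\<in>Z. z' \<noteq> z \<longrightarrow> r < \<bar>z' - z\<bar> / 2)" for z r
  have "eventually (P z) (at_right 0)" if "z \<in> Z" for z
  proof -
    have z: "0 < z" "z < 1" "z \<in> {0..1}" "d z \<noteq> 0"
      using that ends nz by (auto simp: Z_def order.strict_iff_order)
    obtain r1 where r1: "r1 > 0" "\<And>s. s \<in> {0..1} \<Longrightarrow> dist s z < r1 \<Longrightarrow> dist (d s) (d z) < \<bar>d z\<bar>"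
      using d z(3,4) unfolding continuous_on_iff by (metis zero_less_abs_iff)
    obtain r2 where r2: "r2 > 0" "\<And>s. s \<in> {0..1} \<Longrightarrow> dist s z < r2 \<Longrightarrow> dist (w s) (w z) < \<epsilon>"
      using w(1) z(3) \<epsilon> unfolding continuous_on_iff by metis
    have ev: "eventually (\<lambda>r. r < c) (at_right 0)" if "c > 0" for c :: real
      using that by (auto simp: eventually_at_right_field)
    have "eventually (\<lambda>r. \<forall>z'\<in>Z. z' \<noteq> z \<longrightarrow> r < \<bar>z' - z\<bar> / 2) (at_right 0)"
    proof (intro eventually_ball_finite ballI finZ)
      fix z' show "eventually (\<lambda>r. z' \<noteq> z \<longrightarrow> r < \<bar>z' - z\<bar> / 2) (at_right 0)"
        using ev[of "\<bar>z' - z\<bar> / 2"] by (cases "z' = z") auto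
    qed
    moreover have "eventually (\<lambda>r. r < 1 - z) (at_right 0)" using z(2) by (intro ev) simp
    ultimately show ?thesis
      using ev[OF z(1)] ev[OF r1(1)] ev[OF r2(1)]
    proof (eventually_elim)
      case (elim r)
      have sub: "{z - r..z + r} \<subseteq> {0..1}" using elim by auto
      have "d t \<noteq> 0 \<and> \<bar>w t - w z\<bar> < \<epsilon>" if "t \<in> {z - r..z + r}" for t
      proof -
        have "t \<in> {0..1}" "dist t z < r1" "dist t z < r2"
          using that elim sub by (auto simp: dist_real_def abs_less_iff)
        then show ?thesis using r1(2)[of t] r2(2)[of t] by (auto simp: dist_real_def)
      qed
      then show ?case using sub elim by (auto simp: P_def)
    qed
  qed
  then have "eventually (\<lambda>r. r > 0 \<and> (\<forall>z\<in>Z. P z r)) (at_right 0)"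
    using finZ by (intro eventually_conj eventually_ball_finite eventually_at_right_less) auto
  then obtain r where r: "r > 0" "\<And>z. z \<in> Z \<Longrightarrow> P z r"
    using eventually_happens' trivial_limit_at_right_real by blast
  \<comment> \<open>Only the open windows are removed, so that \<open>C\<close> is compact and
    contains the window ends: one lower bound for |h| then serves both off the windows and at their
    ends.\<close>
  define C where "C = {0..1} - (\<Union>z\<in>Z. {z - r<..<z + r})"
  have disj: "z' = z" if "z \<in> Z" "z' \<in> Z" "\<bar>t - z\<bar> \<le> r" "\<bar>t - z'\<bar> \<le> r" for z z' t
  proof (rule ccontr)
    assume "z' \<noteq> z"
    then have "r < \<bar>z' - z\<bar> / 2" using r(2)[OF that(1)] that(2) by (auto simp: P_def)
    moreover have "\<bar>z' - z\<bar> \<le> \<bar>t - z\<bar> + \<bar>t - z'\<bar>" by arith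
    ultimately show False using that(3,4) by argo
  qed
  have endC: "z - r \<in> C" "z + r \<in> C" if "z \<in> Z" for z
  proof -
    have "{z - r..z + r} \<subseteq> {0..1}" using r(2)[OF that] by (auto simp: P_def)
    then have 1: "z - r \<in> {0..1}" "z + r \<in> {0..1}" using r(1) by auto
    have "z - r \<notin> {z' - r<..<z' + r}" "z + r \<notin> {z' - r<..<z' + r}" if "z' \<in> Z" for z'
      using disj[OF \<open>z \<in> Z\<close> that, of "z - r"] disj[OF \<open>z \<in> Z\<close> that, of "z + r"] r(1) by (auto simp: abs_le_iff)
    then show "z - r \<in> C" "z + r \<in> C" using 1 unfolding C_def by blast+
  qed
  obtain \<delta>0 where \<delta>0: "\<delta>0 > 0" "\<And>t. t \<in> C \<Longrightarrow> \<delta>0 \<le> \<bar>h t\<bar>"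
  proof (cases "C = {}")
    case True then show thesis by (intro that[of 1]) auto
  next
    case False
    have "compact C" unfolding C_def by (intro compact_diff open_UN) auto
    moreover have "continuous_on C (\<lambda>t. \<bar>h t\<bar>)"
      by (intro continuous_intros continuous_on_subset[OF ch]) (auto simp: C_def)
    ultimately obtain t0 where t0: "t0 \<in> C" "\<And>t. t \<in> C \<Longrightarrow> \<bar>h t0\<bar> \<le> \<bar>h t\<bar>"
      using continuous_attains_inf[of C "\<lambda>t. \<bar>h t\<bar>"] False by auto
    have "h t0 \<noteq> 0" using t0(1) r(1) by (force simp: C_def Z_def)
    then show thesis using t0 by (intro that[of "\<bar>h t0\<bar>"]) auto
  qed
  have "eventually (\<lambda>k. 1 / real (Suc k) < \<delta>0) sequentially"
    by (rule eventually_inverse_Suc_less[OF \<delta>0(1)])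
  then show ?thesis
  proof eventually_elim
    case (elim k)
    define B where "B = {- (1/Suc k)<..<1/real (Suc k)}"
    define K where "K = ennreal (Suc k / 2)"
    let ?W = "\<lambda>z t. ennreal (\<bar>d t\<bar> * w t) * indicator B (h t) * indicator {z - r..z + r} t" and ?V = "\<lambda>z t. ennreal \<bar>d t\<bar> * indicator B (h t) * indicator {z - r..z + r} t"
    have K1: "K * (ennreal c * ennreal (2 * (1 / Suc k))) = ennreal c" if "c \<ge> 0" for c
    proof -
      have "K * (ennreal c * ennreal (2 * (1 / Suc k))) = ennreal (Suc k / 2 * (c * (2 * (1 / Suc k))))"
        using that by (simp add: K_def ennreal_mult[symmetric] del: of_nat_Suc)
      also have "Suc k / 2 * (c * (2 * (1 / Suc k))) = c" by (simp add: field_simps)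
      finally show ?thesis .
    qed
    have win: "(\<integral>\<^sup>+t. ?V z t \<partial>lborel)
        = ennreal (2 * (1 / Suc k))" if "z \<in> Z" for z
      unfolding B_def
    proof (rule band_average_window[OF r(1) _ d _ h])
      show "1 / real (Suc k) \<le> \<bar>h (z - r)\<bar>" "1 / real (Suc k) \<le> \<bar>h (z + r)\<bar>"
        using endC[OF that] \<delta>0(2) elim by force+
    qed (use r(2)[OF that] that in \<open>auto simp: P_def Z_def\<close>)
    have meas: "(\<lambda>t. ennreal (F t) * indicator B (h t) * indicator {z - r..z + r} t) \<in> borel_measurable lborel"
      if "z \<in> Z" "continuous_on {0..1} F" for F z
      using r(2)[OF that(1)] that(2) ch
      by (intro continuous_band_measurable) (auto simp: P_def B_def)
    have "(\<integral>\<^sup>+t. ennreal (\<bar>d t\<bar> * w t) * indicator B (h t) * indicator {0..1} t \<partial>lborel)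
      = (\<integral>\<^sup>+t. (\<Sum>z\<in>Z. ?W z t) \<partial>lborel)"
    proof (rule nn_integral_cong)
      fix t :: real
      show "ennreal (\<bar>d t\<bar> * w t) * indicator B (h t) * indicator {0..1} t
        = (\<Sum>z\<in>Z. ?W z t)"
      proof (cases "\<exists>z\<in>Z. t \<in> {z - r..z + r}")
        case True
        then obtain z where z: "z \<in> Z" "t \<in> {z - r..z + r}" by auto
        have t01: "t \<in> {0..1}" using r(2)[OF z(1)] z(2) by (auto simp: P_def)
        have "(\<Sum>z\<in>Z. ?W z t)
          = (\<Sum>z'\<in>Z. if z' = z then ennreal (\<bar>d t\<bar> * w t) * indicator B (h t) else 0)"
        proof (rule sum.cong[OF refl])
          fix z' assume z': "z' \<in> Z"
          have "t \<in> {z' - r..z' + r} \<longleftrightarrow> z' = z"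
            using disj[OF z(1) z', of t] z(2) by (auto simp: abs_le_iff)
          then show "ennreal (\<bar>d t\<bar> * w t) * indicator B (h t) * indicator {z' - r..z' + r} t
              = (if z' = z then ennreal (\<bar>d t\<bar> * w t) * indicator B (h t) else 0)"
            by (simp add: indicator_def)
        qed
        then show ?thesis using z(1) finZ t01 by simp
      next
        case False
        have "h t \<notin> B" if "t \<in> {0..1}"
        proof -
          have "t \<in> C" using False that by (force simp: C_def)
          then show ?thesis using \<delta>0(2)[of t] elim by (auto simp: B_def)
        qed
        then have "ennreal (\<bar>d t\<bar> * w t) * indicator B (h t) * indicator {0..1} t = 0"
          by (auto simp: indicator_def)
        moreover have "(\<Sum>z\<in>Z. ?W z t) = 0"
          using False by (intro sum.neutral) (auto simp: indicator_def)
        ultimately show ?thesis by simp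
      qed
    qed
    also have "\<dots> = (\<Sum>z\<in>Z. \<integral>\<^sup>+t. ?W z t \<partial>lborel)"
      by (intro nn_integral_sum meas continuous_intros d w) auto
    finally have avg: "band_average h d w k
        = (\<Sum>z\<in>Z. K * (\<integral>\<^sup>+t. ?W z t \<partial>lborel))"
      unfolding band_average_def B_def K_def by (simp add: sum_distrib_left)
    have term_le: "K * (\<integral>\<^sup>+t. ?W z t \<partial>lborel)
        \<le> ennreal (w z + \<epsilon>)" if z: "z \<in> Z" for z
    proof -
      have wz: "0 \<le> w z" using w(2) z by (auto simp: Z_def)
      have "(\<integral>\<^sup>+t. ?W z t \<partial>lborel)
        \<le> (\<integral>\<^sup>+t. ennreal (w z + \<epsilon>) * ?V z t \<partial>lborel)"
      proof (rule nn_integral_mono)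
        fix t
        have "\<bar>d t\<bar> * w t \<le> (w z + \<epsilon>) * \<bar>d t\<bar>" if t: "t \<in> {z - r..z + r}"
        proof -
          have "\<bar>w t - w z\<bar> < \<epsilon>" using r(2)[OF z] t by (auto simp: P_def)
          then have "w t \<le> w z + \<epsilon>" by auto
          then show ?thesis by (subst mult.commute) (rule mult_right_mono, auto)
        qed
        then show "?W z t
          \<le> ennreal (w z + \<epsilon>) * ?V z t"
          using wz \<epsilon>
          by (auto simp: indicator_def ennreal_mult[symmetric] simp del: ennreal_plus intro!: ennreal_leI)
      qed
      also have "\<dots> = ennreal (w z + \<epsilon>) * ennreal (2 * (1 / Suc k))"
        by (subst nn_integral_cmult[OF meas[OF z continuous_on_rabs[OF d]]]) (simp add: win[OF z])
      finally have "K * (\<integral>\<^sup>+t. ?W z t \<partial>lborel)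
        \<le> K * (ennreal (w z + \<epsilon>) * ennreal (2 * (1 / Suc k)))" by (rule mult_left_mono) auto
      also have "\<dots> = ennreal (w z + \<epsilon>)" using wz \<epsilon> by (intro K1) auto
      finally show ?thesis .
    qed
    have term_ge: "ennreal (max 0 (w z - \<epsilon>))
        \<le> K * (\<integral>\<^sup>+t. ?W z t \<partial>lborel)"
      if z: "z \<in> Z" for z
    proof -
      have "ennreal (max 0 (w z - \<epsilon>)) * ennreal (2 * (1 / Suc k))
        = (\<integral>\<^sup>+t. ennreal (max 0 (w z - \<epsilon>)) * ?V z t \<partial>lborel)"
        by (subst nn_integral_cmult[OF meas[OF z continuous_on_rabs[OF d]]]) (simp add: win[OF z])
      also have "\<dots> \<le> (\<integral>\<^sup>+t. ?W z t \<partial>lborel)"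
      proof (rule nn_integral_mono)
        fix t
        have "max 0 (w z - \<epsilon>) * \<bar>d t\<bar> \<le> \<bar>d t\<bar> * w t" if t: "t \<in> {z - r..z + r}"
        proof -
          have "t \<in> {0..1}" "\<bar>w t - w z\<bar> < \<epsilon>" using r(2)[OF z] t by (auto simp: P_def)
          then have "max 0 (w z - \<epsilon>) \<le> w t" using w(2)[of t] by auto
          then show ?thesis by (subst (2) mult.commute) (rule mult_right_mono, auto)
        qed
        then show "ennreal (max 0 (w z - \<epsilon>)) * ?V z t
          \<le> ?W z t"
          by (auto simp: indicator_def ennreal_mult[symmetric] simp del: ennreal_max_0 ennreal_max_0' intro!: ennreal_leI)
      qed
      finally have "K * (ennreal (max 0 (w z - \<epsilon>)) * ennreal (2 * (1 / Suc k)))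
        \<le> K * (\<integral>\<^sup>+t. ?W z t \<partial>lborel)"
        by (rule mult_left_mono) auto
      then show ?thesis by (subst (asm) K1) auto
    qed
    have "(\<Sum>z\<in>Z. ennreal (max 0 (w z - \<epsilon>))) \<le> band_average h d w k"
      unfolding avg by (intro sum_mono term_ge)
    moreover have "band_average h d w k \<le> (\<Sum>z\<in>Z. ennreal (w z + \<epsilon>))"
      unfolding avg by (intro sum_mono term_le)
    moreover have "0 \<le> w z + \<epsilon>" if "z \<in> Z" for z using w(2)[of z] that \<epsilon> by (auto simp: Z_def)
    ultimately show ?case by (simp add: sum_ennreal del: ennreal_max_0 ennreal_max_0')
  qed
qed

text \<open>Letting \<epsilon> tend to 0 in the two-sided estimate. The condition
  \<open>ends\<close> is essential to the value of the limit: half of the window of a zero at 0 or 1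
  lies outside [0,1], so such a zero would enter with half its weight.\<close>

lemma band_average_tendsto:
  fixes h d w :: "real \<Rightarrow> real"
  defines "Z \<equiv> {t\<in>{0..1}. h t = 0}"
  assumes d: "continuous_on {0..1} d"
    and h: "\<And>t. t \<in> {0..1} \<Longrightarrow> (h has_real_derivative d t) (at t within {0..1})"
    and w: "continuous_on {0..1} w" "\<And>t. t \<in> {0..1} \<Longrightarrow> w t \<ge> 0"
    and ends: "h 0 \<noteq> 0" "h 1 \<noteq> 0"
    and nz: "\<And>t. t \<in> {0..1} \<Longrightarrow> h t = 0 \<Longrightarrow> d t \<noteq> 0"
  shows "band_average h d w \<longlonglongrightarrow> ennreal (\<Sum>z\<in>Z. w z)"
proof -
  have finZ: "finite Z" unfolding Z_def by (rule finite_nondegenerate_zeros[OF h nz])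
  have wZ: "0 \<le> w z" if "z \<in> Z" for z using that w(2) by (auto simp: Z_def)
  have near: "eventually (\<lambda>k. ennreal (\<Sum>z\<in>Z. max 0 (w z - \<epsilon>)) \<le> band_average h d w k \<and>
    band_average h d w k \<le> ennreal (\<Sum>z\<in>Z. w z + \<epsilon>)) sequentially" if "\<epsilon> > 0" for \<epsilon>
    unfolding Z_def by (rule band_average_near_sum) (fact d h w ends nz that)+
  have lim0: "((\<lambda>\<epsilon>. ennreal (\<Sum>z\<in>Z. max 0 (w z - \<epsilon>))) \<longlongrightarrow> ennreal (\<Sum>z\<in>Z. max 0 (w z - 0))) (at_right 0)"
    "((\<lambda>\<epsilon>. ennreal (\<Sum>z\<in>Z. w z + \<epsilon>)) \<longlongrightarrow> ennreal (\<Sum>z\<in>Z. w z + 0)) (at_right 0)"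
    by (intro tendsto_ennrealI tendsto_intros)+
  have S: "(\<Sum>z\<in>Z. max 0 (w z - 0)) = (\<Sum>z\<in>Z. w z)" "(\<Sum>z\<in>Z. w z + 0) = (\<Sum>z\<in>Z. w z)"
    using wZ by (auto intro!: sum.cong)
  show ?thesis
  proof (rule order_tendstoI)
    fix y assume y: "y < ennreal (\<Sum>z\<in>Z. w z)"
    have "eventually (\<lambda>\<epsilon>. \<epsilon> > 0 \<and> y < ennreal (\<Sum>z\<in>Z. max 0 (w z - \<epsilon>))) (at_right 0)"
      using order_tendstoD(1)[OF lim0(1), unfolded S, OF y]
      by (intro eventually_conj eventually_at_right_less)
    then obtain \<epsilon> where "\<epsilon> > 0" "y < ennreal (\<Sum>z\<in>Z. max 0 (w z - \<epsilon>))"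
      using eventually_happens' trivial_limit_at_right_real by blast
    then show "eventually (\<lambda>k. y < band_average h d w k) sequentially"
      using near[of \<epsilon>] by (auto elim!: eventually_mono less_le_trans)
  next
    fix y assume y: "ennreal (\<Sum>z\<in>Z. w z) < y"
    have "eventually (\<lambda>\<epsilon>. \<epsilon> > 0 \<and> ennreal (\<Sum>z\<in>Z. w z + \<epsilon>) < y) (at_right 0)"
      using order_tendstoD(2)[OF lim0(2), unfolded S, OF y]
      by (intro eventually_conj eventually_at_right_less)
    then obtain \<epsilon> where "\<epsilon> > 0" "ennreal (\<Sum>z\<in>Z. w z + \<epsilon>) < y"
      using eventually_happens' trivial_limit_at_right_real by blast
    then show "eventually (\<lambda>k. band_average h d w k < y) sequentially"
      using near[of \<epsilon>] by (auto elim!: eventually_mono le_less_trans)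
  qed
qed

section \<open>Charts, gradients and curves\<close>

lemma inv_chart_coord:
  assumes "is_chart c"
  shows "p \<in> dom_chart c \<Longrightarrow> inv_chart c (coord c p) = p"
    and "x \<in> coord c ` dom_chart c \<Longrightarrow> coord c (inv_chart c x) = x"
    and "x \<in> coord c ` dom_chart c \<Longrightarrow> inv_chart c x \<in> dom_chart c"
    and "continuous_on (dom_chart c) (coord c)"
    and "continuous_on (coord c ` dom_chart c) (inv_chart c)"
  using assms unfolding is_chart_def homeomorphism_def by blast+

lemma open_chart_image:
  assumes "is_chart c" "open U"
  shows "open (coord c ` (dom_chart c \<inter> U))"
proof -
  have "coord c ` (dom_chart c \<inter> U) = coord c ` dom_chart c \<inter> inv_chart c -` U"
    using inv_chart_coord[OF assms(1)] by (auto simp: image_iff)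
  then show ?thesis
    using assms inv_chart_coord(5)[OF assms(1)]
    by (metis continuous_on_open_vimage is_chart_def inf_commute)
qed

lemma smooth_atlas_chart: "smooth_atlas A \<Longrightarrow> c \<in> A \<Longrightarrow> is_chart c"
  by (simp add: smooth_atlas_def)

lemma chart_at:
  assumes "smooth_atlas A" shows "chart_at A p \<in> A" "p \<in> dom_chart (chart_at A p)"
proof -
  have "\<exists>c. c \<in> A \<and> p \<in> dom_chart c" using assms unfolding smooth_atlas_def by blast
  from someI_ex[OF this] show "chart_at A p \<in> A" "p \<in> dom_chart (chart_at A p)"
    by (simp_all add: chart_at_def)
qed

lemma Ck_on_differentiable:
  "Ck_on k S f \<Longrightarrow> enat 1 \<le> k \<Longrightarrow> x \<in> S \<Longrightarrow> f differentiable (at x)"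
  unfolding Ck_on_def by (drule spec[of _ 1]) simp

lemma Ck_on_continuous_derivative:
  "Ck_on k S f \<Longrightarrow> enat 1 \<le> k \<Longrightarrow> continuous_on S (\<lambda>x. frechet_derivative f (at x) v)"
  unfolding Ck_on_def by (drule spec[of _ 1]) simp

lemma Ck_on_continuous: "Ck_on k S f \<Longrightarrow> continuous_on S f"
  unfolding Ck_on_def by (drule spec[of _ 0]) (simp add: zero_enat_def[symmetric])

lemma one_le_infinity_enat: "enat 1 \<le> \<infinity>" "enat 1 \<le> 1"
  by (simp_all add: one_enat_def)

lemma transition_differentiable:
  assumes "smooth_atlas A" "c \<in> A" "d \<in> A" "p \<in> dom_chart c" "p \<in> dom_chart d"
  shows "(coord d \<circ> inv_chart c) differentiable (at (coord c p))"
  using assms by (intro Ck_on_differentiable[of \<infinity> "coord c ` (dom_chart c \<inter> dom_chart d)"])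
    (auto simp: smooth_atlas_def)

text \<open>The chain rule. The factorisation of \<open>F \<circ> inv_chart c\<close> through the
  chart \<open>d\<close> holds only on the image of the overlap, which is open and hence sufficient
  for a derivative.\<close>

lemma frechet_derivative_change_chart:
  assumes A: "smooth_atlas A" and cd: "c \<in> A" "d \<in> A" "p \<in> dom_chart c" "p \<in> dom_chart d"
    and F: "(F \<circ> inv_chart d) differentiable (at (coord d p))"
  shows "frechet_derivative (F \<circ> inv_chart c) (at (coord c p))
    = (\<lambda>e. frechet_derivative (F \<circ> inv_chart d) (at (coord d p))
        (frechet_derivative (coord d \<circ> inv_chart c) (at (coord c p)) e))"
proof -
  note c = inv_chart_coord[OF smooth_atlas_chart[OF A cd(1)]]
    and d = inv_chart_coord[OF smooth_atlas_chart[OF A cd(2)]]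
  have "((F \<circ> inv_chart d) has_derivative frechet_derivative (F \<circ> inv_chart d) (at (coord d p)))
      (at ((coord d \<circ> inv_chart c) (coord c p)))"
    using F c(1)[OF cd(3)] by (simp add: frechet_derivative_works)
  from diff_chain_at[OF transition_differentiable[OF A cd, unfolded frechet_derivative_works] this]
  have "((F \<circ> inv_chart d) \<circ> (coord d \<circ> inv_chart c) has_derivative
      (\<lambda>e. frechet_derivative (F \<circ> inv_chart d) (at (coord d p))
        (frechet_derivative (coord d \<circ> inv_chart c) (at (coord c p)) e))) (at (coord c p))"
    by (simp add: o_def)
  then have "((F \<circ> inv_chart c) has_derivative
      (\<lambda>e. frechet_derivative (F \<circ> inv_chart d) (at (coord d p))
        (frechet_derivative (coord d \<circ> inv_chart c) (at (coord c p)) e))) (at (coord c p))"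
  proof (rule has_derivative_transform_within_open)
    show "open (coord c ` (dom_chart c \<inter> dom_chart d))"
      using A cd by (intro open_chart_image) (auto simp: smooth_atlas_def is_chart_def)
  qed (use c d cd in auto)
  from frechet_derivative_at[OF this] show ?thesis by simp
qed

lemma frechet_derivative_coord_self:
  assumes "smooth_atlas A" "c \<in> A" "p \<in> dom_chart c"
  shows "frechet_derivative (coord c \<circ> inv_chart c) (at (coord c p)) = (\<lambda>e. e)"
proof -
  note c = inv_chart_coord[OF smooth_atlas_chart[OF assms(1,2)]]
  have "((coord c \<circ> inv_chart c) has_derivative (\<lambda>e. e)) (at (coord c p))"
    using smooth_atlas_chart[OF assms(1,2)] assms(3) c
    by (intro has_derivative_transform_within_open[OF has_derivative_ident, of "coord c ` dom_chart c"])
       (auto simp: is_chart_def)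
  from frechet_derivative_at[OF this] show ?thesis by simp
qed

text \<open>The transformation law demanded of a tangent vector is here the cocycle identity for
  derivatives of transition maps.\<close>

lemma coordinate_vector_in_tangent_space:
  assumes A: "smooth_atlas A" and c: "c \<in> A" "p \<in> dom_chart c"
  shows "coordinate_vector A c p e \<in> tangent_space A p"
proof -
  have key: "frechet_derivative (coord d' \<circ> inv_chart c) (at (coord c p)) e
      = frechet_derivative (coord d' \<circ> inv_chart d) (at (coord d p))
          (frechet_derivative (coord d \<circ> inv_chart c) (at (coord c p)) e)"
    if d: "d \<in> A" "p \<in> dom_chart d" and d': "d' \<in> A" "p \<in> dom_chart d'" for d d'
    by (subst frechet_derivative_change_chart[OF A c(1) d(1) c(2) d(2)
          transition_differentiable[OF A d(1) d'(1) d(2) d'(2)]]) simp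
  show ?thesis unfolding tangent_space_def mem_Collect_eq
  proof (intro conjI ballI allI impI)
    fix d d' assume "d \<in> A" "d' \<in> A" "p \<in> dom_chart d \<and> p \<in> dom_chart d'"
    then show "coordinate_vector A c p e d' = frechet_derivative (coord d' \<circ> inv_chart d) (at (coord d p))
        (coordinate_vector A c p e d)"
      using key[of d d'] by (simp add: coordinate_vector_def)
  qed (auto simp: coordinate_vector_def)
qed

lemma tangent_space_transform:
  "v \<in> tangent_space A p \<Longrightarrow> c \<in> A \<Longrightarrow> d \<in> A \<Longrightarrow> p \<in> dom_chart c \<Longrightarrow> p \<in> dom_chart d \<Longrightarrow>
    v d = frechet_derivative (coord d \<circ> inv_chart c) (at (coord c p)) (v c)"
  unfolding tangent_space_def by blast

lemma coordinate_vector_self: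
  assumes "smooth_atlas A" "c \<in> A" "p \<in> dom_chart c"
  shows "coordinate_vector A c p e c = e"
  using assms by (simp add: coordinate_vector_def frechet_derivative_coord_self)

lemma tangent_space_eq_coordinate_vector:
  assumes "v \<in> tangent_space A p" "c \<in> A" "p \<in> dom_chart c"
  shows "v = coordinate_vector A c p (v c)"
proof
  fix d
  show "v d = coordinate_vector A c p (v c) d"
  proof (cases "d \<in> A \<and> p \<in> dom_chart d")
    case True
    then show ?thesis
      using tangent_space_transform[OF assms(1,2) _ assms(3), of d] by (simp add: coordinate_vector_def)
  next
    case False
    then have "v d = 0" using assms(1) unfolding tangent_space_def by blast
    then show ?thesis using False by (auto simp: coordinate_vector_def)
  qed
qed

lemma coordinate_vector_linear:
  assumes A: "smooth_atlas A" and c: "c \<in> A" "p \<in> dom_chart c"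
  shows "coordinate_vector A c p (a *\<^sub>R e + b *\<^sub>R e')
    = (\<lambda>d. a *\<^sub>R coordinate_vector A c p e d + b *\<^sub>R coordinate_vector A c p e' d)"
proof
  fix d
  show "coordinate_vector A c p (a *\<^sub>R e + b *\<^sub>R e') d
    = a *\<^sub>R coordinate_vector A c p e d + b *\<^sub>R coordinate_vector A c p e' d"
  proof (cases "d \<in> A \<and> p \<in> dom_chart d")
    case True
    then have "linear (frechet_derivative (coord d \<circ> inv_chart c) (at (coord c p)))"
      using transition_differentiable[OF A c(1) _ c(2)] linear_frechet_derivative by blast
    then show ?thesis using True by (simp add: coordinate_vector_def linear_add linear_scale)
  qed (auto simp: coordinate_vector_def)
qed

section \<open>Differentials as gradients in a chart\<close>

text \<open>The Euclidean gradient of the coordinate expression. As a vector of the fixed space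
  \<open>'e\<close> it has limits when the point and the function vary together, and the
  differential becomes an inner product.\<close>

definition chart_gradient :: "('m, 'e::euclidean_space) chart \<Rightarrow> ('m \<Rightarrow> real) \<Rightarrow> 'e \<Rightarrow> 'e" where
  "chart_gradient c f x = (\<Sum>b\<in>Basis. frechet_derivative (f \<circ> inv_chart c) (at x) b *\<^sub>R b)"

lemma C1_differentiable:
  assumes "f \<in> C1_functions A" "c \<in> A" "x \<in> coord c ` dom_chart c"
  shows "(f \<circ> inv_chart c) differentiable (at x)"
  using assms Ck_on_differentiable[of 1 _ "f \<circ> inv_chart c"] one_le_infinity_enat
  by (auto simp: C1_functions_def)

lemma C1_gradient:
  assumes "f \<in> C1_functions A" "c \<in> A" "x \<in> coord c ` dom_chart c"
  shows "frechet_derivative (f \<circ> inv_chart c) (at x) = (\<lambda>e. chart_gradient c f x \<bullet> e)"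
proof
  fix e
  have "linear (frechet_derivative (f \<circ> inv_chart c) (at x))"
    using C1_differentiable[OF assms] linear_frechet_derivative by blast
  then have "frechet_derivative (f \<circ> inv_chart c) (at x) (\<Sum>b\<in>Basis. (e \<bullet> b) *\<^sub>R b)
    = (\<Sum>b\<in>Basis. (e \<bullet> b) * frechet_derivative (f \<circ> inv_chart c) (at x) b)"
    by (simp add: linear_sum linear_scale)
  also have "\<dots> = chart_gradient c f x \<bullet> e"
    unfolding chart_gradient_def inner_sum_left
    by (intro sum.cong) (auto simp: inner_commute[of e] mult.commute)
  finally show "frechet_derivative (f \<circ> inv_chart c) (at x) e = chart_gradient c f x \<bullet> e"
    by (simp add: euclidean_representation)
qed

lemma C1_has_derivative:
  assumes "f \<in> C1_functions A" "c \<in> A" "x \<in> coord c ` dom_chart c"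
  shows "((f \<circ> inv_chart c) has_derivative (\<lambda>e. chart_gradient c f x \<bullet> e)) (at x)"
  using C1_differentiable[OF assms] C1_gradient[OF assms] by (simp add: frechet_derivative_works)

text \<open>Frees the differential from the chart \<open>chart_at A p\<close>, which is chosen
  separately at each point; continuity arguments need one chart on a whole neighbourhood.\<close>

lemma differential_eq_gradient:
  assumes A: "smooth_atlas A" and f: "f \<in> C1_functions A" and v: "v \<in> tangent_space A p"
    and c: "c \<in> A" "p \<in> dom_chart c"
  shows "differential A f p v = chart_gradient c f (coord c p) \<bullet> v c"
proof -
  let ?d = "chart_at A p"
  note d = chart_at[OF A, of p]
  have "v ?d = frechet_derivative (coord ?d \<circ> inv_chart c) (at (coord c p)) (v c)"
    using tangent_space_transform[OF v c(1) d(1) c(2) d(2)] .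
  moreover have "frechet_derivative (f \<circ> inv_chart c) (at (coord c p)) (v c)
    = frechet_derivative (f \<circ> inv_chart ?d) (at (coord ?d p))
        (frechet_derivative (coord ?d \<circ> inv_chart c) (at (coord c p)) (v c))"
    by (subst frechet_derivative_change_chart[OF A c(1) d(1) c(2) d(2) C1_differentiable[OF f d(1) imageI[OF d(2)]]])
      (rule refl)
  ultimately show ?thesis
    using C1_gradient[OF f c(1) imageI[OF c(2)]] by (simp add: differential_def)
qed

section \<open>Velocities of curves and transversality\<close>

text \<open>Both facts are read off the local extension of the curve to an open set of parameters.
  The condition \<open>at s within S \<noteq> bot\<close> makes the vector derivative unique, so
  that \<open>velocity\<close> is really the derivative at s; the second fact needs this at all
  nearby s.\<close>

lemma coord_curve_velocity:
  assumes \<gamma>: "Ck_curve_on k A S \<gamma>" "enat 1 \<le> k" and t: "t \<in> S" "at t within S \<noteq> bot"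
    and c: "c \<in> A" "\<gamma> t \<in> dom_chart c"
  shows "((coord c \<circ> \<gamma>) has_vector_derivative velocity A S \<gamma> t c) (at t within S)"
    and "(\<And>s. s \<in> S \<Longrightarrow> at s within S \<noteq> bot) \<Longrightarrow>
      ((\<lambda>s. velocity A S \<gamma> s c) \<longlongrightarrow> velocity A S \<gamma> t c) (at t within S)"
proof -
  obtain J h where J: "open J" "t \<in> J" "\<gamma> ` (J \<inter> S) \<subseteq> dom_chart c" "Ck_on k J h"
      and h: "\<And>s. s \<in> J \<inter> S \<Longrightarrow> h s = coord c (\<gamma> s)"
    using \<gamma>(1) t(1) c unfolding Ck_curve_on_def by metis
  have *: "((coord c \<circ> \<gamma>) has_vector_derivative frechet_derivative h (at s) 1) (at s within S)"
    if s: "s \<in> J \<inter> S" for s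
  proof -
    have hd: "h differentiable (at s)" using Ck_on_differentiable[OF J(4) \<gamma>(2)] s by auto
    then have "(h has_vector_derivative frechet_derivative h (at s) 1) (at s within S)"
    proof -
      have "frechet_derivative h (at s) = (\<lambda>x. x *\<^sub>R frechet_derivative h (at s) 1)"
      proof
        fix x
        show "frechet_derivative h (at s) x = x *\<^sub>R frechet_derivative h (at s) 1"
          using linear_scale[OF linear_frechet_derivative[OF hd], of x 1]
          by (simp only: real_scaleR_def mult_1_right)
      qed
      then show ?thesis
        using hd unfolding frechet_derivative_works has_vector_derivative_def
        by (metis has_derivative_at_withinI)
    qed
    moreover obtain e where "e > 0" "ball s e \<subseteq> J"
      using J(1) s openE by blast
    moreover have "h x = (coord c \<circ> \<gamma>) x" if "x \<in> S" "dist x s < e" for x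
    proof -
      have "x \<in> J" using \<open>ball s e \<subseteq> J\<close> that(2) by (auto simp: dist_commute)
      then show ?thesis using h that(1) by simp
    qed
    moreover have "s \<in> S" using s by simp
    ultimately show ?thesis
      using has_vector_derivative_transform_within[where f = h and g = "coord c \<circ> \<gamma>" and d = e] by blast
  qed
  have vel: "velocity A S \<gamma> s c = frechet_derivative h (at s) 1"
    if s: "s \<in> J \<inter> S" "at s within S \<noteq> bot" for s
  proof -
    have "\<gamma> s \<in> dom_chart c" using J(3) s by auto
    then show ?thesis using c(1) vector_derivative_within[OF s(2) *[OF s(1)]]
      by (simp add: velocity_def)
  qed
  show "((coord c \<circ> \<gamma>) has_vector_derivative velocity A S \<gamma> t c) (at t within S)"
    using *[of t] vel[of t] t J(2) by simp
  assume nb: "\<And>s. s \<in> S \<Longrightarrow> at s within S \<noteq> bot"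
  have "continuous (at t) (\<lambda>s. frechet_derivative h (at s) 1)"
    using Ck_on_continuous_derivative[OF J(4) \<gamma>(2)] J(1,2) continuous_on_eq_continuous_at by blast
  then have "((\<lambda>s. frechet_derivative h (at s) 1) \<longlongrightarrow> velocity A S \<gamma> t c) (at t within S)"
    using vel[of t] t J(2) by (simp add: isCont_def tendsto_within_subset[where S=UNIV])
  moreover have "eventually (\<lambda>s. s \<in> J \<inter> S) (at t within S)"
    using J(1,2) unfolding eventually_at_topological by blast
  then have "eventually (\<lambda>s. frechet_derivative h (at s) 1 = velocity A S \<gamma> s c) (at t within S)"
    by eventually_elim (use vel nb in auto)
  ultimately show "((\<lambda>s. velocity A S \<gamma> s c) \<longlongrightarrow> velocity A S \<gamma> t c) (at t within S)"
    by (rule Lim_transform_eventually)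
qed

lemma C1_along_curve:
  assumes A: "smooth_atlas A" and f: "f \<in> C1_functions A"
    and \<gamma>: "Ck_curve_on k A S \<gamma>" "enat 1 \<le> k" and t: "t \<in> S" "at t within S \<noteq> bot"
    and c: "c \<in> A" "\<gamma> t \<in> dom_chart c"
  shows "((\<lambda>s. f (\<gamma> s)) has_real_derivative
    chart_gradient c f (coord c (\<gamma> t)) \<bullet> velocity A S \<gamma> t c) (at t within S)"
proof -
  note c' = inv_chart_coord[OF smooth_atlas_chart[OF A c(1)]]
  have chain: "((f \<circ> inv_chart c) has_derivative (\<lambda>e. chart_gradient c f (coord c (\<gamma> t)) \<bullet> e))
      (at ((coord c \<circ> \<gamma>) t) within (coord c \<circ> \<gamma>) ` S)"
    unfolding o_apply[of "coord c"]
    using C1_has_derivative[OF f c(1) imageI[OF c(2)]] by (rule has_derivative_at_withinI)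
  have "((f \<circ> inv_chart c) \<circ> (coord c \<circ> \<gamma>) has_vector_derivative
      chart_gradient c f (coord c (\<gamma> t)) \<bullet> velocity A S \<gamma> t c) (at t within S)"
    using vector_derivative_diff_chain_within[OF coord_curve_velocity(1)[OF \<gamma> t c] chain] .
  moreover obtain U where U: "open U" "t \<in> U" "\<And>s. s \<in> U \<inter> S \<Longrightarrow> \<gamma> s \<in> dom_chart c"
    using \<gamma>(1) t(1) c unfolding Ck_curve_on_def by (metis image_subset_iff)
  moreover obtain e where "e > 0" "ball t e \<subseteq> U" using U openE by blast
  moreover have "((f \<circ> inv_chart c) \<circ> (coord c \<circ> \<gamma>)) x = f (\<gamma> x)" if "x \<in> S" "dist x t < e" for x
  proof -
    have "x \<in> U" using \<open>ball t e \<subseteq> U\<close> that(2) by (auto simp: dist_commute)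
    then show ?thesis using U(3) c'(1) that(1) by simp
  qed
  ultimately have "((\<lambda>s. f (\<gamma> s)) has_vector_derivative
      chart_gradient c f (coord c (\<gamma> t)) \<bullet> velocity A S \<gamma> t c) (at t within S)"
    using has_vector_derivative_transform_within[where
        f = "(f \<circ> inv_chart c) \<circ> (coord c \<circ> \<gamma>)" and g = "\<lambda>s. f (\<gamma> s)" and d = e] t(1) by blast
  then show ?thesis by (simp add: has_real_derivative_iff_has_vector_derivative)
qed

lemma differential_velocity:
  assumes A: "smooth_atlas A" and f: "f \<in> C1_functions A"
    and \<gamma>: "Ck_curve_on k A S \<gamma>" "enat 1 \<le> k" and t: "t \<in> S" "at t within S \<noteq> bot"
  shows "((\<lambda>s. f (\<gamma> s)) has_real_derivative differential A f (\<gamma> t) (velocity A S \<gamma> t)) (at t within S)"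
  using C1_along_curve[OF assms chart_at[OF A]] C1_gradient[OF f chart_at(1)[OF A] imageI[OF chart_at(2)[OF A]], of "\<gamma> t"]
  by (simp add: differential_def)

lemma differential_linear:
  assumes A: "smooth_atlas A" and f: "f \<in> C1_functions A"
  shows "differential A f p (\<lambda>c. a *\<^sub>R v c + w c) = a * differential A f p v + differential A f p w"
  using C1_gradient[OF f chart_at(1)[OF A] imageI[OF chart_at(2)[OF A]], of p]
  by (simp add: differential_def inner_add_right)

text \<open>The differential of \<open>f\<close> kills tangent vectors of the zero set, since
  \<open>f\<close> is constant along curves inside it. If it also killed the velocity,
  transversality would make it vanish on the whole tangent space, against surjectivity at a regular
  zero.\<close>

lemma transverse_derivative_nonzero:
  assumes A: "smooth_atlas A" and f: "f \<in> C1_functions A" and reg: "zero_regular_value A f"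
    and tr: "curve_transverse A \<gamma> (zero_set f)" and t: "t \<in> {0..1}" "f (\<gamma> t) = 0"
  shows "differential A f (\<gamma> t) (velocity A {0..1} \<gamma> t) \<noteq> 0"
proof
  assume 0: "differential A f (\<gamma> t) (velocity A {0..1} \<gamma> t) = 0"
  have Z: "\<gamma> t \<in> zero_set f" using t by (simp add: zero_set_def)
  then obtain u where u: "u \<in> tangent_space A (\<gamma> t)" "differential A f (\<gamma> t) u = 1"
    using reg unfolding zero_regular_value_def by (metis UNIV_I imageE)
  then obtain s w where w: "w \<in> tangent_space_of_subset A (zero_set f) (\<gamma> t)"
      and u_eq: "u = (\<lambda>c. s *\<^sub>R velocity A {0..1} \<gamma> t c + w c)"
    using tr t(1) Z unfolding curve_transverse_def by blast
  obtain \<sigma> where \<sigma>: "w = velocity A {-1<..<1} \<sigma> 0" "Ck_curve_on 1 A {-1<..<1} \<sigma>"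
      "\<sigma> ` {-1<..<1} \<subseteq> zero_set f" "\<sigma> 0 = \<gamma> t"
    using w by (auto simp: tangent_space_of_subset_def)
  have at0: "at (0::real) within {-1<..<1} = at 0" by (intro at_within_open) auto
  have "((\<lambda>s. f (\<sigma> s)) has_real_derivative differential A f (\<gamma> t) w) (at 0)"
    using differential_velocity[OF A f \<sigma>(2), of 0] at0 \<sigma>(1,4) one_le_infinity_enat(2) by simp
  moreover have "((\<lambda>s. f (\<sigma> s)) has_real_derivative 0) (at 0)"
  proof (rule has_field_derivative_transform_within_open[where f = "\<lambda>_. 0" and S = "{-1<..<1}"])
    show "0 = f (\<sigma> s)" if "s \<in> {-1<..<1}" for s using subsetD[OF \<sigma>(3) imageI[OF that]] by (simp add: zero_set_def)
  qed auto
  ultimately have "differential A f (\<gamma> t) w = 0" by (rule DERIV_unique)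
  then show False using u(2) 0 unfolding u_eq differential_linear[OF A f] by simp
qed

section \<open>Joint continuity in the \<open>C\<^sup>1\<close> topology\<close>

text \<open>A joint limit at u, together with continuity of \<open>F0\<close>, gives the estimate on
  a neighbourhood of u for all y satisfying one eventual condition; finitely many neighbourhoods
  cover \<open>K\<close>. The filter is not punctured at u, as the estimate is wanted at u
  too.\<close>

lemma eventually_uniform_compact:
  fixes F :: "'u::topological_space \<Rightarrow> 'y \<Rightarrow> real"
  assumes K: "compact K" and F0: "continuous_on K F0"
    and lim: "\<And>u. u \<in> K \<Longrightarrow> ((\<lambda>(u, y). F u y) \<longlongrightarrow> F0 u) (inf (nhds u) (principal K) \<times>\<^sub>F L)"
    and "\<epsilon> > 0"
  shows "eventually (\<lambda>y. \<forall>u\<in>K. \<bar>F u y - F0 u\<bar> < \<epsilon>) L"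
proof -
  have "\<exists>U Q. open U \<and> u \<in> U \<and> eventually Q L \<and> (\<forall>v\<in>U \<inter> K. \<forall>y. Q y \<longrightarrow> \<bar>F v y - F0 v\<bar> < \<epsilon>)"
    if u: "u \<in> K" for u
  proof -
    have "eventually (\<lambda>z. dist (case z of (u, y) \<Rightarrow> F u y) (F0 u) < \<epsilon> / 2) (inf (nhds u) (principal K) \<times>\<^sub>F L)"
      by (rule tendstoD[OF lim[OF u]]) (use \<open>\<epsilon> > 0\<close> in simp)
    then obtain P Q where P: "eventually P (inf (nhds u) (principal K))" and Q: "eventually Q L"
        and PQ: "\<And>v y. P v \<Longrightarrow> Q y \<Longrightarrow> dist (F v y) (F0 u) < \<epsilon> / 2"
      unfolding eventually_prod_filter by auto
    obtain U where U: "open U" "u \<in> U" "\<And>v. v \<in> U \<Longrightarrow> v \<in> K \<Longrightarrow> P v"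
      using P unfolding eventually_inf_principal eventually_nhds by blast
    have "open (ball (F0 u) (\<epsilon> / 2))" "F0 u \<in> ball (F0 u) (\<epsilon> / 2)" using \<open>\<epsilon> > 0\<close> by auto
    then obtain V where V: "open V" "u \<in> V" "\<And>v. v \<in> V \<Longrightarrow> v \<in> K \<Longrightarrow> F0 v \<in> ball (F0 u) (\<epsilon> / 2)"
      using F0[unfolded continuous_on_topological, rule_format, OF u, of "ball (F0 u) (\<epsilon> / 2)"] by metis
    have "\<bar>F v y - F0 v\<bar> < \<epsilon>" if "v \<in> (U \<inter> V) \<inter> K" "Q y" for v y
    proof -
      have "dist (F v y) (F0 u) < \<epsilon> / 2" "dist (F0 u) (F0 v) < \<epsilon> / 2"
        using that PQ U(3) V(3) by auto
      then show ?thesis unfolding dist_real_def by linarith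
    qed
    then show ?thesis using U V Q by (intro exI[of _ "U \<inter> V"] exI[of _ Q]) auto
  qed
  then obtain U Q where UQ: "\<And>u. u \<in> K \<Longrightarrow> open (U u)" "\<And>u. u \<in> K \<Longrightarrow> u \<in> U u"
      "\<And>u. u \<in> K \<Longrightarrow> eventually (Q u) L"
      "\<And>u v y. u \<in> K \<Longrightarrow> v \<in> U u \<inter> K \<Longrightarrow> Q u y \<Longrightarrow> \<bar>F v y - F0 v\<bar> < \<epsilon>"
    by metis
  obtain T where T: "T \<subseteq> K" "finite T" "K \<subseteq> (\<Union>u\<in>T. U u)"
    by (rule compactE_image[OF K, of K U]) (use UQ(1,2) in blast)+
  have "eventually (\<lambda>y. \<forall>u\<in>T. Q u y) L"
    using T UQ(3) by (intro eventually_ball_finite) auto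
  then show ?thesis
  proof eventually_elim
    case (elim y)
    show ?case
    proof
      fix v assume "v \<in> K"
      then obtain u where "u \<in> T" "v \<in> U u" using T(3) by blast
      then show "\<bar>F v y - F0 v\<bar> < \<epsilon>" using UQ(4)[of u v y] T(1) elim \<open>v \<in> K\<close> by auto
    qed
  qed
qed

text \<open>Uniform closeness passes to suprema. It serves the Jacobian, the window infimum and the
  oscillation of a moving integrand, each written as a supremum over a compact set that does not
  move.\<close>

lemma tendsto_SUP_compact:
  fixes F :: "'u::topological_space \<Rightarrow> 'y \<Rightarrow> real"
  assumes K: "compact K" "K \<noteq> {}" and F0: "continuous_on K F0"
    and lim: "\<And>u. u \<in> K \<Longrightarrow> ((\<lambda>(u, y). F u y) \<longlongrightarrow> F0 u) (inf (nhds u) (principal K) \<times>\<^sub>F L)"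
  shows "((\<lambda>y. SUP u\<in>K. F u y) \<longlongrightarrow> (SUP u\<in>K. F0 u)) L"
proof (rule tendstoI)
  fix \<epsilon> :: real assume "\<epsilon> > 0"
  have "compact (F0 ` K)" using F0 K by (intro compact_continuous_image)
  then have bdd0: "bdd_above (F0 ` K)" by (intro bounded_imp_bdd_above compact_imp_bounded)
  have "eventually (\<lambda>y. \<forall>u\<in>K. \<bar>F u y - F0 u\<bar> < \<epsilon> / 2) L"
    using \<open>\<epsilon> > 0\<close> by (intro eventually_uniform_compact K F0 lim) auto
  then show "eventually (\<lambda>y. dist (SUP u\<in>K. F u y) (SUP u\<in>K. F0 u) < \<epsilon>) L"
  proof eventually_elim
    case (elim y)
    have le: "F u y \<le> (SUP u\<in>K. F0 u) + \<epsilon> / 2" if "u \<in> K" for u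
    proof -
      have "F u y \<le> F0 u + \<epsilon> / 2" using elim that by (smt (verit, best))
      also have "F0 u \<le> (SUP u\<in>K. F0 u)" by (intro cSUP_upper that bdd0)
      finally show ?thesis by simp
    qed
    then have bdd: "bdd_above ((\<lambda>u. F u y) ` K)" by (intro bdd_aboveI2)
    have "F0 u \<le> (SUP u\<in>K. F u y) + \<epsilon> / 2" if "u \<in> K" for u
    proof -
      have "F0 u \<le> F u y + \<epsilon> / 2" using elim that by (smt (verit, best))
      also have "F u y \<le> (SUP u\<in>K. F u y)" by (intro cSUP_upper that bdd)
      finally show ?thesis by simp
    qed
    then have "(SUP u\<in>K. F0 u) \<le> (SUP u\<in>K. F u y) + \<epsilon> / 2" by (intro cSUP_least K)
    moreover have "(SUP u\<in>K. F u y) \<le> (SUP u\<in>K. F0 u) + \<epsilon> / 2" by (intro cSUP_least K le)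
    ultimately show ?case using \<open>\<epsilon> > 0\<close> unfolding dist_real_def by linarith
  qed
qed

text \<open>\<open>at t within S\<close> leaves out t itself, whereas in the joint limits the
  function may vary while the parameter stays at t.\<close>

lemma tendsto_nhds_within:
  assumes "(f \<longlongrightarrow> f t) (at t within S)"
  shows "(f \<longlongrightarrow> f t) (inf (nhds t) (principal S))"
  unfolding tendsto_def
proof (intro allI impI)
  fix U assume U: "open U" "f t \<in> U"
  then have "eventually (\<lambda>x. f x \<in> U) (at t within S)" using assms by (auto simp: tendsto_def)
  then show "eventually (\<lambda>x. f x \<in> U) (inf (nhds t) (principal S))"
    unfolding eventually_at_filter eventually_inf_principal by eventually_elim (use U in auto)
qed

lemma tendsto_at_self:
  assumes "((\<lambda>(u, y). F u y) \<longlongrightarrow> F u0 y0) (inf (nhds u0) (principal S) \<times>\<^sub>F L)" "u0 \<in> S"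
  shows "(F u0 \<longlongrightarrow> F u0 y0) L"
proof -
  have "filterlim (\<lambda>y. u0) (inf (nhds u0) (principal S)) L"
    using assms(2) unfolding filterlim_inf filterlim_principal by auto
  then have "filterlim (\<lambda>y. (u0, y)) (inf (nhds u0) (principal S) \<times>\<^sub>F L) L"
    by (intro filterlim_Pair filterlim_ident)
  from filterlim_compose[OF assms(1) this] show ?thesis by simp
qed

section \<open>Continuity and measurability on the space of C^1 functions\<close>

lemma openin_C1_subbasic:
  assumes "f \<in> C1_functions A" "c \<in> A" "compact K" "K \<subseteq> dom_chart c" "\<epsilon> > 0"
  shows "openin (C1_topology A) (C1_subbasic A f c K \<epsilon>)"
  unfolding C1_topology_def using assms by (intro topology_generated_by_Basis) blast

lemma self_in_C1_subbasic: "f \<in> C1_functions A \<Longrightarrow> \<epsilon> > 0 \<Longrightarrow> f \<in> C1_subbasic A f c K \<epsilon>"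
  by (simp add: C1_subbasic_def onorm_zero)

lemma topspace_C1_topology:
  assumes "smooth_atlas A" shows "topspace (C1_topology A) = C1_functions A"
proof
  show "topspace (C1_topology A) \<subseteq> C1_functions A"
    unfolding C1_topology_def topology_generated_by_topspace by (auto simp: C1_subbasic_def)
  show "C1_functions A \<subseteq> topspace (C1_topology A)"
  proof
    fix f assume f: "f \<in> C1_functions A"
    obtain c where "c \<in> A" using chart_at[OF assms] by blast
    \<comment> \<open>With an empty compact set the subbasic condition is vacuous, so this open set
      is the whole space.\<close>
    then have "openin (C1_topology A) (C1_subbasic A f c {} 1)"
      using f by (intro openin_C1_subbasic) auto
    then show "f \<in> topspace (C1_topology A)"
      using openin_subset self_in_C1_subbasic[OF f, of 1 c "{}"] by auto
  qed
qed

lemma continuous_map_nhdsin: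
  fixes f :: "'a \<Rightarrow> 'b::topological_space"
  assumes "\<And>x. x \<in> topspace X \<Longrightarrow> (f \<longlongrightarrow> f x) (nhdsin X x)"
  shows "continuous_map X euclidean f"
  unfolding continuous_map_def
proof (intro conjI allI impI)
  fix U :: "'b set" assume "openin euclidean U"
  then have "\<exists>T. openin X T \<and> x \<in> T \<and> T \<subseteq> {x \<in> topspace X. f x \<in> U}" if x: "x \<in> topspace X" "f x \<in> U" for x
  proof -
    have "eventually (\<lambda>y. f y \<in> U) (nhdsin X x)"
      using assms[OF x(1)] x(2) \<open>openin euclidean U\<close> by (auto simp: tendsto_def)
    then show ?thesis using x(1) openin_subset unfolding eventually_nhdsin by blast
  qed
  then show "openin X {x \<in> topspace X. f x \<in> U}" by (subst openin_subopen) blast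
qed auto

lemma measurable_C1_borel:
  fixes F :: "('m::{t2_space,second_countable_topology} \<Rightarrow> real) \<Rightarrow> 'd::topological_space"
  assumes A: "smooth_atlas A" and F: "continuous_map (C1_topology A) euclidean F"
  shows "F \<in> borel_measurable (C1_borel A)"
proof (rule borel_measurableI)
  have sub: "{U. openin (C1_topology A) U} \<subseteq> Pow (C1_functions A)"
    using openin_subset topspace_C1_topology[OF A] by blast
  fix S :: "'d set" assume "open S"
  then have "openin (C1_topology A) {x \<in> topspace (C1_topology A). F x \<in> S}"
    using F by (auto simp: continuous_map_def)
  moreover have "F -` S \<inter> space (C1_borel A) = {x \<in> topspace (C1_topology A). F x \<in> S}"
    using topspace_C1_topology[OF A] by (auto simp: C1_borel_def space_measure_of[OF sub])
  ultimately show "F -` S \<inter> space (C1_borel A) \<in> sets (C1_borel A)"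
    by (simp add: C1_borel_def sets_measure_of[OF sub])
qed

lemma space_C1_borel: "smooth_atlas A \<Longrightarrow> space (C1_borel A) = C1_functions A"
  unfolding C1_borel_def using openin_subset topspace_C1_topology by (subst space_measure_of) blast+

text \<open>A subbasic neighbourhood of \<open>f0\<close> controls derivatives uniformly on a
  compact neighbourhood of the point, and the derivative of \<open>f0\<close> itself is continuous;
  each accounts for \<epsilon>/2.\<close>

lemma gradient_tendsto:
  assumes A: "smooth_atlas A" and c: "c \<in> A" and x0: "x0 \<in> coord c ` dom_chart c"
    and f0: "f0 \<in> C1_functions A"
  shows "((\<lambda>(x, f). chart_gradient c f x) \<longlongrightarrow> chart_gradient c f0 x0)
    (nhds x0 \<times>\<^sub>F nhdsin (C1_topology A) f0)"
proof -
  note c' = inv_chart_coord[OF smooth_atlas_chart[OF A c]]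
  let ?D = "\<lambda>b f x. frechet_derivative (f \<circ> inv_chart c) (at x) b"
  let ?L = "nhds x0 \<times>\<^sub>F nhdsin (C1_topology A) f0"
  have open_img: "open (coord c ` dom_chart c)"
    using smooth_atlas_chart[OF A c] by (simp add: is_chart_def)
  have "((\<lambda>z. ?D b (snd z) (fst z)) \<longlongrightarrow> ?D b f0 x0) ?L" if b: "b \<in> Basis" for b
  proof (rule tendstoI)
    fix \<epsilon> :: real assume \<epsilon>: "\<epsilon> > 0"
    obtain r where r: "r > 0" "cball x0 r \<subseteq> coord c ` dom_chart c"
      using open_img x0 open_contains_cball by blast
    \<comment> \<open>A closed coordinate ball, because the topology compares derivatives only over
      compact sets.\<close>
    define K where "K = inv_chart c ` cball x0 r"
    have K: "compact K" "K \<subseteq> dom_chart c"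
      unfolding K_def using r(2) c'(3)
      by (auto intro!: compact_continuous_image continuous_on_subset[OF c'(5)])
    define U where "U = C1_subbasic A f0 c K (\<epsilon> / 2)"
    have U: "openin (C1_topology A) U" "f0 \<in> U"
      unfolding U_def using f0 c K \<epsilon> by (auto intro!: openin_C1_subbasic self_in_C1_subbasic)
    have evU: "eventually (\<lambda>f. f \<in> U) (nhdsin (C1_topology A) f0)"
      unfolding eventually_nhdsin using U by blast
    have "continuous_on (coord c ` dom_chart c) (\<lambda>x. ?D b f0 x)"
      using f0 c by (intro Ck_on_continuous_derivative[OF _ one_le_infinity_enat(2)]) (auto simp: C1_functions_def)
    then have "isCont (\<lambda>x. ?D b f0 x) x0"
      using open_img x0 continuous_on_eq_continuous_at by blast
    then have "((\<lambda>x. ?D b f0 x) \<longlongrightarrow> ?D b f0 x0) (nhds x0)"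
      by (simp add: isCont_def tendsto_nhds_iff)
    then have "eventually (\<lambda>x. dist (?D b f0 x) (?D b f0 x0) < \<epsilon> / 2) (nhds x0)"
      using \<epsilon> by (intro tendstoD) auto
    moreover have "eventually (\<lambda>x. x \<in> ball x0 r) (nhds x0)"
      using r(1) by (intro eventually_nhds_in_open) auto
    ultimately have evx: "eventually (\<lambda>x. x \<in> ball x0 r \<and> dist (?D b f0 x) (?D b f0 x0) < \<epsilon> / 2) (nhds x0)"
      by eventually_elim simp
    have main: "dist (?D b f x) (?D b f0 x0) < \<epsilon>"
      if x: "x \<in> ball x0 r" and d: "dist (?D b f0 x) (?D b f0 x0) < \<epsilon> / 2" and f: "f \<in> U" for x f
    proof -
      let ?E = "\<lambda>v. frechet_derivative (f \<circ> inv_chart c) (at x) v - frechet_derivative (f0 \<circ> inv_chart c) (at x) v"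
      have xi: "x \<in> coord c ` dom_chart c" using x r(2) by auto
      have fC: "f \<in> C1_functions A" using f by (simp add: U_def C1_subbasic_def)
      have "inv_chart c x \<in> K" using x by (auto simp: K_def)
      then have on: "onorm ?E < \<epsilon> / 2"
        using f c'(2)[OF xi] by (auto simp: U_def C1_subbasic_def)
      have "bounded_linear ?E"
        using C1_has_derivative[OF fC c xi] C1_has_derivative[OF f0 c xi]
        by (simp add: C1_gradient[OF fC c xi] C1_gradient[OF f0 c xi]
            bounded_linear_sub bounded_linear_inner_right)
      then have "norm (?E b) \<le> onorm ?E * norm b" by (rule onorm)
      then have "\<bar>?E b\<bar> < \<epsilon> / 2" using on b by simp
      then show ?thesis using d unfolding dist_real_def by linarith
    qed
    show "eventually (\<lambda>z. dist (?D b (snd z) (fst z)) (?D b f0 x0) < \<epsilon>) ?L"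
      unfolding eventually_prod_filter fst_conv snd_conv
      by (rule exI, rule exI, rule conjI[OF evx], rule conjI[OF evU]) (use main in blast)
  qed
  then show ?thesis
    unfolding chart_gradient_def case_prod_beta by (intro tendsto_sum tendsto_scaleR tendsto_const)
qed

section \<open>The metric and its dual norm in a chart\<close>

definition chart_metric ::
    "('m, 'e::euclidean_space) chart set
      \<Rightarrow> ('m \<Rightarrow> ('m, 'e) tangent_vector \<Rightarrow> ('m, 'e) tangent_vector \<Rightarrow> real)
      \<Rightarrow> ('m, 'e) chart \<Rightarrow> 'm \<Rightarrow> 'e \<Rightarrow> 'e \<Rightarrow> real" where
  "chart_metric A g c p e e' = g p (coordinate_vector A c p e) (coordinate_vector A c p e')"

lemma riemannian_metricD:
  assumes "riemannian_metric A g" "u \<in> tangent_space A p" "v \<in> tangent_space A p"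
  shows "g p u v = g p v u"
    and "w \<in> tangent_space A p \<Longrightarrow> g p (\<lambda>c. a *\<^sub>R u c + b *\<^sub>R v c) w = a * g p u w + b * g p v w"
    and "u \<noteq> (\<lambda>c. 0) \<Longrightarrow> g p u u > 0"
  using assms unfolding riemannian_metric_def by blast+

context
  fixes A :: "('m::{t2_space,second_countable_topology}, 'e::euclidean_space) chart set" and g
  assumes A: "smooth_atlas A" and g: "riemannian_metric A g"
begin

lemma chart_metric_commute:
  assumes "c \<in> A" "p \<in> dom_chart c"
  shows "chart_metric A g c p e e' = chart_metric A g c p e' e"
  unfolding chart_metric_def
  by (intro riemannian_metricD(1)[OF g] coordinate_vector_in_tangent_space A assms)

lemma chart_metric_linear:
  assumes "c \<in> A" "p \<in> dom_chart c"
  shows "linear (\<lambda>e. chart_metric A g c p e e')"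
proof (rule linearI)
  note cv = coordinate_vector_in_tangent_space[OF A assms]
  note lin = riemannian_metricD(2)[OF g cv cv cv, folded coordinate_vector_linear[OF A assms], folded chart_metric_def]
  show "chart_metric A g c p (x + y) e' = chart_metric A g c p x e' + chart_metric A g c p y e'" for x y
    using lin[of 1 x 1 y e'] by simp
  show "chart_metric A g c p (r *\<^sub>R x) e' = r *\<^sub>R chart_metric A g c p x e'" for r x
    using lin[of r x 0 x e'] by simp
qed

lemma chart_metric_pos:
  assumes "c \<in> A" "p \<in> dom_chart c" "e \<noteq> 0"
  shows "chart_metric A g c p e e > 0"
proof -
  note cv = coordinate_vector_in_tangent_space[OF A assms(1,2)]
  have "coordinate_vector A c p e \<noteq> (\<lambda>c. 0)"
    using coordinate_vector_self[OF A assms(1,2), of e] assms(3) by auto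
  then show ?thesis unfolding chart_metric_def by (rule riemannian_metricD(3)[OF g cv cv])
qed

text \<open>The metric is regular by assumption only on fixed pairs of coordinate vectors. Expanding
  in the basis upgrades this to continuity jointly in the point and the vector.\<close>

lemma chart_metric_expand:
  assumes "c \<in> A" "p \<in> dom_chart c"
  shows "chart_metric A g c p e e' = (\<Sum>b\<in>Basis. \<Sum>b'\<in>Basis. (e \<bullet> b) * ((e' \<bullet> b') * chart_metric A g c p b b'))"
proof -
  have expand: "chart_metric A g c p e e' = (\<Sum>b\<in>Basis. (e \<bullet> b) * chart_metric A g c p b e')" for e e'
  proof -
    have "chart_metric A g c p (\<Sum>b\<in>Basis. (e \<bullet> b) *\<^sub>R b) e' = (\<Sum>b\<in>Basis. (e \<bullet> b) * chart_metric A g c p b e')"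
      by (simp add: linear_sum[OF chart_metric_linear[OF assms]] linear_scale[OF chart_metric_linear[OF assms]])
    then show ?thesis by (simp add: euclidean_representation)
  qed
  have "chart_metric A g c p b e' = (\<Sum>b'\<in>Basis. (e' \<bullet> b') * chart_metric A g c p b b')" for b
    using expand[of e' b] chart_metric_commute[OF assms, of _ b] by simp
  then show ?thesis using expand[of e e'] by (simp add: sum_distrib_left)
qed

lemma chart_metric_scale:
  assumes "c \<in> A" "p \<in> dom_chart c"
  shows "chart_metric A g c p (r *\<^sub>R e) (r *\<^sub>R e) = r\<^sup>2 * chart_metric A g c p e e"
proof -
  have scale: "chart_metric A g c p (r *\<^sub>R x) y = r * chart_metric A g c p x y" for x y
    using linear_scale[OF chart_metric_linear[OF assms]] by simp
  have "chart_metric A g c p (r *\<^sub>R e) (r *\<^sub>R e) = r * chart_metric A g c p e (r *\<^sub>R e)" by (rule scale)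
  also have "chart_metric A g c p e (r *\<^sub>R e) = r * chart_metric A g c p e e"
    by (subst chart_metric_commute[OF assms]) (rule scale)
  finally show ?thesis by (simp add: power2_eq_square)
qed

lemma chart_metric_tendsto:
  assumes c: "c \<in> A" "p0 \<in> dom_chart c"
  shows "((\<lambda>z. chart_metric A g c (fst z) (snd z) (snd z)) \<longlongrightarrow> chart_metric A g c p0 e0 e0) (nhds p0 \<times>\<^sub>F nhds e0)"
proof -
  note c' = inv_chart_coord[OF smooth_atlas_chart[OF A c(1)]]
  have dom: "open (dom_chart c)" using smooth_atlas_chart[OF A c(1)] by (simp add: is_chart_def)
  have coeff: "((\<lambda>p. chart_metric A g c p b b') \<longlongrightarrow> chart_metric A g c p0 b b') (nhds p0)" for b b'
  proof -
    have "continuous_on (coord c ` dom_chart c) (\<lambda>x. chart_metric A g c (inv_chart c x) b b')"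
      using g c unfolding riemannian_metric_def chart_metric_def by (intro Ck_on_continuous[of \<infinity>]) blast
    then have "continuous_on (dom_chart c) (\<lambda>p. chart_metric A g c (inv_chart c (coord c p)) b b')"
      using c'(4) by (rule continuous_on_compose2) simp
    then have "continuous_on (dom_chart c) (\<lambda>p. chart_metric A g c p b b')"
      by (rule continuous_on_eq) (simp add: c'(1))
    then have "isCont (\<lambda>p. chart_metric A g c p b b') p0"
      using dom c(2) continuous_on_eq_continuous_at by blast
    then show ?thesis by (simp add: isCont_def tendsto_nhds_iff)
  qed
  have snd: "((\<lambda>z. snd z) \<longlongrightarrow> e0) (nhds p0 \<times>\<^sub>F nhds e0)" by (rule filterlim_snd)
  have fst: "((\<lambda>z. chart_metric A g c (fst z) b b') \<longlongrightarrow> chart_metric A g c p0 b b') (nhds p0 \<times>\<^sub>F nhds e0)" for b b'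
    by (rule filterlim_compose[OF coeff filterlim_fst])
  have "((\<lambda>z. \<Sum>b\<in>Basis. \<Sum>b'\<in>Basis. (snd z \<bullet> b) * ((snd z \<bullet> b') * chart_metric A g c (fst z) b b')) \<longlongrightarrow>
      (\<Sum>b\<in>Basis. \<Sum>b'\<in>Basis. (e0 \<bullet> b) * ((e0 \<bullet> b') * chart_metric A g c p0 b b'))) (nhds p0 \<times>\<^sub>F nhds e0)"
    by (intro tendsto_sum tendsto_mult tendsto_inner tendsto_const snd fst)
  moreover have "eventually (\<lambda>p. p \<in> dom_chart c) (nhds p0)"
    using dom c(2) by (rule eventually_nhds_in_open)
  then have "eventually (\<lambda>z. fst z \<in> dom_chart c) (nhds p0 \<times>\<^sub>F nhds e0)"
    by (rule eventually_compose_filterlim[OF _ filterlim_fst])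
  then have "eventually (\<lambda>z. (\<Sum>b\<in>Basis. \<Sum>b'\<in>Basis. (snd z \<bullet> b) * ((snd z \<bullet> b') * chart_metric A g c (fst z) b b'))
      = chart_metric A g c (fst z) (snd z) (snd z)) (nhds p0 \<times>\<^sub>F nhds e0)"
    by eventually_elim (rule chart_metric_expand[OF c(1), symmetric])
  ultimately show ?thesis
    unfolding chart_metric_expand[OF c, symmetric] by (rule Lim_transform_eventually)
qed

lemma continuous_on_chart_metric:
  assumes "c \<in> A" "p \<in> dom_chart c"
  shows "continuous_on S (\<lambda>e. chart_metric A g c p e e)"
proof -
  have "(\<lambda>e. chart_metric A g c p e e)
      = (\<lambda>e. \<Sum>b\<in>Basis. \<Sum>b'\<in>Basis. (e \<bullet> b) * ((e \<bullet> b') * chart_metric A g c p b b'))"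
    by (rule ext) (rule chart_metric_expand[OF assms])
  moreover have "continuous_on S \<dots>" by (intro continuous_intros)
  ultimately show ?thesis by (simp only:)
qed

lemma continuous_on_sphere_quotient:
  assumes c: "c \<in> A" "p \<in> dom_chart c"
  shows "continuous_on (sphere 0 1) (\<lambda>e. \<bar>v \<bullet> e\<bar> / sqrt (chart_metric A g c p e e))"
proof (intro continuous_intros continuous_on_chart_metric c ballI)
  fix e :: 'e assume "e \<in> sphere 0 1"
  then have "e \<noteq> 0" by auto
  from chart_metric_pos[OF c this] show "sqrt (chart_metric A g c p e e) \<noteq> 0" by simp
qed

text \<open>Both sides are homogeneous of degree 1 in \<open>e\<close>, so it is enough to compare
  them on the Euclidean unit sphere.\<close>

lemma gradient_le_sphere_SUP:
  assumes c: "c \<in> A" "p \<in> dom_chart c"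
  shows "\<bar>v \<bullet> e\<bar> \<le> (SUP e\<in>sphere 0 1. \<bar>v \<bullet> e\<bar> / sqrt (chart_metric A g c p e e)) * sqrt (chart_metric A g c p e e)"
    (is "_ \<le> ?S * _")
proof (cases "e = 0")
  case True
  then show ?thesis using linear_0[OF chart_metric_linear[OF c]] by simp
next
  case False
  define u where "u = (1 / norm e) *\<^sub>R e"
  have e: "e = norm e *\<^sub>R u" using False by (simp add: u_def)
  have u: "u \<in> sphere 0 1" using False by (simp add: u_def)
  then have pos: "chart_metric A g c p u u > 0" by (intro chart_metric_pos c) auto
  have "bdd_above ((\<lambda>e. \<bar>v \<bullet> e\<bar> / sqrt (chart_metric A g c p e e)) ` sphere 0 1)"
    by (intro bounded_imp_bdd_above compact_imp_bounded compact_continuous_image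
        continuous_on_sphere_quotient c compact_sphere)
  then have le: "\<bar>v \<bullet> u\<bar> / sqrt (chart_metric A g c p u u)
      \<le> ?S"
    using u by (intro cSUP_upper)
  have "\<bar>v \<bullet> e\<bar> = norm e * \<bar>v \<bullet> u\<bar>" by (subst e) (simp add: abs_mult)
  also have "\<dots> = \<bar>v \<bullet> u\<bar> / sqrt (chart_metric A g c p u u) * (norm e * sqrt (chart_metric A g c p u u))"
    using pos by simp
  also have "\<dots> \<le> ?S *
      (norm e * sqrt (chart_metric A g c p u u))"
    using le pos by (intro mult_right_mono) auto
  also have "norm e * sqrt (chart_metric A g c p u u) = sqrt (chart_metric A g c p e e)"
    by (subst (2 3) e) (simp only: chart_metric_scale[OF c] real_sqrt_mult real_sqrt_abs abs_norm_cancel)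
  finally show ?thesis .
qed

text \<open>The defining supremum runs over the metric unit ball, which moves with p. Rescaling each
  vector to Euclidean length 1 trades it for a quotient over the fixed compact sphere, where limits
  and suprema can be exchanged. A unit vector \<open>e\<close> attains its quotient after being
  rescaled to metric length 1.\<close>

lemma jacobian_chart:
  assumes f: "f \<in> C1_functions A" and c: "c \<in> A" "p \<in> dom_chart c"
  shows "jacobian A g p f = (SUP e\<in>sphere 0 1. \<bar>chart_gradient c f (coord c p) \<bullet> e\<bar> / sqrt (chart_metric A g c p e e))"
    (is "_ = ?S")
proof -
  let ?G = "chart_gradient c f (coord c p)"
  let ?J = "SUP v\<in>{v \<in> tangent_space A p. g p v v \<le> 1}. \<bar>differential A f p v\<bar>"
  have ne: "sphere (0::'e) 1 \<noteq> {}" by (simp add: sphere_eq_empty)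
  have cv: "coordinate_vector A c p e \<in> tangent_space A p" for e
    by (rule coordinate_vector_in_tangent_space[OF A c])
  have diff: "differential A f p (coordinate_vector A c p e) = ?G \<bullet> e" for e
    using differential_eq_gradient[OF A f cv c] coordinate_vector_self[OF A c] by simp
  have bdd: "bdd_above ((\<lambda>e. \<bar>?G \<bullet> e\<bar> / sqrt (chart_metric A g c p e e)) ` sphere 0 1)"
    by (intro bounded_imp_bdd_above compact_imp_bounded compact_continuous_image
        continuous_on_sphere_quotient c compact_sphere)
  obtain e1 :: 'e where e1: "e1 \<in> sphere 0 1" using ne by blast
  have "0 \<le> \<bar>?G \<bullet> e1\<bar> / sqrt (chart_metric A g c p e1 e1)"
    using chart_metric_pos[OF c, of e1] e1 by (cases "e1 = 0") auto
  also have "\<dots> \<le> ?S" using e1 bdd by (intro cSUP_upper)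
  finally have S0: "0 \<le> ?S" .
  have le: "\<bar>differential A f p v\<bar> \<le> ?S" if v: "v \<in> tangent_space A p" "g p v v \<le> 1" for v
  proof -
    have veq: "v = coordinate_vector A c p (v c)" by (rule tangent_space_eq_coordinate_vector[OF v(1) c])
    have "chart_metric A g c p (v c) (v c) \<le> 1" using v(2) veq by (simp add: chart_metric_def)
    then have sq: "sqrt (chart_metric A g c p (v c) (v c)) \<le> 1" by simp
    have "\<bar>differential A f p v\<bar> = \<bar>?G \<bullet> v c\<bar>" by (subst veq) (simp only: diff)
    also have "\<dots> \<le> ?S * sqrt (chart_metric A g c p (v c) (v c))" by (rule gradient_le_sphere_SUP[OF c])
    also have "\<dots> \<le> ?S" using sq S0 by (intro mult_left_le)
    finally show ?thesis .
  qed
  show ?thesis unfolding jacobian_def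
  proof (rule antisym)
    have "coordinate_vector A c p 0 \<in> {v \<in> tangent_space A p. g p v v \<le> 1}"
      using cv[of 0] linear_0[OF chart_metric_linear[OF c]] by (simp add: chart_metric_def)
    then show "?J \<le> ?S"
      using le by (intro cSUP_least) auto
    show "?S \<le> ?J"
    proof (rule cSUP_least[OF ne])
      fix e :: 'e assume "e \<in> sphere 0 1"
      then have pos: "chart_metric A g c p e e > 0" by (intro chart_metric_pos c) auto
      define e' where "e' = (1 / sqrt (chart_metric A g c p e e)) *\<^sub>R e"
      have "chart_metric A g c p e' e' = 1"
        using pos by (simp add: e'_def chart_metric_scale[OF c] power_divide)
      then have in_ball: "coordinate_vector A c p e' \<in> {v \<in> tangent_space A p. g p v v \<le> 1}"
        using cv by (simp add: chart_metric_def)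
      have "\<bar>?G \<bullet> e\<bar> / sqrt (chart_metric A g c p e e) = \<bar>differential A f p (coordinate_vector A c p e')\<bar>"
        using pos unfolding diff by (simp add: e'_def abs_mult)
      also have "\<dots> \<le> ?J"
        using le by (intro cSUP_upper in_ball bdd_aboveI2[of _ _ ?S]) auto
      finally show "\<bar>?G \<bullet> e\<bar> / sqrt (chart_metric A g c p e e)
        \<le> ?J" .
    qed
  qed
qed

lemma gradient_le_jacobian:
  assumes f: "f \<in> C1_functions A" and c: "c \<in> A" "p \<in> dom_chart c"
  shows "\<bar>chart_gradient c f (coord c p) \<bullet> e\<bar> \<le> jacobian A g p f * sqrt (chart_metric A g c p e e)"
  unfolding jacobian_chart[OF assms] by (rule gradient_le_sphere_SUP[OF c])

lemma gradient_coord_tendsto: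
  assumes c: "c \<in> A" "p0 \<in> dom_chart c" and f0: "f0 \<in> C1_functions A"
  shows "((\<lambda>z. chart_gradient c (snd z) (coord c (fst z))) \<longlongrightarrow> chart_gradient c f0 (coord c p0))
    (nhds p0 \<times>\<^sub>F nhdsin (C1_topology A) f0)"
proof -
  note c' = inv_chart_coord[OF smooth_atlas_chart[OF A c(1)]]
  have dom: "open (dom_chart c)" using smooth_atlas_chart[OF A c(1)] by (simp add: is_chart_def)
  have "isCont (coord c) p0" using c'(4) dom c(2) continuous_on_eq_continuous_at by blast
  then have "filterlim (coord c) (nhds (coord c p0)) (nhds p0)"
    by (simp add: isCont_def tendsto_nhds_iff)
  then have "filterlim (\<lambda>z. (coord c (fst z), snd z)) (nhds (coord c p0) \<times>\<^sub>F nhdsin (C1_topology A) f0)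
      (nhds p0 \<times>\<^sub>F nhdsin (C1_topology A) f0)"
    by (intro filterlim_Pair filterlim_snd filterlim_compose[OF _ filterlim_fst])
  from filterlim_compose[OF gradient_tendsto[OF A c(1) imageI[OF c(2)] f0] this]
  show ?thesis by simp
qed

lemma eventually_C1_functions:
  assumes "f0 \<in> C1_functions A"
  shows "eventually (\<lambda>f. f \<in> C1_functions A) (nhdsin (C1_topology A) f0)"
  unfolding eventually_nhdsin using topspace_C1_topology[OF A] assms openin_topspace by metis

lemma jacobian_tendsto:
  assumes f0: "f0 \<in> C1_functions A"
  shows "((\<lambda>z. jacobian A g (fst z) (snd z)) \<longlongrightarrow> jacobian A g p0 f0) (nhds p0 \<times>\<^sub>F nhdsin (C1_topology A) f0)"
proof -
  let ?L = "nhds p0 \<times>\<^sub>F nhdsin (C1_topology A) f0"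
  define c where "c = chart_at A p0"
  have c: "c \<in> A" "p0 \<in> dom_chart c" using chart_at[OF A] by (auto simp: c_def)
  have dom: "open (dom_chart c)" using smooth_atlas_chart[OF A c(1)] by (simp add: is_chart_def)
  define F where "F e z = \<bar>chart_gradient c (snd z) (coord c (fst z)) \<bullet> e\<bar> / sqrt (chart_metric A g c (fst z) e e)"
    for e and z :: "'m \<times> ('m \<Rightarrow> real)"
  have lim: "((\<lambda>z. SUP e\<in>sphere 0 1. F e z) \<longlongrightarrow> (SUP e\<in>sphere 0 1. F e (p0, f0))) ?L"
  proof (rule tendsto_SUP_compact)
    show "sphere (0::'e) 1 \<noteq> {}" by (simp add: sphere_eq_empty)
    show "continuous_on (sphere 0 1) (\<lambda>e. F e (p0, f0))"
      using continuous_on_sphere_quotient[OF c] by (simp add: F_def)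
    fix e0 :: 'e assume "e0 \<in> sphere 0 1"
    then have pos: "chart_metric A g c p0 e0 e0 > 0" by (intro chart_metric_pos c) auto
    let ?M = "inf (nhds e0) (principal (sphere 0 1)) \<times>\<^sub>F ?L"
    have fst: "filterlim fst (nhds e0) ?M"
      by (rule filterlim_mono[OF filterlim_fst inf_le1 order_refl])
    have snd: "filterlim snd ?L ?M" by (rule filterlim_snd)
    have 1: "((\<lambda>y. chart_gradient c (snd (snd y)) (coord c (fst (snd y)))) \<longlongrightarrow> chart_gradient c f0 (coord c p0)) ?M"
      by (rule filterlim_compose[OF gradient_coord_tendsto[OF c f0] snd])
    have "filterlim (\<lambda>y. (fst (snd y), fst y)) (nhds p0 \<times>\<^sub>F nhds e0) ?M"
      by (intro filterlim_Pair fst filterlim_compose[OF filterlim_fst snd])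
    from filterlim_compose[OF chart_metric_tendsto[OF c] this]
    have 2: "((\<lambda>y. chart_metric A g c (fst (snd y)) (fst y) (fst y)) \<longlongrightarrow> chart_metric A g c p0 e0 e0) ?M" by simp
    have "((\<lambda>y. F (fst y) (snd y)) \<longlongrightarrow> F e0 (p0, f0)) ?M"
      unfolding F_def fst_conv snd_conv using pos
      by (intro tendsto_divide tendsto_rabs tendsto_inner tendsto_real_sqrt 1 2 fst) auto
    then show "((\<lambda>(u, y). F u y) \<longlongrightarrow> F e0 (p0, f0)) ?M" by (simp add: case_prod_unfold)
  qed simp
  have "eventually (\<lambda>z. fst z \<in> dom_chart c) ?L"
    using eventually_nhds_in_open[OF dom c(2)] by (rule eventually_compose_filterlim[OF _ filterlim_fst])
  moreover have "eventually (\<lambda>z. snd z \<in> C1_functions A) ?L"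
    using eventually_C1_functions[OF f0] by (rule eventually_compose_filterlim[OF _ filterlim_snd])
  ultimately have "eventually (\<lambda>z. (SUP e\<in>sphere 0 1. F e z) = jacobian A g (fst z) (snd z)) ?L"
    by eventually_elim (simp only: F_def jacobian_chart[OF _ c(1)])
  with lim have "((\<lambda>z. jacobian A g (fst z) (snd z)) \<longlongrightarrow> (SUP e\<in>sphere 0 1. F e (p0, f0))) ?L"
    by (rule Lim_transform_eventually)
  then show ?thesis by (simp add: jacobian_chart[OF f0 c] F_def)
qed

end

section \<open>Weak limits with a moving integrand\<close>

lemma continuous_on_joint:
  fixes \<Phi> :: "'a::topological_space \<Rightarrow> 'y \<Rightarrow> 'b::topological_space"
  assumes joint: "\<And>t. t \<in> S \<Longrightarrow> y \<in> topspace X \<Longrightarrow>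
      ((\<lambda>z. \<Phi> (fst z) (snd z)) \<longlongrightarrow> \<Phi> t y) (inf (nhds t) (principal S) \<times>\<^sub>F nhdsin X y)"
    and y: "y \<in> topspace X"
  shows "continuous_on S (\<lambda>t. \<Phi> t y)"
  unfolding continuous_on_def
proof
  fix t assume t: "t \<in> S"
  have "filterlim (\<lambda>s. y) (nhdsin X y) (inf (nhds t) (principal S))"
    using y by (auto simp: filterlim_iff eventually_nhdsin)
  then have "filterlim (\<lambda>s. (s, y)) (inf (nhds t) (principal S) \<times>\<^sub>F nhdsin X y) (inf (nhds t) (principal S))"
    by (intro filterlim_Pair filterlim_ident)
  from filterlim_compose[OF joint[OF t y] this]
  have "((\<lambda>s. \<Phi> s y) \<longlongrightarrow> \<Phi> t y) (inf (nhds t) (principal S))" by simp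
  moreover have "at t within S \<le> inf (nhds t) (principal S)"
    unfolding at_within_def by (intro inf_mono) auto
  ultimately show "((\<lambda>s. \<Phi> s y) \<longlongrightarrow> \<Phi> t y) (at t within S)" by (rule tendsto_mono[rotated])
qed

lemma continuous_map_joint:
  fixes \<Phi> :: "'a::topological_space \<Rightarrow> 'y \<Rightarrow> 'b::topological_space"
  assumes joint: "\<And>y. t \<in> S \<Longrightarrow> y \<in> topspace X \<Longrightarrow>
      ((\<lambda>z. \<Phi> (fst z) (snd z)) \<longlongrightarrow> \<Phi> t y) (inf (nhds t) (principal S) \<times>\<^sub>F nhdsin X y)"
    and t: "t \<in> S"
  shows "continuous_map X euclidean (\<Phi> t)"
proof (rule continuous_map_nhdsin)
  fix y assume "y \<in> topspace X"
  then have "((\<lambda>(u, y). \<Phi> u y) \<longlongrightarrow> \<Phi> t y) (inf (nhds t) (principal S) \<times>\<^sub>F nhdsin X y)"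
    using joint t by (simp add: case_prod_unfold)
  from tendsto_at_self[OF this t] show "(\<Phi> t \<longlongrightarrow> \<Phi> t y) (nhdsin X y)" .
qed

text \<open>Continuity comes from compactness of \<open>S \<inter> cball t0 r\<close>. The
  convergence in the last claim is only pointwise in y; the bound 2L makes it usable under an
  integral.\<close>

lemma SUP_oscillation:
  fixes \<Phi> :: "real \<Rightarrow> 'y \<Rightarrow> real"
  assumes S: "compact S" "t0 \<in> S" and "r > 0"
    and joint: "\<And>t y. t \<in> S \<Longrightarrow> y \<in> topspace X \<Longrightarrow>
      ((\<lambda>z. \<Phi> (fst z) (snd z)) \<longlongrightarrow> \<Phi> t y) (inf (nhds t) (principal S) \<times>\<^sub>F nhdsin X y)"
    and bound: "\<And>t y. t \<in> S \<Longrightarrow> y \<in> topspace X \<Longrightarrow> \<bar>\<Phi> t y\<bar> \<le> L"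
  defines "osc \<equiv> \<lambda>r y. SUP t\<in>S \<inter> cball t0 r. \<bar>\<Phi> t y - \<Phi> t0 y\<bar>"
  shows "continuous_map X euclidean (osc r)"
    and "y \<in> topspace X \<Longrightarrow> 0 \<le> osc r y \<and> osc r y \<le> 2 * L"
    and "y \<in> topspace X \<Longrightarrow> t \<in> S \<Longrightarrow> dist t0 t \<le> r \<Longrightarrow> \<bar>\<Phi> t y - \<Phi> t0 y\<bar> \<le> osc r y"
    and "y \<in> topspace X \<Longrightarrow> (\<lambda>m. osc (1 / Suc m) y) \<longlonglongrightarrow> 0"
proof -
  let ?K = "\<lambda>r. S \<inter> cball t0 r"
  have ne: "t0 \<in> ?K r" if "r > 0" for r using S that by auto
  have le2L: "\<bar>\<Phi> t y - \<Phi> t0 y\<bar> \<le> 2 * L" if "t \<in> S" "y \<in> topspace X" for t y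
    using bound[OF that] bound[OF S(2) that(2)] by linarith
  have bdd: "bdd_above ((\<lambda>t. \<bar>\<Phi> t y - \<Phi> t0 y\<bar>) ` ?K r)" if "y \<in> topspace X" for y r
    using le2L that by (intro bdd_aboveI2[where M = "2 * L"]) auto
  show upper: "\<bar>\<Phi> t y - \<Phi> t0 y\<bar> \<le> osc r y" if "y \<in> topspace X" "t \<in> S" "dist t0 t \<le> r" for y t r
    unfolding osc_def using that bdd by (intro cSUP_upper) auto
  have upper2: "osc r y \<le> c" if "r > 0" "\<And>t. t \<in> S \<Longrightarrow> dist t0 t \<le> r \<Longrightarrow> \<bar>\<Phi> t y - \<Phi> t0 y\<bar> \<le> c" for y r c
    unfolding osc_def using that ne[OF that(1)] by (intro cSUP_least) auto
  have pos: "0 \<le> osc r y" if "y \<in> topspace X" "r > 0" for y r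
    using upper[OF that(1) S(2), of r] that(2) by simp
  show "0 \<le> osc r y \<and> osc r y \<le> 2 * L" if "y \<in> topspace X" for y
    using pos[OF that \<open>r > 0\<close>] upper2[OF \<open>r > 0\<close>] le2L that by auto
  have cont: "continuous_on S (\<lambda>t. \<Phi> t y)" if y: "y \<in> topspace X" for y
    using joint y by (rule continuous_on_joint)
  show "continuous_map X euclidean (osc r)"
  proof (rule continuous_map_nhdsin)
    fix y assume y: "y \<in> topspace X"
    show "(osc r \<longlongrightarrow> osc r y) (nhdsin X y)"
      unfolding osc_def
    proof (rule tendsto_SUP_compact)
      show "compact (?K r)" using S by (intro compact_Int_closed) auto
      show "?K r \<noteq> {}" using ne[OF \<open>r > 0\<close>] by auto
      show "continuous_on (?K r) (\<lambda>t. \<bar>\<Phi> t y - \<Phi> t0 y\<bar>)"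
        by (intro continuous_intros continuous_on_subset[OF cont[OF y]]) auto
      fix t assume t: "t \<in> ?K r"
      let ?M = "inf (nhds t) (principal (?K r)) \<times>\<^sub>F nhdsin X y"
      have "?M \<le> inf (nhds t) (principal S) \<times>\<^sub>F nhdsin X y"
        by (intro prod_filter_mono inf_mono) auto
      with joint[of t y] t y have 1: "((\<lambda>z. \<Phi> (fst z) (snd z)) \<longlongrightarrow> \<Phi> t y) ?M"
        by (auto intro: tendsto_mono)
      have "((\<lambda>(u, y). \<Phi> u y) \<longlongrightarrow> \<Phi> t0 y) (inf (nhds t0) (principal S) \<times>\<^sub>F nhdsin X y)"
        using joint[OF S(2) y] by (simp add: case_prod_unfold)
      from filterlim_compose[OF tendsto_at_self[OF this S(2)] filterlim_snd]
      have 2: "((\<lambda>z. \<Phi> t0 (snd z)) \<longlongrightarrow> \<Phi> t0 y) ?M" .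
      show "((\<lambda>(u, y). \<bar>\<Phi> u y - \<Phi> t0 y\<bar>) \<longlongrightarrow> \<bar>\<Phi> t y - \<Phi> t0 y\<bar>) ?M"
        unfolding case_prod_beta by (intro tendsto_intros 1 2)
    qed
  qed
  show "(\<lambda>m. osc (1 / Suc m) y) \<longlonglongrightarrow> 0" if y: "y \<in> topspace X" for y
  proof (rule order_tendstoI)
    fix a :: real assume "a < 0"
    then have "a < osc (1 / Suc m) y" for m using pos[OF y, of "1 / Suc m"] by (simp add: order_less_le_trans)
    then show "eventually (\<lambda>m. a < osc (1 / Suc m) y) sequentially" by simp
  next
    fix a :: real assume a: "0 < a"
    then obtain \<delta> where \<delta>: "\<delta> > 0" "\<And>t. t \<in> S \<Longrightarrow> dist t t0 < \<delta> \<Longrightarrow> dist (\<Phi> t y) (\<Phi> t0 y) < a / 2"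
      using cont[OF y] S(2) unfolding continuous_on_iff by (metis half_gt_zero)
    have "eventually (\<lambda>m. 1 / real (Suc m) < \<delta>) sequentially"
    by (rule eventually_inverse_Suc_less[OF \<delta>(1)])
    then show "eventually (\<lambda>m. osc (1 / Suc m) y < a) sequentially"
    proof eventually_elim
      case (elim m)
      have "osc (1 / Suc m) y \<le> a / 2"
      proof (rule upper2)
        fix t assume t: "t \<in> S" "dist t0 t \<le> 1 / real (Suc m)"
        then have "dist t t0 < \<delta>" using elim by (simp add: dist_commute)
        from \<delta>(2)[OF t(1) this] show "\<bar>\<Phi> t y - \<Phi> t0 y\<bar> \<le> a / 2" by (simp add: dist_real_def)
      qed simp
      then show ?case using a by simp
    qed
  qed
qed

text \<open>No tightness is needed here: the variation of the integrand is dominated by its oscillation,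
  which is itself a continuous test function.\<close>

lemma weak_limit_moving_integrand:
  fixes \<Phi> :: "real \<Rightarrow> 'y \<Rightarrow> real" and \<nu> :: "'i \<Rightarrow> 'y measure"
  assumes S: "compact S" "t0 \<in> S" and \<tau>: "filterlim \<tau> (inf (nhds t0) (principal S)) G"
    and fin: "\<And>i. finite_measure (\<nu> i)" "finite_measure \<nu>0"
    and space: "\<And>i. space (\<nu> i) = topspace X" "space \<nu>0 = topspace X"
    and meas: "\<And>i F. continuous_map X euclideanreal F \<Longrightarrow> F \<in> borel_measurable (\<nu> i)"
      "\<And>F. continuous_map X euclideanreal F \<Longrightarrow> F \<in> borel_measurable \<nu>0"
    and weak: "\<And>F. continuous_map X euclideanreal F \<Longrightarrow> bounded (F ` topspace X) \<Longrightarrow>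
      ((\<lambda>i. \<integral>y. F y \<partial>\<nu> i) \<longlongrightarrow> (\<integral>y. F y \<partial>\<nu>0)) G"
    and joint: "\<And>t y. t \<in> S \<Longrightarrow> y \<in> topspace X \<Longrightarrow>
      ((\<lambda>z. \<Phi> (fst z) (snd z)) \<longlongrightarrow> \<Phi> t y) (inf (nhds t) (principal S) \<times>\<^sub>F nhdsin X y)"
    and bound: "\<And>t y. t \<in> S \<Longrightarrow> y \<in> topspace X \<Longrightarrow> \<bar>\<Phi> t y\<bar> \<le> L"
  shows "((\<lambda>i. \<integral>y. \<Phi> (\<tau> i) y \<partial>\<nu> i) \<longlongrightarrow> (\<integral>y. \<Phi> t0 y \<partial>\<nu>0)) G"
proof (rule tendstoI)
  fix \<epsilon> :: real assume \<epsilon>: "\<epsilon> > 0"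
  define osc where "osc r y = (SUP t\<in>S \<inter> cball t0 r. \<bar>\<Phi> t y - \<Phi> t0 y\<bar>)" for r y
  have osc1: "continuous_map X euclideanreal (osc r)" if "r > 0" for r
    unfolding osc_def by (rule SUP_oscillation(1)[OF S that]) (fact joint bound)+
  have osc2: "0 \<le> osc r y \<and> osc r y \<le> 2 * L" if "r > 0" "y \<in> topspace X" for r y
    unfolding osc_def by (rule SUP_oscillation(2)[OF S that(1)]) (fact joint bound that(2))+
  have osc3: "\<bar>\<Phi> t y - \<Phi> t0 y\<bar> \<le> osc r y"
    if "r > 0" "y \<in> topspace X" "t \<in> S" "dist t0 t \<le> r" for r y t
    unfolding osc_def by (rule SUP_oscillation(3)[OF S that(1)]) (fact joint bound that(2-))+
  have osc4: "(\<lambda>m. osc (1 / Suc m) y) \<longlonglongrightarrow> 0" if "y \<in> topspace X" for y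
    unfolding osc_def by (rule SUP_oscillation(4)[OF S zero_less_one]) (fact joint bound that)+
  have contt: "continuous_map X euclideanreal (\<Phi> t)" if "t \<in> S" for t
    using joint that by (rule continuous_map_joint)
  have bdd: "bounded (F ` topspace X)" if "\<And>y. y \<in> topspace X \<Longrightarrow> \<bar>F y\<bar> \<le> c" for F :: "'y \<Rightarrow> real" and c
    using that by (auto simp: bounded_iff)
  have osc_bdd: "\<bar>osc r y\<bar> \<le> 2 * L" if "r > 0" "y \<in> topspace X" for r y
    using osc2[OF that] by simp
  \<comment> \<open>The radius is fixed by looking at the limit measure alone, through dominated
    convergence. Only afterwards does i vary, with this one oscillation as test function.\<close>
  have "(\<lambda>m. \<integral>y. osc (1 / Suc m) y \<partial>\<nu>0) \<longlonglongrightarrow> (\<integral>y. 0 \<partial>\<nu>0)"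
  proof (rule integral_dominated_convergence[where w = "\<lambda>_. 2 * L"])
    show "AE y in \<nu>0. (\<lambda>m. osc (1 / Suc m) y) \<longlonglongrightarrow> 0"
      using osc4 space(2) by (intro AE_I2) auto
    show "AE y in \<nu>0. norm (osc (1 / Suc m) y) \<le> 2 * L" for m
      using osc_bdd space(2) by (intro AE_I2) auto
    show "integrable \<nu>0 (\<lambda>_. 2 * L)" using fin(2) by (simp add: finite_measure.integrable_const)
  qed (use meas(2) osc1 in auto)
  then have "eventually (\<lambda>m. (\<integral>y. osc (1 / Suc m) y \<partial>\<nu>0) < \<epsilon> / 4) sequentially"
    using \<epsilon> by (intro order_tendstoD(2)) auto
  then obtain m where m: "(\<integral>y. osc (1 / Suc m) y \<partial>\<nu>0) < \<epsilon> / 4"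
    by (meson eventually_sequentially order_refl)
  define r where "r = 1 / real (Suc m)"
  have r: "r > 0" by (simp add: r_def)
  have "eventually (\<lambda>i. (\<integral>y. osc r y \<partial>\<nu> i) < \<epsilon> / 4) G"
    using m by (intro order_tendstoD(2)[OF weak[OF osc1[OF r] bdd[OF osc_bdd[OF r]]]]) (auto simp: r_def)
  moreover have "eventually (\<lambda>i. dist (\<integral>y. \<Phi> t0 y \<partial>\<nu> i) (\<integral>y. \<Phi> t0 y \<partial>\<nu>0) < \<epsilon> / 4) G"
    using \<epsilon> by (intro tendstoD[OF weak[OF contt[OF S(2)] bdd[OF bound[OF S(2)]]]]) auto
  moreover have "eventually (\<lambda>t. t \<in> S \<and> dist t0 t \<le> r) (inf (nhds t0) (principal S))"
  proof -
    have "eventually (\<lambda>t. t \<in> ball t0 r) (nhds t0)" using r by (intro eventually_nhds_in_open) auto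
    then show ?thesis unfolding eventually_inf_principal by eventually_elim auto
  qed
  then have "eventually (\<lambda>i. \<tau> i \<in> S \<and> dist t0 (\<tau> i) \<le> r) G"
    using \<tau> by (rule eventually_compose_filterlim)
  ultimately show "eventually (\<lambda>i. dist (\<integral>y. \<Phi> (\<tau> i) y \<partial>\<nu> i) (\<integral>y. \<Phi> t0 y \<partial>\<nu>0) < \<epsilon>) G"
  proof eventually_elim
    case (elim i)
    have int: "integrable (\<nu> i) F" if "continuous_map X euclideanreal F" "\<And>y. y \<in> topspace X \<Longrightarrow> \<bar>F y\<bar> \<le> c" for F c
    proof (rule finite_measure.integrable_const_bound[OF fin(1)])
      show "AE y in \<nu> i. norm (F y) \<le> c" using that(2) space(1) by (intro AE_I2) auto
    qed (rule meas(1)[OF that(1)])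
    have i1: "integrable (\<nu> i) (\<Phi> (\<tau> i))" using elim(3) contt bound by (intro int) auto
    have i2: "integrable (\<nu> i) (\<Phi> t0)" using S(2) contt bound by (intro int) auto
    have i3: "integrable (\<nu> i) (osc r)" by (rule int[OF osc1[OF r] osc_bdd[OF r]])
    have "\<bar>(\<integral>y. \<Phi> (\<tau> i) y \<partial>\<nu> i) - (\<integral>y. \<Phi> t0 y \<partial>\<nu> i)\<bar> = \<bar>\<integral>y. \<Phi> (\<tau> i) y - \<Phi> t0 y \<partial>\<nu> i\<bar>"
      using i1 i2 by simp
    also have "\<dots> \<le> (\<integral>y. \<bar>\<Phi> (\<tau> i) y - \<Phi> t0 y\<bar> \<partial>\<nu> i)" by (rule integral_abs_bound)
    also have "\<dots> \<le> (\<integral>y. osc r y \<partial>\<nu> i)"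
      using osc3[OF r] elim(3) space(1) i1 i2 i3 by (intro integral_mono) auto
    also have "\<dots> < \<epsilon> / 4" by (rule elim(1))
    finally show ?case using elim(2) \<epsilon> unfolding dist_real_def by linarith
  qed
qed

section \<open>Derivative and Jacobian along a curve\<close>

locale riemannian_curve =
  fixes A :: "('m::{t2_space,second_countable_topology}, 'e::euclidean_space) chart set"
    and g :: "'m \<Rightarrow> ('m, 'e) tangent_vector \<Rightarrow> ('m, 'e) tangent_vector \<Rightarrow> real"
    and \<gamma> :: "real \<Rightarrow> 'm"
  assumes atlas: "smooth_atlas A" and metric: "riemannian_metric A g"
    and curve: "Ck_curve_on \<infinity> A {0..1} \<gamma>"
begin

lemmas topspace_C1 = topspace_C1_topology[OF atlas]

definition deriv_along :: "('m \<Rightarrow> real) \<Rightarrow> real \<Rightarrow> real" where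
  "deriv_along f t = differential A f (\<gamma> t) (velocity A {0..1} \<gamma> t)"

definition jac_along :: "('m \<Rightarrow> real) \<Rightarrow> real \<Rightarrow> real" where
  "jac_along f t = Defs.jacobian A g (\<gamma> t) f"

lemma at_within_unit_interval: "t \<in> {0..1} \<Longrightarrow> at t within {0..1::real} \<noteq> bot"
  by (simp add: trivial_limit_within)

lemma has_deriv_along:
  assumes "f \<in> C1_functions A" "t \<in> {0..1}"
  shows "((\<lambda>s. f (\<gamma> s)) has_real_derivative deriv_along f t) (at t within {0..1})"
  unfolding deriv_along_def
  by (rule differential_velocity[OF atlas assms(1) curve one_le_infinity_enat(1) assms(2)
        at_within_unit_interval[OF assms(2)]])

lemma deriv_along_chart:
  assumes f: "f \<in> C1_functions A" and t: "t \<in> {0..1}" and c: "c \<in> A" "\<gamma> t \<in> dom_chart c"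
  shows "deriv_along f t = chart_gradient c f (coord c (\<gamma> t)) \<bullet> velocity A {0..1} \<gamma> t c"
  using has_deriv_along[OF f t]
    C1_along_curve[OF atlas f curve one_le_infinity_enat(1) t at_within_unit_interval[OF t] c]
  unfolding has_real_derivative_iff_has_vector_derivative
  by (rule vector_derivative_unique_within[OF at_within_unit_interval[OF t]])

lemma curve_tendsto:
  assumes "t0 \<in> {0..1}" shows "(\<gamma> \<longlongrightarrow> \<gamma> t0) (inf (nhds t0) (principal {0..1}))"
  using curve assms by (intro tendsto_nhds_within) (auto simp: Ck_curve_on_def continuous_on_def)

lemma velocity_tendsto:
  assumes "t0 \<in> {0..1}" "c \<in> A" "\<gamma> t0 \<in> dom_chart c"
  shows "((\<lambda>t. velocity A {0..1} \<gamma> t c) \<longlongrightarrow> velocity A {0..1} \<gamma> t0 c) (inf (nhds t0) (principal {0..1}))"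
  using coord_curve_velocity(2)[OF curve one_le_infinity_enat(1) assms(1)
      at_within_unit_interval[OF assms(1)] assms(2,3)] at_within_unit_interval
  by (intro tendsto_nhds_within) auto

lemma eventually_in_chart:
  assumes "t0 \<in> {0..1}" "c \<in> A" "\<gamma> t0 \<in> dom_chart c"
  shows "eventually (\<lambda>t. t \<in> {0..1} \<and> \<gamma> t \<in> dom_chart c) (inf (nhds t0) (principal {0..1}))"
proof -
  have "open (dom_chart c)" using smooth_atlas_chart[OF atlas assms(2)] by (simp add: is_chart_def)
  then have "eventually (\<lambda>t. \<gamma> t \<in> dom_chart c) (inf (nhds t0) (principal {0..1}))"
    using topological_tendstoD[OF curve_tendsto[OF assms(1)] _ assms(3)] by blast
  moreover have "eventually (\<lambda>t. t \<in> {0..1}) (inf (nhds t0) (principal {0..1}))"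
    by (simp add: eventually_inf_principal)
  ultimately show ?thesis by eventually_elim simp
qed

abbreviation nearby :: "real \<Rightarrow> ('m \<Rightarrow> real) \<Rightarrow> (real \<times> ('m \<Rightarrow> real)) filter" where
  "nearby t f \<equiv> inf (nhds t) (principal {0..1}) \<times>\<^sub>F nhdsin (C1_topology A) f"

lemma filterlim_nearby:
  assumes "t0 \<in> {0..1}"
  shows "filterlim (\<lambda>z. (\<gamma> (fst z), snd z)) (nhds (\<gamma> t0) \<times>\<^sub>F nhdsin (C1_topology A) f0) (nearby t0 f0)"
  by (intro filterlim_Pair filterlim_snd filterlim_compose[OF curve_tendsto[OF assms] filterlim_fst])

lemma jac_along_tendsto:
  assumes "t0 \<in> {0..1}" "f0 \<in> C1_functions A"
  shows "((\<lambda>z. jac_along (snd z) (fst z)) \<longlongrightarrow> jac_along f0 t0) (nearby t0 f0)"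
  using filterlim_compose[OF jacobian_tendsto[OF atlas metric assms(2)] filterlim_nearby[OF assms(1)]]
  by (simp add: jac_along_def)

lemma deriv_along_tendsto:
  assumes t0: "t0 \<in> {0..1}" and f0: "f0 \<in> C1_functions A"
  shows "((\<lambda>z. deriv_along (snd z) (fst z)) \<longlongrightarrow> deriv_along f0 t0) (nearby t0 f0)"
proof -
  define c where "c = chart_at A (\<gamma> t0)"
  have c: "c \<in> A" "\<gamma> t0 \<in> dom_chart c" using chart_at[OF atlas] by (auto simp: c_def)
  have 1: "((\<lambda>z. chart_gradient c (snd z) (coord c (\<gamma> (fst z)))) \<longlongrightarrow> chart_gradient c f0 (coord c (\<gamma> t0))) (nearby t0 f0)"
    using filterlim_compose[OF gradient_coord_tendsto[OF atlas metric c f0] filterlim_nearby[OF t0]] by simp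
  have 2: "((\<lambda>z. velocity A {0..1} \<gamma> (fst z) c) \<longlongrightarrow> velocity A {0..1} \<gamma> t0 c) (nearby t0 f0)"
    by (rule filterlim_compose[OF velocity_tendsto[OF t0 c] filterlim_fst])
  have "eventually (\<lambda>z. fst z \<in> {0..1} \<and> \<gamma> (fst z) \<in> dom_chart c) (nearby t0 f0)"
    using eventually_in_chart[OF t0 c] by (rule eventually_compose_filterlim[OF _ filterlim_fst])
  moreover have "eventually (\<lambda>z. snd z \<in> C1_functions A) (nearby t0 f0)"
    using eventually_C1_functions[OF atlas metric f0] by (rule eventually_compose_filterlim[OF _ filterlim_snd])
  ultimately have "eventually (\<lambda>z. chart_gradient c (snd z) (coord c (\<gamma> (fst z))) \<bullet> velocity A {0..1} \<gamma> (fst z) c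
      = deriv_along (snd z) (fst z)) (nearby t0 f0)"
    by eventually_elim (rule deriv_along_chart[OF _ _ c(1), symmetric]; simp)
  with tendsto_inner[OF 1 2] show ?thesis
    unfolding deriv_along_chart[OF f0 t0 c] by (rule Lim_transform_eventually)
qed

text \<open>A supremum of reals has no sign by itself. The gradient estimate at a basis vector,
  whose metric length is positive, forces it.\<close>

lemma jac_along_nonneg: assumes "f \<in> C1_functions A" shows "0 \<le> jac_along f t"
proof -
  obtain e :: 'e where e: "e \<in> Basis" using nonempty_Basis by blast
  note c = chart_at[OF atlas, of "\<gamma> t"]
  have "0 < chart_metric A g (chart_at A (\<gamma> t)) (\<gamma> t) e e"
    using e by (intro chart_metric_pos[OF atlas metric c] nonzero_Basis)
  moreover have "0 \<le> jac_along f t * sqrt (chart_metric A g (chart_at A (\<gamma> t)) (\<gamma> t) e e)"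
    using gradient_le_jacobian[OF atlas metric assms c, of e] unfolding jac_along_def by linarith
  ultimately show ?thesis by (simp add: zero_le_mult_iff)
qed

text \<open>By duality |h'(t)| is at most J times the metric length of the velocity. In a chart
  around \<gamma>(t0) that length is continuous in t, hence below its value at t0 plus 1 nearby; a
  finite subcover of [0,1] makes the bound global. One plus the sum of the local constants is
  positive and dominates each of them.\<close>

lemma deriv_along_le_jac:
  obtains L where "L > 0" "\<And>f t. f \<in> C1_functions A \<Longrightarrow> t \<in> {0..1} \<Longrightarrow> \<bar>deriv_along f t\<bar> \<le> L * jac_along f t"
proof -
  have "\<exists>U C. open U \<and> t0 \<in> U \<and> C > 0 \<and>
      (\<forall>t\<in>U \<inter> {0..1}. \<forall>f\<in>C1_functions A. \<bar>deriv_along f t\<bar> \<le> C * jac_along f t)" if t0: "t0 \<in> {0..1}" for t0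
  proof -
    define c where "c = chart_at A (\<gamma> t0)"
    have c: "c \<in> A" "\<gamma> t0 \<in> dom_chart c" using chart_at[OF atlas] by (auto simp: c_def)
    define s where "s t = sqrt (chart_metric A g c (\<gamma> t) (velocity A {0..1} \<gamma> t c) (velocity A {0..1} \<gamma> t c))" for t
    have "filterlim (\<lambda>t. (\<gamma> t, velocity A {0..1} \<gamma> t c)) (nhds (\<gamma> t0) \<times>\<^sub>F nhds (velocity A {0..1} \<gamma> t0 c))
        (inf (nhds t0) (principal {0..1}))"
      by (intro filterlim_Pair curve_tendsto velocity_tendsto t0 c)
    from tendsto_real_sqrt[OF filterlim_compose[OF chart_metric_tendsto[OF atlas metric c] this]]
    have "(s \<longlongrightarrow> s t0) (inf (nhds t0) (principal {0..1}))" by (simp add: s_def[abs_def])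
    then have "eventually (\<lambda>t. s t < \<bar>s t0\<bar> + 1) (inf (nhds t0) (principal {0..1}))"
      by (rule order_tendstoD(2)) simp
    with eventually_in_chart[OF t0 c]
    have "eventually (\<lambda>t. \<forall>f\<in>C1_functions A. \<bar>deriv_along f t\<bar> \<le> (\<bar>s t0\<bar> + 1) * jac_along f t)
        (inf (nhds t0) (principal {0..1}))"
    proof eventually_elim
      case (elim t)
      show ?case
      proof
        fix f assume f: "f \<in> C1_functions A"
        have "\<bar>deriv_along f t\<bar> \<le> jac_along f t * s t"
          using gradient_le_jacobian[OF atlas metric f c(1)] elim(1) deriv_along_chart[OF f _ c(1)]
          by (simp add: jac_along_def s_def)
        also have "\<dots> \<le> jac_along f t * (\<bar>s t0\<bar> + 1)"
          using elim(2) jac_along_nonneg[OF f] by (intro mult_left_mono) auto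
        finally show "\<bar>deriv_along f t\<bar> \<le> (\<bar>s t0\<bar> + 1) * jac_along f t" by (simp add: mult.commute)
      qed
    qed
    then obtain U where "open U" "t0 \<in> U"
      "\<And>t. t \<in> U \<Longrightarrow> t \<in> {0..1} \<Longrightarrow> \<forall>f\<in>C1_functions A. \<bar>deriv_along f t\<bar> \<le> (\<bar>s t0\<bar> + 1) * jac_along f t"
      unfolding eventually_inf_principal eventually_nhds by blast
    then show ?thesis by (intro exI[of _ U] exI[of _ "\<bar>s t0\<bar> + 1"]) auto
  qed
  then obtain U C where UC: "\<And>t. t \<in> {0..1} \<Longrightarrow> open (U t)" "\<And>t. t \<in> {0..1} \<Longrightarrow> t \<in> U t"
      "\<And>t. t \<in> {0..1} \<Longrightarrow> C t > 0"
      "\<And>t s f. t \<in> {0..1} \<Longrightarrow> s \<in> U t \<inter> {0..1} \<Longrightarrow> f \<in> C1_functions A \<Longrightarrow> \<bar>deriv_along f s\<bar> \<le> C t * jac_along f s"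
    by metis
  obtain T where T: "T \<subseteq> {0..1}" "finite T" "{0..1} \<subseteq> (\<Union>t\<in>T. U t)"
    by (rule compactE_image[OF compact_Icc, of "{0..1}" U]) (use UC(1,2) in blast)+
  show thesis
  proof
    have Cpos: "0 \<le> C s" if "s \<in> T" for s using UC(3)[of s] T(1) that by (auto simp: less_imp_le subset_iff)
    then have "0 \<le> sum C T" by (intro sum_nonneg)
    then show "1 + sum C T > 0" by simp
    fix f and t :: real assume f: "f \<in> C1_functions A" and t: "t \<in> {0..1}"
    then obtain t0 where t0: "t0 \<in> T" "t \<in> U t0" using T(3) by blast
    have "\<bar>deriv_along f t\<bar> \<le> C t0 * jac_along f t" using t0 T(1) t f by (intro UC(4)) auto
    also have "C t0 \<le> 1 + sum C T"
      using member_le_sum[of t0 T C] t0(1) T(2) Cpos by auto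
    then have "C t0 * jac_along f t \<le> (1 + sum C T) * jac_along f t"
      by (intro mult_right_mono jac_along_nonneg f)
    finally show "\<bar>deriv_along f t\<bar> \<le> (1 + sum C T) * jac_along f t" .
  qed
qed

lemma continuous_on_deriv_along: "f \<in> C1_functions A \<Longrightarrow> continuous_on {0..1} (deriv_along f)"
  by (rule continuous_on_joint[where X = "C1_topology A" and \<Phi> = "\<lambda>t f. deriv_along f t"])
    (simp_all add: deriv_along_tendsto topspace_C1)

text \<open>Minus a supremum over the fixed interval of shifts u. Clamping t + u is continuous and
  stays in [0,1], so the joint continuity of the derivative applies at every shift.\<close>

lemma window_min_tendsto:
  assumes t0: "t0 \<in> {0..1}" and f0: "f0 \<in> C1_functions A"
  shows "((\<lambda>z. window_min n (deriv_along (snd z)) (fst z)) \<longlongrightarrow> window_min n (deriv_along f0) t0) (nearby t0 f0)"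
proof -
  define F where "F u z = - \<bar>deriv_along (snd z) (max 0 (min 1 (fst z + u)))\<bar>" for u and z :: "real \<times> ('m \<Rightarrow> real)"
  let ?K = "{- 1 / real (Suc n)..1 / real (Suc n)}"
  have eq: "window_min n (deriv_along (snd z)) (fst z) = - (SUP u\<in>?K. F u z)" for z
    by (simp add: window_min_def F_def Inf_real_def image_image)
  have "((\<lambda>z. SUP u\<in>?K. F u z) \<longlongrightarrow> (SUP u\<in>?K. F u (t0, f0))) (nearby t0 f0)"
  proof (rule tendsto_SUP_compact)
    show "?K \<noteq> {}" by (simp add: divide_simps)
    show "continuous_on ?K (\<lambda>u. F u (t0, f0))"
      unfolding F_def fst_conv snd_conv
      by (intro continuous_intros continuous_on_compose2[OF continuous_on_deriv_along[OF f0]]) auto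
    fix u0 assume "u0 \<in> ?K"
    let ?M = "inf (nhds u0) (principal ?K) \<times>\<^sub>F nearby t0 f0"
    have u: "((\<lambda>y. fst y) \<longlongrightarrow> u0) ?M" by (rule filterlim_mono[OF filterlim_fst inf_le1 order_refl])
    have "((\<lambda>t. t) \<longlongrightarrow> t0) (inf (nhds t0) (principal {0..1}))"
      by (rule filterlim_mono[OF filterlim_ident inf_le1 order_refl])
    from filterlim_compose[OF this filterlim_compose[OF filterlim_fst filterlim_snd]]
    have t: "((\<lambda>y. fst (snd y)) \<longlongrightarrow> t0) ?M" .
    have "((\<lambda>y. max 0 (min 1 (fst (snd y) + fst y))) \<longlongrightarrow> max 0 (min 1 (t0 + u0))) ?M"
      by (intro tendsto_intros t u)
    then have "filterlim (\<lambda>y. max 0 (min 1 (fst (snd y) + fst y)))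
        (inf (nhds (max 0 (min 1 (t0 + u0)))) (principal {0..1})) ?M"
      by (simp add: filterlim_inf filterlim_principal)
    then have "filterlim (\<lambda>y. (max 0 (min 1 (fst (snd y) + fst y)), snd (snd y)))
        (nearby (max 0 (min 1 (t0 + u0))) f0) ?M"
      by (intro filterlim_Pair filterlim_compose[OF filterlim_snd filterlim_snd])
    from filterlim_compose[OF deriv_along_tendsto[OF _ f0] this]
    have "((\<lambda>y. F (fst y) (snd y)) \<longlongrightarrow> F u0 (t0, f0)) ?M"
      unfolding F_def by (auto intro!: tendsto_intros)
    then show "((\<lambda>(u, y). F u y) \<longlongrightarrow> F u0 (t0, f0)) ?M" by (simp add: case_prod_unfold)
  qed simp
  then have "((\<lambda>z. - (SUP u\<in>?K. F u z)) \<longlongrightarrow> - (SUP u\<in>?K. F u (t0, f0))) (nearby t0 f0)" by (rule tendsto_minus)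
  then show ?thesis using eq[of "(t0, f0)"] by (simp add: eq)
qed

lemma cutoff_tendsto:
  assumes "t0 \<in> {0..1}" "f0 \<in> C1_functions A"
  shows "((\<lambda>z. cutoff n (deriv_along (snd z)) (fst z)) \<longlongrightarrow> cutoff n (deriv_along f0) t0) (nearby t0 f0)"
  unfolding cutoff_def by (intro tendsto_intros window_min_tendsto assms)

text \<open>The maximum keeps the quotient continuous where the Jacobian vanishes; it is inactive wherever the
  cutoff is positive, if \<open>\<bar>h'\<bar> \<le> L J\<close>.\<close>

definition normalized_speed :: "nat \<Rightarrow> real \<Rightarrow> real \<Rightarrow> ('m \<Rightarrow> real) \<Rightarrow> real" where
  "normalized_speed n L t f =
     \<bar>deriv_along f t\<bar> * cutoff n (deriv_along f) t / max (jac_along f t) (1 / (real (Suc n) * L))"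

lemma normalized_speed_tendsto:
  assumes "t0 \<in> {0..1}" "f0 \<in> C1_functions A" "L > 0"
  shows "((\<lambda>z. normalized_speed n L (fst z) (snd z)) \<longlongrightarrow> normalized_speed n L t0 f0) (nearby t0 f0)"
proof -
  have "1 / (real (Suc n) * L) > 0" using assms(3) by simp
  then have "max (jac_along f0 t0) (1 / (real (Suc n) * L)) \<noteq> 0" by linarith
  then show ?thesis
    unfolding normalized_speed_def
    by (intro tendsto_intros deriv_along_tendsto jac_along_tendsto cutoff_tendsto assms)
qed

lemma normalized_speed_bound:
  assumes f: "f \<in> C1_functions A" and t: "t \<in> {0..1}" and L: "L > 0" "\<bar>deriv_along f t\<bar> \<le> L * jac_along f t"
  shows "\<bar>normalized_speed n L t f\<bar> \<le> L"
proof -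
  define m where "m = max (jac_along f t) (1 / (real (Suc n) * L))"
  have "1 / (real (Suc n) * L) > 0" using L(1) by simp
  then have m: "m > 0" "jac_along f t \<le> m" unfolding m_def by linarith+
  have "\<bar>deriv_along f t\<bar> * cutoff n (deriv_along f) t \<le> \<bar>deriv_along f t\<bar>"
    using cutoff_bounds by (intro mult_left_le) auto
  also have "\<dots> \<le> L * m" using L m(2) by (meson less_imp_le mult_left_mono order_trans)
  finally show ?thesis
    using m(1) cutoff_bounds(1)[of n "deriv_along f" t]
    unfolding normalized_speed_def m_def[symmetric] by (simp add: abs_mult divide_simps)
qed

text \<open>Where the cutoff is positive, 1/(n+1) < |h'(t)| \<le> L J, that is J > 1/((n+1) L): this
  is where the floor in the denominator comes from. Elsewhere both sides vanish.\<close>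

lemma normalized_speed_times_jac:
  assumes f: "f \<in> C1_functions A" and t: "t \<in> {0..1}" and L: "L > 0" "\<bar>deriv_along f t\<bar> \<le> L * jac_along f t"
  shows "jac_along f t * normalized_speed n L t f = \<bar>deriv_along f t\<bar> * cutoff n (deriv_along f) t"
proof (cases "cutoff n (deriv_along f) t > 0")
  case True
  have "1 / Suc n < \<bar>deriv_along f t\<bar>" by (rule cutoff_pos_imp[OF True t]) simp
  then have "1 / Suc n < L * jac_along f t" using L(2) by linarith
  then have "1 / Suc n / L < jac_along f t"
    unfolding pos_divide_less_eq[OF L(1)] by (simp only: mult.commute)
  then have "1 / (real (Suc n) * L) < jac_along f t" by simp
  moreover have "1 / (real (Suc n) * L) > 0" using L(1) by simp
  ultimately have "max (jac_along f t) (1 / (real (Suc n) * L)) = jac_along f t" "jac_along f t \<noteq> 0" by linarith+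
  then show ?thesis unfolding normalized_speed_def by simp
next
  case False
  then have "cutoff n (deriv_along f) t = 0" using cutoff_bounds(1)[of n "deriv_along f" t] by linarith
  then show ?thesis by (simp add: normalized_speed_def)
qed

end

section \<open>Expected crossings\<close>

text \<open>Sampling the parameter on a grid of mesh 1/(k+1) glues countably many measurable
  functions of \<omega>; continuity in t recovers \<open>F\<close> as k grows. The joint
  measurability is what Fubini requires, and clamping extends the parameter from [0,1] to the
  line.\<close>

lemma caratheodory_measurable:
  fixes F :: "'w \<Rightarrow> real \<Rightarrow> real"
  assumes meas: "\<And>t. t \<in> {0..1} \<Longrightarrow> (\<lambda>\<omega>. F \<omega> t) \<in> borel_measurable M"
    and cont: "\<And>\<omega>. \<omega> \<in> space M \<Longrightarrow> continuous_on {0..1} (F \<omega>)"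
  shows "(\<lambda>z. F (fst z) (max 0 (min 1 (snd z)))) \<in> borel_measurable (M \<Otimes>\<^sub>M lborel)"
proof -
  define c :: "real \<Rightarrow> real" where "c t = max 0 (min 1 t)" for t
  have c: "c t \<in> {0..1}" for t by (simp add: c_def)
  define F' where "F' k z = F (fst z) (c (\<lfloor>c (snd z) * Suc k\<rfloor> / Suc k))" for k :: nat and z
  have [measurable]: "c \<in> borel_measurable borel" unfolding c_def by measurable
  have "F' k \<in> borel_measurable (M \<Otimes>\<^sub>M lborel)" for k
    unfolding F'_def
  proof (rule measurable_compose_countable[where f = "\<lambda>i z. F (fst z) (c (real_of_int i / real (Suc k)))"
        and g = "\<lambda>z. \<lfloor>c (snd z) * real (Suc k)\<rfloor>"])
    fix i :: int
    have [measurable]: "(\<lambda>\<omega>. F \<omega> (c (real_of_int i / Suc k))) \<in> borel_measurable M" by (rule meas[OF c])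
    show "(\<lambda>z. F (fst z) (c (real_of_int i / Suc k))) \<in> borel_measurable (M \<Otimes>\<^sub>M lborel)" by measurable
  qed measurable
  moreover have "(\<lambda>k. F' k z) \<longlonglongrightarrow> F (fst z) (c (snd z))" if z: "z \<in> space (M \<Otimes>\<^sub>M lborel)" for z
  proof -
    let ?t = "c (snd z)"
    have "(\<lambda>k. \<lfloor>?t * Suc k\<rfloor> / real (Suc k)) \<longlonglongrightarrow> ?t"
    proof (rule tendsto_sandwich)
      have "(\<lambda>k. ?t - inverse (real (Suc k))) \<longlonglongrightarrow> ?t - 0"
        by (intro tendsto_diff tendsto_const LIMSEQ_inverse_real_of_nat)
      then show "(\<lambda>k. ?t - inverse (real (Suc k))) \<longlonglongrightarrow> ?t" by simp
      have "?t - inverse (real (Suc k)) \<le> \<lfloor>?t * Suc k\<rfloor> / real (Suc k)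
          \<and> \<lfloor>?t * Suc k\<rfloor> / real (Suc k) \<le> ?t" for k
      proof -
        have fl: "real_of_int \<lfloor>?t * Suc k\<rfloor> \<le> ?t * Suc k" "?t * Suc k - 1 \<le> real_of_int \<lfloor>?t * Suc k\<rfloor>"
          by linarith+
        have "(?t * Suc k - 1) / Suc k \<le> \<lfloor>?t * Suc k\<rfloor> / real (Suc k)" "\<lfloor>?t * Suc k\<rfloor> / real (Suc k) \<le> ?t * Suc k / Suc k"
          by (intro divide_right_mono fl; simp)+
        moreover have "(?t * Suc k - 1) / Suc k = ?t - inverse (real (Suc k))" "?t * Suc k / Suc k = ?t"
          by (simp_all add: diff_divide_distrib inverse_eq_divide del: of_nat_Suc)
        ultimately show ?thesis by simp
      qed
      then show "eventually (\<lambda>k. ?t - inverse (real (Suc k)) \<le> \<lfloor>?t * Suc k\<rfloor> / real (Suc k)) sequentially"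
        "eventually (\<lambda>k. \<lfloor>?t * Suc k\<rfloor> / real (Suc k) \<le> ?t) sequentially" by auto
    qed simp
    then have "(\<lambda>k. c (\<lfloor>?t * Suc k\<rfloor> / real (Suc k))) \<longlonglongrightarrow> c ?t"
      unfolding c_def by (intro tendsto_intros)
    moreover have "c ?t = ?t" by (simp add: c_def)
    moreover have "fst z \<in> space M" using z by (auto simp: space_pair_measure)
    ultimately show ?thesis
      unfolding F'_def using continuous_on_tendsto_compose[OF cont _ c] c by fastforce
  qed
  ultimately show ?thesis
    unfolding c_def[symmetric] by (rule borel_measurable_LIMSEQ_real[rotated])
qed

section \<open>Disintegration over the value of the field at a point\<close>

locale zkrok_on_curve = riemannian_curve A g \<gamma>
  for A :: "('m::{t2_space,second_countable_topology}, 'e::euclidean_space) chart set" and g \<gamma> +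
  fixes P :: "'w measure" and X :: "'w \<Rightarrow> 'm \<Rightarrow> real" and \<rho> :: "'m \<Rightarrow> real \<Rightarrow> real"
    and \<mu> :: "'m \<Rightarrow> real \<Rightarrow> ('m \<Rightarrow> real) measure"
  assumes zkrok: "zKROK A g P X \<rho> \<mu>"
begin

lemma prob_P: "prob_space P" and X_measurable: "X \<in> measurable P (C1_borel A)"
  and regular: "AE \<omega> in P. zero_regular_value A (X \<omega>)"
  and density_nonneg: "0 \<le> \<rho> p x"
  and X_distributed: "distributed P lborel (\<lambda>\<omega>. X \<omega> p) (\<lambda>x. ennreal (\<rho> p x))"
  and density_isCont: "isCont (\<lambda>(q, x). \<rho> q x) (p, 0)"
  and cond_prob: "regular_conditional_prob A P X p (\<mu> p)"
  and finite_J_measure: "finite_measure (J_measure A g p (\<mu> p x))"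
  using zkrok unfolding zKROK_def by blast+

lemma J_measure_isCont:
  assumes "continuous_map (C1_topology A) euclideanreal F" "bounded (F ` C1_functions A)"
  shows "isCont (\<lambda>(q, x). \<integral>f. F f \<partial>J_measure A g q (\<mu> q x)) (p, 0)"
  using zkrok assms unfolding zKROK_def by blast

sublocale prob_space P by (rule prob_P)

lemma X_in_C1: "\<omega> \<in> space P \<Longrightarrow> X \<omega> \<in> C1_functions A"
  using measurable_space[OF X_measurable] space_C1_borel[OF atlas] by simp

lemma kernel: "prob_space (\<mu> p x)" "space (\<mu> p x) = C1_functions A" "sets (\<mu> p x) = sets (C1_borel A)"
  using cond_prob[of p] unfolding regular_conditional_prob_def by blast+

lemma kernel_measurable: "\<mu> p \<in> measurable borel (prob_algebra (C1_borel A))"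
proof (rule measurable_prob_algebraI)
  show "prob_space (\<mu> p x)" for x by (rule kernel)
  show "\<mu> p \<in> borel \<rightarrow>\<^sub>M subprob_algebra (C1_borel A)"
  proof (rule measurable_subprob_algebra)
    show "subprob_space (\<mu> p x)" for x using kernel(1) by (rule prob_space_imp_subprob_space)
    show "sets (\<mu> p x) = sets (C1_borel A)" for x by (rule kernel)
    show "(\<lambda>x. emeasure (\<mu> p x) B) \<in> borel_measurable borel" if "B \<in> sets (C1_borel A)" for B
      using cond_prob[of p] that unfolding regular_conditional_prob_def by blast
  qed
qed

lemma borel_measurable_kernel: "borel_measurable (\<mu> p x) = borel_measurable (C1_borel A)"
  by (rule measurable_cong_sets) (simp_all add: kernel)

lemma evaluation_measurable: "(\<lambda>\<omega>. X \<omega> p) \<in> borel_measurable P"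
  using X_distributed[of p] by (simp add: distributed_def)

lemma conditional_nn_integral_measurable:
  assumes F: "F \<in> borel_measurable (C1_borel A)"
  shows "(\<lambda>x. \<integral>\<^sup>+f. F f \<partial>\<mu> p x) \<in> borel_measurable borel"
  using nn_integral_measurable_subprob_algebra[OF F] measurable_prob_algebraD[OF kernel_measurable]
  by (rule measurable_compose[rotated])

text \<open>The defining identity of the conditional law is the case of an indicator. Linearity and
  monotone limits extend it to all nonnegative measurable \<open>F\<close>; the law of X(p) is then
  replaced by its density.\<close>

lemma disintegration:
  fixes F :: "('m \<Rightarrow> real) \<Rightarrow> ennreal"
  assumes "F \<in> borel_measurable (C1_borel A)" and V: "V \<in> sets borel"
  shows "(\<integral>\<^sup>+\<omega>. F (X \<omega>) * indicator V (X \<omega> p) \<partial>P)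
    = (\<integral>\<^sup>+x. ennreal (\<rho> p x) * (indicator V x * (\<integral>\<^sup>+f. F f \<partial>\<mu> p x)) \<partial>lborel)"
proof -
  have [measurable]: "(\<lambda>\<omega>. X \<omega> p) \<in> borel_measurable P" by (rule evaluation_measurable)
  have [measurable]: "X \<in> measurable P (C1_borel A)" by (rule X_measurable)
  have [measurable]: "V \<in> sets borel" by (rule V)
  have "(\<integral>\<^sup>+\<omega>. F (X \<omega>) * indicator V (X \<omega> p) \<partial>P)
      = (\<integral>\<^sup>+x. indicator V x * (\<integral>\<^sup>+f. F f \<partial>\<mu> p x) \<partial>distr P borel (\<lambda>\<omega>. X \<omega> p))"
    using assms(1)
  proof (induction rule: borel_measurable_induct)
    case (cong f g)
    have "(\<integral>\<^sup>+\<omega>. f (X \<omega>) * indicator V (X \<omega> p) \<partial>P) = (\<integral>\<^sup>+\<omega>. g (X \<omega>) * indicator V (X \<omega> p) \<partial>P)"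
      using cong(3) measurable_space[OF X_measurable] by (intro nn_integral_cong) auto
    moreover have "(\<integral>\<^sup>+h. f h \<partial>\<mu> p x) = (\<integral>\<^sup>+h. g h \<partial>\<mu> p x)" for x
      using cong(3) kernel(2) space_C1_borel[OF atlas] by (intro nn_integral_cong) auto
    ultimately show ?case using cong(4) by simp
  next
    case (set B)
    have "(\<integral>\<^sup>+\<omega>. indicator B (X \<omega>) * indicator V (X \<omega> p) \<partial>P)
        = (\<integral>\<^sup>+\<omega>. indicator {\<omega>\<in>space P. X \<omega> \<in> B \<and> X \<omega> p \<in> V} \<omega> \<partial>P)"
      by (intro nn_integral_cong) (auto simp: indicator_def)
    also have "\<dots> = emeasure P {\<omega>\<in>space P. X \<omega> \<in> B \<and> X \<omega> p \<in> V}"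
    proof (rule nn_integral_indicator)
      have "{\<omega>\<in>space P. X \<omega> \<in> B \<and> X \<omega> p \<in> V} = (X -` B \<inter> space P) \<inter> ((\<lambda>\<omega>. X \<omega> p) -` V \<inter> space P)" by auto
      also have "\<dots> \<in> sets P"
        using measurable_sets[OF X_measurable set] measurable_sets[OF evaluation_measurable V] by (rule sets.Int)
      finally show "{\<omega>\<in>space P. X \<omega> \<in> B \<and> X \<omega> p \<in> V} \<in> sets P" .
    qed
    also have "\<dots> = (\<integral>\<^sup>+x\<in>V. emeasure (\<mu> p x) B \<partial>distr P borel (\<lambda>\<omega>. X \<omega> p))"
      using cond_prob[of p] set V unfolding regular_conditional_prob_def by blast
    finally show ?case using set by (simp add: kernel mult.commute)
  next
    case (mult u c)
    have [measurable]: "u \<in> borel_measurable (C1_borel A)" "(\<lambda>x. \<integral>\<^sup>+f. u f \<partial>\<mu> p x) \<in> borel_measurable borel"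
      using mult(2) conditional_nn_integral_measurable by auto
    have "(\<integral>\<^sup>+\<omega>. c * u (X \<omega>) * indicator V (X \<omega> p) \<partial>P) = c * (\<integral>\<^sup>+\<omega>. u (X \<omega>) * indicator V (X \<omega> p) \<partial>P)"
      by (simp add: mult.assoc nn_integral_cmult)
    also have "\<dots> = (\<integral>\<^sup>+x. c * (indicator V x * (\<integral>\<^sup>+f. u f \<partial>\<mu> p x)) \<partial>distr P borel (\<lambda>\<omega>. X \<omega> p))"
      unfolding mult(4) by (subst nn_integral_cmult) simp_all
    also have "\<dots> = (\<integral>\<^sup>+x. indicator V x * (\<integral>\<^sup>+f. c * u f \<partial>\<mu> p x) \<partial>distr P borel (\<lambda>\<omega>. X \<omega> p))"
      using mult(2) by (simp add: nn_integral_cmult borel_measurable_kernel mult.left_commute)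
    finally show ?case .
  next
    case (add u v)
    have [measurable]: "u \<in> borel_measurable (C1_borel A)" "(\<lambda>x. \<integral>\<^sup>+f. u f \<partial>\<mu> p x) \<in> borel_measurable borel"
      "v \<in> borel_measurable (C1_borel A)" "(\<lambda>x. \<integral>\<^sup>+f. v f \<partial>\<mu> p x) \<in> borel_measurable borel"
      using add(1,3) conditional_nn_integral_measurable by auto
    have "(\<integral>\<^sup>+\<omega>. (v (X \<omega>) + u (X \<omega>)) * indicator V (X \<omega> p) \<partial>P)
        = (\<integral>\<^sup>+\<omega>. v (X \<omega>) * indicator V (X \<omega> p) \<partial>P) + (\<integral>\<^sup>+\<omega>. u (X \<omega>) * indicator V (X \<omega> p) \<partial>P)"
      by (subst nn_integral_add[symmetric]) (simp_all add: distrib_right)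
    also have "\<dots> = (\<integral>\<^sup>+x. indicator V x * (\<integral>\<^sup>+f. v f \<partial>\<mu> p x) + indicator V x * (\<integral>\<^sup>+f. u f \<partial>\<mu> p x)
        \<partial>distr P borel (\<lambda>\<omega>. X \<omega> p))"
      using add.IH by (subst nn_integral_add) simp_all
    also have "\<dots> = (\<integral>\<^sup>+x. indicator V x * (\<integral>\<^sup>+f. v f + u f \<partial>\<mu> p x) \<partial>distr P borel (\<lambda>\<omega>. X \<omega> p))"
      using add(1,3) by (simp add: nn_integral_add borel_measurable_kernel distrib_left)
    finally show ?case .
  next
    case (seq U)
    have U [measurable]: "U i \<in> borel_measurable (C1_borel A)" "(\<lambda>x. \<integral>\<^sup>+f. U i f \<partial>\<mu> p x) \<in> borel_measurable borel" for i
      using seq(1) conditional_nn_integral_measurable by auto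
    have mono: "incseq (\<lambda>i x. \<integral>\<^sup>+f. U i f \<partial>\<mu> p x)"
      using seq(3) by (auto simp: incseq_def le_fun_def intro!: nn_integral_mono)
    have "(\<integral>\<^sup>+\<omega>. (SUP i. U i) (X \<omega>) * indicator V (X \<omega> p) \<partial>P)
        = (\<integral>\<^sup>+\<omega>. (SUP i. U i (X \<omega>) * indicator V (X \<omega> p)) \<partial>P)"
      by (simp add: SUP_apply image_comp SUP_mult_right_ennreal)
    also have "\<dots> = (SUP i. \<integral>\<^sup>+\<omega>. U i (X \<omega>) * indicator V (X \<omega> p) \<partial>P)"
      using seq(3) by (intro nn_integral_monotone_convergence_SUP)
        (auto simp: incseq_def le_fun_def intro!: mult_right_mono)
    also have "\<dots> = (SUP i. \<integral>\<^sup>+x. indicator V x * (\<integral>\<^sup>+f. U i f \<partial>\<mu> p x) \<partial>distr P borel (\<lambda>\<omega>. X \<omega> p))"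
      by (simp add: seq.IH)
    also have "\<dots> = (\<integral>\<^sup>+x. (SUP i. indicator V x * (\<integral>\<^sup>+f. U i f \<partial>\<mu> p x)) \<partial>distr P borel (\<lambda>\<omega>. X \<omega> p))"
      using mono by (intro nn_integral_monotone_convergence_SUP[symmetric])
        (auto simp: incseq_def le_fun_def intro!: mult_left_mono)
    also have "\<dots> = (\<integral>\<^sup>+x. indicator V x * (\<integral>\<^sup>+f. (SUP i. U i) f \<partial>\<mu> p x) \<partial>distr P borel (\<lambda>\<omega>. X \<omega> p))"
    proof (rule nn_integral_cong)
      fix x
      have "(\<integral>\<^sup>+f. (SUP i. U i) f \<partial>\<mu> p x) = (SUP i. \<integral>\<^sup>+f. U i f \<partial>\<mu> p x)"
        using nn_integral_monotone_convergence_SUP[OF seq(3), of "\<mu> p x"] seq(1)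
        by (simp add: borel_measurable_kernel SUP_apply image_comp)
      then show "(SUP i. indicator V x * (\<integral>\<^sup>+f. U i f \<partial>\<mu> p x)) = indicator V x * (\<integral>\<^sup>+f. (SUP i. U i) f \<partial>\<mu> p x)"
        by (simp add: SUP_mult_left_ennreal)
    qed
    finally show ?case .
  qed
  also have "\<dots> = (\<integral>\<^sup>+\<omega>. indicator V (X \<omega> p) * (\<integral>\<^sup>+f. F f \<partial>\<mu> p (X \<omega> p)) \<partial>P)"
    using conditional_nn_integral_measurable[OF assms(1)] V
    by (subst nn_integral_distr) simp_all
  also have "\<dots> = (\<integral>\<^sup>+x. ennreal (\<rho> p x) * (indicator V x * (\<integral>\<^sup>+f. F f \<partial>\<mu> p x)) \<partial>lborel)"
    using conditional_nn_integral_measurable[OF assms(1), of p] V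
    by (intro distributed_nn_integral[OF X_distributed, symmetric]) simp
  finally show ?thesis .
qed

end

context zkrok_on_curve
begin

section \<open>The truncated speed and its conditional mean\<close>

definition speed :: "nat \<Rightarrow> real \<Rightarrow> ('m \<Rightarrow> real) \<Rightarrow> real" where
  "speed n t f = \<bar>deriv_along f t\<bar> * cutoff n (deriv_along f) t"

lemma speed_nonneg: "0 \<le> speed n t f"
  by (simp add: speed_def cutoff_bounds)

lemma speed_tendsto:
  assumes "t \<in> {0..1}" "f \<in> topspace (C1_topology A)"
  shows "((\<lambda>z. speed n (fst z) (snd z)) \<longlongrightarrow> speed n t f) (nearby t f)"
  unfolding speed_def using assms
  by (intro tendsto_intros deriv_along_tendsto cutoff_tendsto) (auto simp: topspace_C1)

lemma speed_measurable: "t \<in> {0..1} \<Longrightarrow> speed n t \<in> borel_measurable (C1_borel A)"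
  by (rule measurable_C1_borel[OF atlas continuous_map_joint]) (rule speed_tendsto)

lemma continuous_on_speed: "f \<in> C1_functions A \<Longrightarrow> continuous_on {0..1} (\<lambda>t. speed n t f)"
  by (rule continuous_on_joint[where X = "C1_topology A"])
    (simp_all add: speed_tendsto topspace_C1)

lemma continuous_on_cutoff: "f \<in> C1_functions A \<Longrightarrow> continuous_on {0..1} (cutoff n (deriv_along f))"
  by (rule continuous_on_joint[where X = "C1_topology A" and \<Phi> = "\<lambda>t f. cutoff n (deriv_along f) t"])
    (simp_all add: cutoff_tendsto topspace_C1)

lemma deriv_along_measurable: "t \<in> {0..1} \<Longrightarrow> (\<lambda>f. deriv_along f t) \<in> borel_measurable (C1_borel A)"
  by (rule measurable_C1_borel[OF atlas continuous_map_joint[where \<Phi> = "\<lambda>t f. deriv_along f t" and S = "{0..1}"]])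
    (simp_all add: deriv_along_tendsto topspace_C1)

lemma jacobian_measurable: "Defs.jacobian A g p \<in> borel_measurable (C1_borel A)"
proof (rule measurable_C1_borel[OF atlas continuous_map_joint[where S = UNIV]])
  fix f assume "f \<in> topspace (C1_topology A)"
  then show "((\<lambda>z. Defs.jacobian A g (fst z) (snd z)) \<longlongrightarrow> Defs.jacobian A g p f)
      (inf (nhds p) (principal UNIV) \<times>\<^sub>F nhdsin (C1_topology A) f)"
    using jacobian_tendsto[OF atlas metric] by (simp add: topspace_C1)
qed simp

lemma J_measure_measurable:
  "borel_measurable (J_measure A g p (\<mu> p x)) = borel_measurable (C1_borel A)"
  by (rule measurable_cong_sets) (simp_all add: J_measure_def kernel)

lemma space_J_measure: "space (J_measure A g p (\<mu> p x)) = topspace (C1_topology A)"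
  by (simp add: J_measure_def kernel topspace_C1)

lemma curve_pair_tendsto:
  assumes "t0 \<in> {0..1}"
  shows "filterlim (\<lambda>z. (\<gamma> (fst z), snd z)) (nhds (\<gamma> t0, x0)) (inf (nhds t0) (principal {0..1}) \<times>\<^sub>F nhds x0)"
  unfolding nhds_prod
  by (intro filterlim_Pair filterlim_snd filterlim_compose[OF curve_tendsto[OF assms] filterlim_fst])

definition cond_speed :: "nat \<Rightarrow> real \<Rightarrow> real \<Rightarrow> real" where
  "cond_speed n t x = (\<integral>f. speed n t f \<partial>\<mu> (\<gamma> t) x)"

context
  fixes L :: real
  assumes L: "L > 0" "\<And>f t. f \<in> C1_functions A \<Longrightarrow> t \<in> {0..1} \<Longrightarrow> \<bar>deriv_along f t\<bar> \<le> L * jac_along f t"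
begin

lemma normalized_speed_measurable:
  assumes "t \<in> {0..1}" shows "normalized_speed n L t \<in> borel_measurable (C1_borel A)"
  by (rule measurable_C1_borel[OF atlas continuous_map_joint[OF _ assms]])
    (simp add: normalized_speed_tendsto L(1) topspace_C1)

lemma normalized_speed_integrable:
  assumes "t \<in> {0..1}"
  shows "integrable (J_measure A g (\<gamma> t) (\<mu> (\<gamma> t) x)) (normalized_speed n L t)"
proof (rule finite_measure.integrable_const_bound[OF finite_J_measure])
  show "AE f in J_measure A g (\<gamma> t) (\<mu> (\<gamma> t) x). norm (normalized_speed n L t f) \<le> L"
    using assms L
    by (intro AE_I2) (auto simp: space_J_measure topspace_C1 intro!: normalized_speed_bound)
qed (simp add: J_measure_measurable normalized_speed_measurable[OF assms])

text \<open>The truncated speed is J times a bounded continuous function, so its mean under \<mu> is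
  the mean of that function under J \<cdot> \<mu>. In this form the weak continuity hypothesis can
  act on it.\<close>

lemma speed_J_density:
  assumes "t \<in> {0..1}"
  shows "integrable (\<mu> (\<gamma> t) x) (speed n t)"
    and "cond_speed n t x = (\<integral>f. normalized_speed n L t f \<partial>J_measure A g (\<gamma> t) (\<mu> (\<gamma> t) x))"
proof -
  let ?M = "\<mu> (\<gamma> t) x"
  have meas: "normalized_speed n L t \<in> borel_measurable ?M" "Defs.jacobian A g (\<gamma> t) \<in> borel_measurable ?M"
    by (simp_all add: borel_measurable_kernel normalized_speed_measurable[OF assms] jacobian_measurable)
  have nonneg: "AE f in ?M. 0 \<le> Defs.jacobian A g (\<gamma> t) f"
    using jac_along_nonneg by (intro AE_I2) (auto simp: kernel jac_along_def)
  have eq: "Defs.jacobian A g (\<gamma> t) f *\<^sub>R normalized_speed n L t f = speed n t f" if "f \<in> space ?M" for f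
    using normalized_speed_times_jac[OF _ assms L(1) L(2)[OF _ assms]] that
    by (simp add: kernel speed_def jac_along_def)
  have "integrable ?M (\<lambda>f. Defs.jacobian A g (\<gamma> t) f *\<^sub>R normalized_speed n L t f)"
    using normalized_speed_integrable[OF assms, of x n]
    unfolding J_measure_def integrable_density[OF meas nonneg] .
  also have "?this \<longleftrightarrow> integrable ?M (speed n t)" by (intro Bochner_Integration.integrable_cong refl eq)
  finally show "integrable ?M (speed n t)" .
  have "(\<integral>f. normalized_speed n L t f \<partial>J_measure A g (\<gamma> t) ?M)
      = (\<integral>f. Defs.jacobian A g (\<gamma> t) f *\<^sub>R normalized_speed n L t f \<partial>?M)"
    unfolding J_measure_def by (rule integral_density[OF meas nonneg])
  also have "\<dots> = cond_speed n t x"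
    unfolding cond_speed_def by (intro Bochner_Integration.integral_cong refl eq)
  finally show "cond_speed n t x = (\<integral>f. normalized_speed n L t f \<partial>J_measure A g (\<gamma> t) ?M)" ..
qed

text \<open>As (t,x) tends to (t0,0), the measures J \<cdot> \<mu> at \<gamma>(t) converge weakly,
  but the normalised speed changes with t as well; this is the situation of
  \<open>weak_limit_moving_integrand\<close>, with the pair (t,x) as index. The limit is available
  at x = 0 only, as is the hypothesis.\<close>

lemma cond_speed_tendsto:
  assumes t0: "t0 \<in> {0..1}"
  shows "((\<lambda>z. cond_speed n (fst z) (snd z)) \<longlongrightarrow> cond_speed n t0 0)
    (inf (nhds t0) (principal {0..1}) \<times>\<^sub>F nhds 0)"
proof -
  let ?G = "inf (nhds t0) (principal {0..1}) \<times>\<^sub>F nhds (0::real)"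
  let ?\<nu> = "\<lambda>z. J_measure A g (\<gamma> (fst z)) (\<mu> (\<gamma> (fst z)) (snd z))"
  have "((\<lambda>z. \<integral>f. normalized_speed n L (fst z) f \<partial>?\<nu> z) \<longlongrightarrow>
      (\<integral>f. normalized_speed n L t0 f \<partial>?\<nu> (t0, 0))) ?G"
  proof (rule weak_limit_moving_integrand[OF compact_Icc t0 filterlim_fst, where X = "C1_topology A"])
    show "F \<in> borel_measurable (?\<nu> z)" if "continuous_map (C1_topology A) euclideanreal F" for F z
      unfolding J_measure_measurable by (rule measurable_C1_borel[OF atlas that])
    then show "F \<in> borel_measurable (?\<nu> (t0, 0))" if "continuous_map (C1_topology A) euclideanreal F" for F
      using that .
    show "((\<lambda>z. \<integral>f. F f \<partial>?\<nu> z) \<longlongrightarrow> (\<integral>f. F f \<partial>?\<nu> (t0, 0))) ?G"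
      if F: "continuous_map (C1_topology A) euclideanreal F" "bounded (F ` topspace (C1_topology A))" for F
    proof -
      have "isCont (\<lambda>(q, x). \<integral>f. F f \<partial>J_measure A g q (\<mu> q x)) (\<gamma> t0, 0)"
        using F by (intro J_measure_isCont) (simp_all add: topspace_C1)
      then have "((\<lambda>(q, x). \<integral>f. F f \<partial>J_measure A g q (\<mu> q x)) \<longlongrightarrow>
          (\<integral>f. F f \<partial>J_measure A g (\<gamma> t0) (\<mu> (\<gamma> t0) 0))) (nhds (\<gamma> t0, 0))"
        by (simp add: isCont_def tendsto_nhds_iff)
      from filterlim_compose[OF this curve_pair_tendsto[OF t0]] show ?thesis by simp
    qed
    show "((\<lambda>z. normalized_speed n L (fst z) (snd z)) \<longlongrightarrow> normalized_speed n L t f) (nearby t f)"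
      if "t \<in> {0..1}" "f \<in> topspace (C1_topology A)" for t f
      using that L(1) by (intro normalized_speed_tendsto) (simp_all add: topspace_C1)
    show "\<bar>normalized_speed n L t f\<bar> \<le> L" if "t \<in> {0..1}" "f \<in> topspace (C1_topology A)" for t f
      using that L by (intro normalized_speed_bound) (auto simp: topspace_C1)
  qed (simp_all add: finite_J_measure space_J_measure)
  moreover have "eventually (\<lambda>t. t \<in> {0..1}) (inf (nhds t0) (principal {0..1::real}))"
    by (simp add: eventually_inf_principal)
  then have "eventually (\<lambda>z. fst z \<in> {0..1}) ?G" by (rule eventually_compose_filterlim[OF _ filterlim_fst])
  then have "eventually (\<lambda>z. (\<integral>f. normalized_speed n L (fst z) f \<partial>?\<nu> z) = cond_speed n (fst z) (snd z)) ?G"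
    by eventually_elim (rule speed_J_density(2)[symmetric])
  ultimately show ?thesis
    unfolding speed_J_density(2)[OF t0, of n 0] fst_conv snd_conv by (rule Lim_transform_eventually)
qed

text \<open>A bound without cutoff, by L times the mass of J \<cdot> \<mu>. It ensures that the
  conditional expectation in the Finsler structure is finite along the curve and, later, that the
  length integrand is bounded.\<close>

lemma nn_integral_deriv_along_le:
  assumes "t \<in> {0..1}"
  shows "(\<integral>\<^sup>+f. ennreal \<bar>deriv_along f t\<bar> \<partial>\<mu> (\<gamma> t) x) \<le> ennreal (L * (\<integral>f. 1 \<partial>J_measure A g (\<gamma> t) (\<mu> (\<gamma> t) x)))"
proof -
  let ?M = "\<mu> (\<gamma> t) x" and ?J = "Defs.jacobian A g (\<gamma> t)"
  have J: "?J \<in> borel_measurable ?M" by (simp add: borel_measurable_kernel jacobian_measurable)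
  have "(\<integral>\<^sup>+f. ennreal \<bar>deriv_along f t\<bar> \<partial>?M) \<le> (\<integral>\<^sup>+f. ennreal L * ennreal (?J f) \<partial>?M)"
    using L(2)[OF _ assms] L(1)
    by (intro nn_integral_mono) (auto simp: kernel jac_along_def ennreal_mult'[symmetric] intro!: ennreal_leI)
  also have "\<dots> = ennreal L * (\<integral>\<^sup>+f. ennreal (?J f) * 1 \<partial>?M)"
    using J by (simp add: nn_integral_cmult)
  also have "(\<integral>\<^sup>+f. ennreal (?J f) * 1 \<partial>?M) = (\<integral>\<^sup>+f. 1 \<partial>J_measure A g (\<gamma> t) ?M)"
    unfolding J_measure_def using J by (subst nn_integral_density) simp_all
  also have "\<dots> = ennreal (\<integral>f. 1 \<partial>J_measure A g (\<gamma> t) ?M)"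
    by (simp add: finite_measure.emeasure_eq_measure[OF finite_J_measure])
  finally show ?thesis using L(1) by (simp add: ennreal_mult)
qed

end

section \<open>The truncated Kac-Rice density\<close>

text \<open>The Kac-Rice density of crossings of level x at time t, with the cutoff as
  weight.\<close>

definition level_density :: "nat \<Rightarrow> real \<Rightarrow> real \<Rightarrow> real" where
  "level_density n t x = \<rho> (\<gamma> t) x * cond_speed n t x"

lemma cond_speed_nonneg: "0 \<le> cond_speed n t x"
  unfolding cond_speed_def by (intro integral_nonneg_AE AE_I2 speed_nonneg)

lemma level_density_nonneg: "0 \<le> level_density n t x"
  unfolding level_density_def by (intro mult_nonneg_nonneg density_nonneg cond_speed_nonneg)

lemma density_along_tendsto:
  assumes "t0 \<in> {0..1}"
  shows "((\<lambda>z. \<rho> (\<gamma> (fst z)) (snd z)) \<longlongrightarrow> \<rho> (\<gamma> t0) 0) (inf (nhds t0) (principal {0..1}) \<times>\<^sub>F nhds 0)"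
proof -
  have "((\<lambda>(q, x). \<rho> q x) \<longlongrightarrow> \<rho> (\<gamma> t0) 0) (nhds (\<gamma> t0, 0))"
    using density_isCont[of "\<gamma> t0"] by (simp add: isCont_def tendsto_nhds_iff)
  from filterlim_compose[OF this curve_pair_tendsto[OF assms]] show ?thesis by simp
qed

lemma level_density_tendsto:
  assumes "t0 \<in> {0..1}"
  shows "((\<lambda>z. level_density n (fst z) (snd z)) \<longlongrightarrow> level_density n t0 0)
    (inf (nhds t0) (principal {0..1}) \<times>\<^sub>F nhds 0)"
proof -
  obtain L where "L > 0" "\<And>f t. f \<in> C1_functions A \<Longrightarrow> t \<in> {0..1} \<Longrightarrow> \<bar>deriv_along f t\<bar> \<le> L * jac_along f t"
    using deriv_along_le_jac by blast
  from cond_speed_tendsto[OF this assms] show ?thesis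
    unfolding level_density_def by (intro tendsto_mult density_along_tendsto[OF assms])
qed

lemma nn_integral_speed:
  assumes "t \<in> {0..1}"
  shows "(\<integral>\<^sup>+f. ennreal (speed n t f) \<partial>\<mu> (\<gamma> t) x) = ennreal (cond_speed n t x)"
proof -
  obtain L where "L > 0" "\<And>f t. f \<in> C1_functions A \<Longrightarrow> t \<in> {0..1} \<Longrightarrow> \<bar>deriv_along f t\<bar> \<le> L * jac_along f t"
    using deriv_along_le_jac by blast
  from speed_J_density(1)[OF this assms] show ?thesis
    unfolding cond_speed_def by (intro nn_integral_eq_integral AE_I2 speed_nonneg)
qed

lemma tendsto_at_zero_level:
  assumes "((\<lambda>z. F (fst z) (snd z)) \<longlongrightarrow> F t0 0) (inf (nhds t0) (principal S) \<times>\<^sub>F nhds (0::real))"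
  shows "((\<lambda>t. F t 0) \<longlongrightarrow> F t0 0) (at t0 within S)"
proof -
  have "filterlim (\<lambda>t. 0::real) (nhds 0) (inf (nhds t0) (principal S))" by (rule tendsto_const)
  then have "filterlim (\<lambda>t. (t, 0::real)) (inf (nhds t0) (principal S) \<times>\<^sub>F nhds 0) (inf (nhds t0) (principal S))"
    by (intro filterlim_Pair filterlim_ident)
  from filterlim_compose[OF assms this] have "((\<lambda>t. F t 0) \<longlongrightarrow> F t0 0) (inf (nhds t0) (principal S))" by simp
  moreover have "at t0 within S \<le> inf (nhds t0) (principal S)"
    unfolding at_within_def by (intro inf_mono) auto
  ultimately show ?thesis by (rule tendsto_mono[rotated])
qed

lemma continuous_on_level_density: "continuous_on {0..1} (\<lambda>t. level_density n t 0)"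
  unfolding continuous_on_def by (intro ballI tendsto_at_zero_level level_density_tendsto)

text \<open>Joint continuity at every (t,0) and compactness of [0,1]. This is what replaces the
  average over a thin band of levels by the value at level 0, simultaneously for all t.\<close>

lemma level_density_uniform:
  assumes "\<epsilon> > 0"
  shows "eventually (\<lambda>k. \<forall>t\<in>{0..1}. \<forall>x\<in>{-1/Suc k<..<1/Suc k}.
    \<bar>level_density n t x - level_density n t 0\<bar> < \<epsilon>) sequentially"
proof -
  have "eventually (\<lambda>x. \<forall>t\<in>{0..1}. \<bar>level_density n t x - level_density n t 0\<bar> < \<epsilon>) (nhds 0)"
    using level_density_tendsto
    by (intro eventually_uniform_compact continuous_on_level_density compact_Icc assms) (simp add: case_prod_unfold)
  then obtain d where d: "d > 0" "\<And>x t. \<bar>x\<bar> < d \<Longrightarrow> t \<in> {0..1} \<Longrightarrow> \<bar>level_density n t x - level_density n t 0\<bar> < \<epsilon>"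
    unfolding eventually_nhds_metric by (auto simp: dist_real_def)
  have "eventually (\<lambda>k. 1 / real (Suc k) < d) sequentially"
    by (rule eventually_inverse_Suc_less[OF d(1)])
  then show ?thesis
  proof eventually_elim
    case (elim k)
    show ?case
    proof (intro ballI d(2))
      fix x assume "x \<in> {-1/real (Suc k)<..<1/Suc k}"
      then have "\<bar>x\<bar> < 1 / Suc k" by (simp add: abs_less_iff)
      then show "\<bar>x\<bar> < d" using elim by linarith
    qed
  qed
qed

section \<open>Expectation of the band averages\<close>

definition band :: "nat \<Rightarrow> nat \<Rightarrow> 'w \<Rightarrow> ennreal" where
  "band n k \<omega> = band_average (\<lambda>t. X \<omega> (\<gamma> t)) (deriv_along (X \<omega>)) (cutoff n (deriv_along (X \<omega>))) k"

definition band_integrand :: "nat \<Rightarrow> nat \<Rightarrow> 'w \<Rightarrow> real \<Rightarrow> ennreal" where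
  "band_integrand n k \<omega> t = ennreal (Suc k / 2) *
     (ennreal (speed n t (X \<omega>)) * indicator {-1/Suc k<..<1/Suc k} (X \<omega> (\<gamma> t)) * indicator {0..1} t)"

text \<open>The field and the truncated speed are continuous in t only on [0,1], so t is clamped;
  the indicator of [0,1] makes the clamping invisible.\<close>

lemma band_integrand_measurable: "(\<lambda>(\<omega>, t). band_integrand n k \<omega> t) \<in> borel_measurable (P \<Otimes>\<^sub>M lborel)"
proof -
  have 1 [measurable]: "(\<lambda>z. speed n (max 0 (min 1 (snd z))) (X (fst z))) \<in> borel_measurable (P \<Otimes>\<^sub>M lborel)"
    using measurable_compose[OF X_measurable speed_measurable] continuous_on_speed[OF X_in_C1]
    by (intro caratheodory_measurable)
  have 2 [measurable]: "(\<lambda>z. X (fst z) (\<gamma> (max 0 (min 1 (snd z))))) \<in> borel_measurable (P \<Otimes>\<^sub>M lborel)"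
    using evaluation_measurable DERIV_continuous_on[OF has_deriv_along[OF X_in_C1]]
    by (intro caratheodory_measurable[where F = "\<lambda>\<omega> t. X \<omega> (\<gamma> t)"]) auto
  have "(\<lambda>z. ennreal (Suc k / 2) * (ennreal (speed n (max 0 (min 1 (snd z))) (X (fst z))) *
      indicator {-1/Suc k<..<1/Suc k} (X (fst z) (\<gamma> (max 0 (min 1 (snd z))))) * indicator {0..1} (snd z)))
    \<in> borel_measurable (P \<Otimes>\<^sub>M lborel)"
    by measurable
  also have "?this \<longleftrightarrow> ?thesis"
    by (intro measurable_cong) (auto simp: band_integrand_def indicator_def)
  finally show ?thesis .
qed

lemma band_eq: "\<omega> \<in> space P \<Longrightarrow> band n k \<omega> = (\<integral>\<^sup>+t. band_integrand n k \<omega> t \<partial>lborel)"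
proof -
  assume "\<omega> \<in> space P"
  then have C1: "X \<omega> \<in> C1_functions A" by (rule X_in_C1)
  have "(\<lambda>t. ennreal (speed n t (X \<omega>)) * indicator {-1/Suc k<..<1/Suc k} (X \<omega> (\<gamma> t)) * indicator {0..1} t)
      \<in> borel_measurable lborel"
    using DERIV_continuous_on[OF has_deriv_along[OF C1]]
    by (intro continuous_band_measurable continuous_on_speed C1) auto
  then show ?thesis
    unfolding band_def band_average_def band_integrand_def
    by (subst nn_integral_cmult) (simp_all add: speed_def)
qed

lemma band_measurable: "band n k \<in> borel_measurable P"
proof -
  have "(\<lambda>\<omega>. \<integral>\<^sup>+t. band_integrand n k \<omega> t \<partial>lborel) \<in> borel_measurable P"
    by (rule lborel.borel_measurable_nn_integral[OF band_integrand_measurable])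
  also have "?this \<longleftrightarrow> ?thesis" by (intro measurable_cong) (simp add: band_eq)
  finally show ?thesis .
qed

lemma expected_band_integrand:
  assumes t: "t \<in> {0..1}"
  shows "(\<integral>\<^sup>+\<omega>. band_integrand n k \<omega> t \<partial>P)
    = ennreal (Suc k / 2) * (\<integral>\<^sup>+x. ennreal (level_density n t x) * indicator {-1/Suc k<..<1/Suc k} x \<partial>lborel)"
proof -
  have F: "(\<lambda>f. ennreal (speed n t f)) \<in> borel_measurable (C1_borel A)"
    using speed_measurable[OF t] by simp
  have FX [measurable]: "(\<lambda>\<omega>. ennreal (speed n t (X \<omega>))) \<in> borel_measurable P"
    using measurable_compose[OF X_measurable F] by simp
  have [measurable]: "(\<lambda>\<omega>. X \<omega> (\<gamma> t)) \<in> borel_measurable P" by (rule evaluation_measurable)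
  have "(\<integral>\<^sup>+\<omega>. band_integrand n k \<omega> t \<partial>P) = ennreal (Suc k / 2) *
      (\<integral>\<^sup>+\<omega>. ennreal (speed n t (X \<omega>)) * indicator {-1/Suc k<..<1/Suc k} (X \<omega> (\<gamma> t)) \<partial>P)"
    unfolding band_integrand_def using t by (subst nn_integral_cmult) simp_all
  also have "(\<integral>\<^sup>+\<omega>. ennreal (speed n t (X \<omega>)) * indicator {-1/Suc k<..<1/Suc k} (X \<omega> (\<gamma> t)) \<partial>P)
      = (\<integral>\<^sup>+x. ennreal (\<rho> (\<gamma> t) x) * (indicator {-1/Suc k<..<1/Suc k} x * (\<integral>\<^sup>+f. ennreal (speed n t f) \<partial>\<mu> (\<gamma> t) x)) \<partial>lborel)"
    by (rule disintegration[OF F]) simp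
  also have "\<dots> = (\<integral>\<^sup>+x. ennreal (level_density n t x) * indicator {-1/Suc k<..<1/Suc k} x \<partial>lborel)"
    unfolding nn_integral_speed[OF t] level_density_def
    by (intro nn_integral_cong) (simp add: ennreal_mult density_nonneg cond_speed_nonneg mult_ac)
  finally show ?thesis .
qed

text \<open>For x away from 0 no continuity is known, so measurability in x is drawn from the kernel
  and from the density.\<close>

lemma level_density_measurable:
  assumes "t \<in> {0..1}"
  shows "(\<lambda>x. ennreal (level_density n t x)) \<in> borel_measurable borel"
proof -
  have [measurable]: "(\<lambda>x. ennreal (\<rho> (\<gamma> t) x)) \<in> borel_measurable borel"
    using X_distributed[of "\<gamma> t"] by (simp add: distributed_def)
  have [measurable]: "(\<lambda>x. \<integral>\<^sup>+f. ennreal (speed n t f) \<partial>\<mu> (\<gamma> t) x) \<in> borel_measurable borel"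
    using speed_measurable[OF assms] by (intro conditional_nn_integral_measurable) simp
  have "(\<lambda>x. ennreal (\<rho> (\<gamma> t) x) * (\<integral>\<^sup>+f. ennreal (speed n t f) \<partial>\<mu> (\<gamma> t) x)) \<in> borel_measurable borel"
    by measurable
  then show ?thesis
    unfolding nn_integral_speed[OF assms] level_density_def by (simp add: ennreal_mult density_nonneg cond_speed_nonneg)
qed

text \<open>Disintegration turns the expectation into a mean of \<open>level_density\<close> over
  the band of levels, so the hypothesis \<open>near\<close> transfers to it. The lower estimate
  carries \<epsilon> on the other side because subtraction in \<open>ennreal\<close> truncates at
  0.\<close>

lemma expected_band_integrand_near:
  assumes t: "t \<in> {0..1}" and \<epsilon>: "\<epsilon> > 0"
    and near: "\<And>x. x \<in> {-1/Suc k<..<1/Suc k} \<Longrightarrow> \<bar>level_density n t x - level_density n t 0\<bar> < \<epsilon>"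
  shows "(\<integral>\<^sup>+\<omega>. band_integrand n k \<omega> t \<partial>P) \<le> ennreal (level_density n t 0) + ennreal \<epsilon>"
    and "ennreal (level_density n t 0) \<le> (\<integral>\<^sup>+\<omega>. band_integrand n k \<omega> t \<partial>P) + ennreal \<epsilon>"
proof -
  let ?B = "{-1/Suc k<..<1/real (Suc k)}" and ?K = "ennreal (Suc k / 2)"
  have mean: "?K * (\<integral>\<^sup>+x. ennreal c * indicator ?B x \<partial>lborel) = ennreal c" if "c \<ge> 0" for c
  proof -
    have "emeasure lborel ?B = ennreal (2 / Suc k)" by (simp add: field_simps)
    then have "?K * (\<integral>\<^sup>+x. ennreal c * indicator ?B x \<partial>lborel) = ennreal (Suc k / 2 * (c * (2 / Suc k)))"
      using that by (simp add: nn_integral_cmult_indicator ennreal_mult[symmetric] del: of_nat_Suc)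
    also have "Suc k / 2 * (c * (2 / Suc k)) = c" by (simp add: field_simps)
    finally show ?thesis .
  qed
  have "(\<integral>\<^sup>+x. ennreal (level_density n t x) * indicator ?B x \<partial>lborel)
      \<le> (\<integral>\<^sup>+x. ennreal (level_density n t 0 + \<epsilon>) * indicator ?B x \<partial>lborel)"
    using near by (intro nn_integral_mono) (force simp: indicator_def abs_less_iff intro!: ennreal_leI)
  then have "?K * (\<integral>\<^sup>+x. ennreal (level_density n t x) * indicator ?B x \<partial>lborel)
      \<le> ?K * (\<integral>\<^sup>+x. ennreal (level_density n t 0 + \<epsilon>) * indicator ?B x \<partial>lborel)"
    by (rule mult_left_mono) simp
  also have "\<dots> = ennreal (level_density n t 0 + \<epsilon>)"
    using level_density_nonneg[of n t 0] \<epsilon> by (intro mean) simp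
  finally show "(\<integral>\<^sup>+\<omega>. band_integrand n k \<omega> t \<partial>P) \<le> ennreal (level_density n t 0) + ennreal \<epsilon>"
    unfolding expected_band_integrand[OF t] using level_density_nonneg \<epsilon> by (simp add: ennreal_plus)
  have "(\<integral>\<^sup>+x. ennreal (level_density n t 0) * indicator ?B x \<partial>lborel)
      \<le> (\<integral>\<^sup>+x. ennreal (level_density n t x) * indicator ?B x + ennreal \<epsilon> * indicator ?B x \<partial>lborel)"
  proof (rule nn_integral_mono)
    fix x
    show "ennreal (level_density n t 0) * indicator ?B x
        \<le> ennreal (level_density n t x) * indicator ?B x + ennreal \<epsilon> * indicator ?B x"
    proof (cases "x \<in> ?B")
      case True
      then have "level_density n t 0 \<le> level_density n t x + \<epsilon>" using near[of x] by linarith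
      then have "ennreal (level_density n t 0) \<le> ennreal (level_density n t x + \<epsilon>)" by (rule ennreal_leI)
      then show ?thesis using True level_density_nonneg \<epsilon> by (simp add: ennreal_plus)
    qed simp
  qed
  also have "\<dots> = (\<integral>\<^sup>+x. ennreal (level_density n t x) * indicator ?B x \<partial>lborel) + (\<integral>\<^sup>+x. ennreal \<epsilon> * indicator ?B x \<partial>lborel)"
    using level_density_measurable[OF t] by (intro nn_integral_add) simp_all
  finally have "?K * (\<integral>\<^sup>+x. ennreal (level_density n t 0) * indicator ?B x \<partial>lborel)
      \<le> ?K * ((\<integral>\<^sup>+x. ennreal (level_density n t x) * indicator ?B x \<partial>lborel) + (\<integral>\<^sup>+x. ennreal \<epsilon> * indicator ?B x \<partial>lborel))"
    by (rule mult_left_mono) simp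
  then show "ennreal (level_density n t 0) \<le> (\<integral>\<^sup>+\<omega>. band_integrand n k \<omega> t \<partial>P) + ennreal \<epsilon>"
    unfolding expected_band_integrand[OF t] distrib_left
    using mean[OF level_density_nonneg] mean[of \<epsilon>] \<epsilon> by simp
qed

definition crossing_rate :: "nat \<Rightarrow> ennreal" where
  "crossing_rate n = (\<integral>\<^sup>+t. ennreal (level_density n t 0) * indicator {0..1} t \<partial>lborel)"

lemma level_density_indicator_measurable:
  "(\<lambda>t. ennreal (level_density n t 0) * indicator {0..1} t) \<in> borel_measurable lborel"
  using continuous_band_measurable[OF continuous_on_level_density continuous_on_const, of "{0..1}" UNIV] by simp

lemma expected_band_integrand_measurable:
  "(\<lambda>t. \<integral>\<^sup>+\<omega>. band_integrand n k \<omega> t \<partial>P) \<in> borel_measurable lborel"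
proof (rule borel_measurable_nn_integral)
  show "(\<lambda>(t, \<omega>). band_integrand n k \<omega> t) \<in> borel_measurable (lborel \<Otimes>\<^sub>M P)"
    using measurable_pair_swap[OF band_integrand_measurable[of n k]] by simp
qed

text \<open>After Fubini the pointwise estimates are integrated over [0,1]; as this interval has
  length 1, the error stays \<epsilon>.\<close>

lemma expected_band_near:
  assumes "\<epsilon> > 0"
  shows "eventually (\<lambda>k. (\<integral>\<^sup>+\<omega>. band n k \<omega> \<partial>P) \<le> crossing_rate n + ennreal \<epsilon> \<and>
    crossing_rate n \<le> (\<integral>\<^sup>+\<omega>. band n k \<omega> \<partial>P) + ennreal \<epsilon>) sequentially"
  using level_density_uniform[OF assms, of n]
proof eventually_elim
  case (elim k)
  interpret pair_sigma_finite P lborel by standard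
  define \<psi> where "\<psi> t = (\<integral>\<^sup>+\<omega>. band_integrand n k \<omega> t \<partial>P)" for t
  have eq: "(\<integral>\<^sup>+\<omega>. band n k \<omega> \<partial>P) = (\<integral>\<^sup>+t. \<psi> t \<partial>lborel)"
    unfolding \<psi>_def Fubini'[OF band_integrand_measurable] by (intro nn_integral_cong band_eq)
  have \<psi>: "\<psi> \<in> borel_measurable lborel"
    unfolding \<psi>_def by (rule expected_band_integrand_measurable)
  have out: "\<psi> t = 0" if "t \<notin> {0..1}" for t using that by (simp add: \<psi>_def band_integrand_def)
  have eps: "(\<integral>\<^sup>+t. ennreal \<epsilon> * indicator {0..1::real} t \<partial>lborel) = ennreal \<epsilon>"
    by (simp add: nn_integral_cmult_indicator)
  have "(\<integral>\<^sup>+t. \<psi> t \<partial>lborel) \<le> (\<integral>\<^sup>+t. ennreal (level_density n t 0) * indicator {0..1} t + ennreal \<epsilon> * indicator {0..1} t \<partial>lborel)"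
  proof (rule nn_integral_mono)
    fix t
    show "\<psi> t \<le> ennreal (level_density n t 0) * indicator {0..1} t + ennreal \<epsilon> * indicator {0..1} t"
      using expected_band_integrand_near(1)[OF _ assms, of t k n] elim out[of t] unfolding \<psi>_def
      by (cases "t \<in> {0..1}") auto
  qed
  also have "\<dots> = crossing_rate n + ennreal \<epsilon>"
    using nn_integral_add[OF level_density_indicator_measurable, of "\<lambda>t. ennreal \<epsilon> * indicator {0..1} t" n]
    by (simp add: crossing_rate_def eps)
  finally have 1: "(\<integral>\<^sup>+t. \<psi> t \<partial>lborel) \<le> crossing_rate n + ennreal \<epsilon>" .
  have "crossing_rate n \<le> (\<integral>\<^sup>+t. \<psi> t + ennreal \<epsilon> * indicator {0..1} t \<partial>lborel)"
    unfolding crossing_rate_def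
  proof (rule nn_integral_mono)
    fix t
    show "ennreal (level_density n t 0) * indicator {0..1} t \<le> \<psi> t + ennreal \<epsilon> * indicator {0..1} t"
      using expected_band_integrand_near(2)[OF _ assms, of t k n] elim unfolding \<psi>_def
      by (cases "t \<in> {0..1}") auto
  qed
  also have "\<dots> = (\<integral>\<^sup>+t. \<psi> t \<partial>lborel) + ennreal \<epsilon>"
    using \<psi> by (subst nn_integral_add) (simp_all add: eps)
  finally show ?case using 1 unfolding eq by simp
qed

section \<open>Passage from band averages to the number of zeros\<close>

text \<open>A lower limit, so that it is defined and measurable on all of the probability space; the
  weighted count that it equals almost surely is not visibly measurable.\<close>

definition limit_band :: "nat \<Rightarrow> 'w \<Rightarrow> ennreal" where
  "limit_band n \<omega> = liminf (\<lambda>k. band n k \<omega>)"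

lemma limit_band_measurable: "limit_band n \<in> borel_measurable P"
  unfolding limit_band_def using band_measurable by measurable

lemma band_le: "\<omega> \<in> space P \<Longrightarrow> band n k \<omega> \<le> ennreal (Suc n)"
  unfolding band_def
  using has_deriv_along continuous_on_deriv_along X_in_C1 by (intro band_average_cutoff_le) auto

lemma limit_band_mono: "limit_band n \<omega> \<le> limit_band (Suc n) \<omega>"
  unfolding limit_band_def
proof (intro Liminf_mono always_eventually allI)
  fix k
  show "band n k \<omega> \<le> band (Suc n) k \<omega>"
    unfolding band_def band_average_def
    by (intro mult_left_mono nn_integral_mono mult_right_mono ennreal_leI cutoff_mono) auto
qed

text \<open>A law with a density does not charge the point 0. Applied at \<gamma>(0) and
  \<gamma>(1), this rules out zeros at the endpoints.\<close>

lemma almost_surely_nonzero: "AE \<omega> in P. X \<omega> p \<noteq> 0"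
proof -
  have "(\<integral>\<^sup>+\<omega>. indicator {0} (X \<omega> p) \<partial>P) = (\<integral>\<^sup>+x. ennreal (\<rho> p x) * indicator {0} x \<partial>lborel)"
    by (rule distributed_nn_integral[OF X_distributed, symmetric]) simp
  also have "\<dots> = (\<integral>\<^sup>+x. 0 \<partial>(lborel :: real measure))"
    using AE_lborel_singleton[of "0::real"] by (intro nn_integral_cong_AE) (auto elim: eventually_mono)
  finally have "(\<integral>\<^sup>+\<omega>. indicator {0} (X \<omega> p) \<partial>P) = 0" by simp
  moreover have "(\<lambda>\<omega>. indicator {0} (X \<omega> p) :: ennreal) \<in> borel_measurable P"
    using evaluation_measurable[of p] by measurable
  ultimately have "AE \<omega> in P. (indicator {0} (X \<omega> p) :: ennreal) = 0"
    by (simp add: nn_integral_0_iff_AE)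
  then show ?thesis by eventually_elim (auto simp: indicator_def split: if_splits)
qed

text \<open>A sum over an infinite zero set is 0 by convention; almost surely the set is finite and
  the sum is the intended one.\<close>

definition weighted_count :: "nat \<Rightarrow> 'w \<Rightarrow> ennreal" where
  "weighted_count n \<omega> = ennreal (\<Sum>t\<in>{t\<in>{0..1}. X \<omega> (\<gamma> t) = 0}. cutoff n (deriv_along (X \<omega>)) t)"

context
  assumes transverse: "AE \<omega> in P. curve_transverse A \<gamma> (zero_set (X \<omega>))"
begin

lemma almost_surely_nondegenerate:
  "AE \<omega> in P. X \<omega> \<in> C1_functions A \<and> X \<omega> (\<gamma> 0) \<noteq> 0 \<and> X \<omega> (\<gamma> 1) \<noteq> 0 \<and>
    (\<forall>t\<in>{0..1}. X \<omega> (\<gamma> t) = 0 \<longrightarrow> deriv_along (X \<omega>) t \<noteq> 0)"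
  using transverse regular almost_surely_nonzero[of "\<gamma> 0"] almost_surely_nonzero[of "\<gamma> 1"] AE_space
proof eventually_elim
  case (elim \<omega>)
  then show ?case
    using X_in_C1 transverse_derivative_nonzero[OF atlas X_in_C1] unfolding deriv_along_def by blast
qed

lemma band_tendsto:
  "AE \<omega> in P. \<forall>n. (\<lambda>k. band n k \<omega>) \<longlonglongrightarrow> weighted_count n \<omega>"
  using almost_surely_nondegenerate
proof eventually_elim
  case (elim \<omega>)
  show ?case
  proof
    fix n
    have "band_average (\<lambda>t. X \<omega> (\<gamma> t)) (deriv_along (X \<omega>)) (cutoff n (deriv_along (X \<omega>)))
        \<longlonglongrightarrow> weighted_count n \<omega>"
      using elim unfolding weighted_count_def
      by (intro band_average_tendsto continuous_on_deriv_along continuous_on_cutoff has_deriv_along cutoff_bounds) auto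
    then show "(\<lambda>k. band n k \<omega>) \<longlonglongrightarrow> weighted_count n \<omega>"
      by (simp add: band_def)
  qed
qed

text \<open>Two limits of one sequence as k grows: the expectations of \<open>band n k\<close> tend
  to the left side by domination by the constant n+1, and to the right side by the estimates valid
  for every \<epsilon>.\<close>

lemma expected_limit_band: "(\<integral>\<^sup>+\<omega>. limit_band n \<omega> \<partial>P) = crossing_rate n"
proof -
  have lim: "(\<lambda>k. \<integral>\<^sup>+\<omega>. band n k \<omega> \<partial>P) \<longlonglongrightarrow> (\<integral>\<^sup>+\<omega>. limit_band n \<omega> \<partial>P)"
  proof (rule nn_integral_dominated_convergence[where w = "\<lambda>_. ennreal (Suc n)"])
    show "AE \<omega> in P. band n k \<omega> \<le> ennreal (Suc n)" for k using band_le by (intro AE_I2)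
    show "(\<integral>\<^sup>+\<omega>. ennreal (Suc n) \<partial>P) < \<infinity>" by (simp add: emeasure_space_1 del: of_nat_Suc)
    show "AE \<omega> in P. (\<lambda>k. band n k \<omega>) \<longlonglongrightarrow> limit_band n \<omega>"
      using band_tendsto
    proof eventually_elim
      case (elim \<omega>)
      then have "(\<lambda>k. band n k \<omega>) \<longlonglongrightarrow> weighted_count n \<omega>" by blast
      moreover from this have "limit_band n \<omega> = weighted_count n \<omega>"
        unfolding limit_band_def by (intro lim_imp_Liminf) simp_all
      ultimately show ?case by simp
    qed
  qed (auto intro: band_measurable limit_band_measurable)
  show ?thesis
  proof (rule antisym)
    show "(\<integral>\<^sup>+\<omega>. limit_band n \<omega> \<partial>P) \<le> crossing_rate n"
    proof (rule ennreal_le_epsilon)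
      fix \<epsilon> :: real assume "0 < \<epsilon>"
      from expected_band_near[OF this, of n]
      have "eventually (\<lambda>k. (\<integral>\<^sup>+\<omega>. band n k \<omega> \<partial>P) \<le> crossing_rate n + ennreal \<epsilon>) sequentially"
        by eventually_elim blast
      then show "(\<integral>\<^sup>+\<omega>. limit_band n \<omega> \<partial>P) \<le> crossing_rate n + ennreal \<epsilon>"
        by (rule tendsto_upperbound[OF lim]) simp
    qed
    show "crossing_rate n \<le> (\<integral>\<^sup>+\<omega>. limit_band n \<omega> \<partial>P)"
    proof (rule ennreal_le_epsilon)
      fix \<epsilon> :: real assume "0 < \<epsilon>"
      from expected_band_near[OF this, of n]
      have "eventually (\<lambda>k. crossing_rate n \<le> (\<integral>\<^sup>+\<omega>. band n k \<omega> \<partial>P) + ennreal \<epsilon>) sequentially"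
        by eventually_elim blast
      then show "crossing_rate n \<le> (\<integral>\<^sup>+\<omega>. limit_band n \<omega> \<partial>P) + ennreal \<epsilon>"
        by (rule tendsto_lowerbound[OF tendsto_add[OF lim tendsto_const]]) simp
    qed
  qed
qed

text \<open>Almost surely there are finitely many zeros, all nondegenerate, so every weight equals 1
  from some n on. Monotonicity in n identifies this limit with the supremum.\<close>

lemma SUP_limit_band:
  "AE \<omega> in P. (SUP n. limit_band n \<omega>) = curve_count \<gamma> (zero_set (X \<omega>))"
  using band_tendsto almost_surely_nondegenerate
proof eventually_elim
  case (elim \<omega>)
  let ?Z = "{t\<in>{0..1}. X \<omega> (\<gamma> t) = 0}"
  have "finite ?Z"
    using elim(2) by (intro finite_nondegenerate_zeros[OF has_deriv_along]) auto
  have eq: "limit_band n \<omega> = ennreal (\<Sum>t\<in>?Z. cutoff n (deriv_along (X \<omega>)) t)" for n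
    unfolding limit_band_def using elim(1) by (intro lim_imp_Liminf) (simp_all add: weighted_count_def)
  have "(\<lambda>n. ennreal (\<Sum>t\<in>?Z. cutoff n (deriv_along (X \<omega>)) t)) \<longlonglongrightarrow> ennreal (\<Sum>t\<in>?Z. 1)"
    using elim(2)
    by (intro tendsto_ennrealI tendsto_sum tendsto_eventually eventually_cutoff_eq_1 continuous_on_deriv_along) auto
  then have "(\<lambda>n. limit_band n \<omega>) \<longlonglongrightarrow> of_nat (card ?Z)"
    by (simp add: eq ennreal_of_nat_eq_real_of_nat)
  moreover have "incseq (\<lambda>n. limit_band n \<omega>)" by (rule incseq_SucI) (rule limit_band_mono)
  then have "(\<lambda>n. limit_band n \<omega>) \<longlonglongrightarrow> (SUP n. limit_band n \<omega>)" by (rule LIMSEQ_SUP)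
  ultimately have "(SUP n. limit_band n \<omega>) = of_nat (card ?Z)" using LIMSEQ_unique by blast
  also have "\<dots> = curve_count \<gamma> (zero_set (X \<omega>))"
    using \<open>finite ?Z\<close> unfolding curve_count_def zero_set_def by simp
  finally show ?case .
qed

lemma expected_count: "(\<integral>\<^sup>+\<omega>. curve_count \<gamma> (zero_set (X \<omega>)) \<partial>P) = (SUP n. crossing_rate n)"
proof -
  have "(\<integral>\<^sup>+\<omega>. curve_count \<gamma> (zero_set (X \<omega>)) \<partial>P) = (\<integral>\<^sup>+\<omega>. (SUP n. limit_band n \<omega>) \<partial>P)"
    using SUP_limit_band by (intro nn_integral_cong_AE) (auto elim: eventually_mono)
  also have "\<dots> = (SUP n. \<integral>\<^sup>+\<omega>. limit_band n \<omega> \<partial>P)"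
    by (intro nn_integral_monotone_convergence_SUP limit_band_measurable incseq_SucI)
      (simp add: le_fun_def limit_band_mono)
  finally show ?thesis by (simp add: expected_limit_band)
qed

end

section \<open>Removal of the cutoff on the side of the length\<close>

definition total_density :: "real \<Rightarrow> real" where
  "total_density t = \<rho> (\<gamma> t) 0 * (\<integral>f. \<bar>deriv_along f t\<bar> \<partial>\<mu> (\<gamma> t) 0)"

lemma finsler_velocity:
  "2 * finsler_of_field A \<rho> \<mu> (\<gamma> t) (velocity A {0..1} \<gamma> t) = total_density t"
  by (simp add: finsler_of_field_def total_density_def deriv_along_def)

lemma total_density_nonneg: "0 \<le> total_density t"
  unfolding total_density_def by (intro mult_nonneg_nonneg density_nonneg integral_nonneg_AE) simp

text \<open>A Bochner integral is 0 by default when its integrand is not integrable. The bound by L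
  times the mass of J \<cdot> \<mu> excludes this case, so the definition agrees with the extended
  integral.\<close>

lemma total_density_nn_integral:
  assumes t: "t \<in> {0..1}"
  shows "ennreal (total_density t) = ennreal (\<rho> (\<gamma> t) 0) * (\<integral>\<^sup>+f. ennreal \<bar>deriv_along f t\<bar> \<partial>\<mu> (\<gamma> t) 0)"
proof -
  obtain L where "L > 0" "\<And>f t. f \<in> C1_functions A \<Longrightarrow> t \<in> {0..1} \<Longrightarrow> \<bar>deriv_along f t\<bar> \<le> L * jac_along f t"
    using deriv_along_le_jac by blast
  from nn_integral_deriv_along_le[OF this t, of 0]
  have "(\<integral>\<^sup>+f. ennreal \<bar>deriv_along f t\<bar> \<partial>\<mu> (\<gamma> t) 0) < \<infinity>"
    by (simp add: order_le_less_trans[OF _ ennreal_less_top])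
  then have "integrable (\<mu> (\<gamma> t) 0) (\<lambda>f. \<bar>deriv_along f t\<bar>)"
    using deriv_along_measurable[OF t]
    by (intro integrableI_nonneg) (simp_all add: borel_measurable_kernel)
  then have "(\<integral>\<^sup>+f. ennreal \<bar>deriv_along f t\<bar> \<partial>\<mu> (\<gamma> t) 0) = ennreal (\<integral>f. \<bar>deriv_along f t\<bar> \<partial>\<mu> (\<gamma> t) 0)"
    by (intro nn_integral_eq_integral) simp_all
  then show ?thesis
    unfolding total_density_def by (simp add: ennreal_mult density_nonneg)
qed

lemma SUP_level_density:
  assumes t: "t \<in> {0..1}"
  shows "(SUP n. ennreal (level_density n t 0)) = ennreal (total_density t)"
proof -
  have mono: "speed n t f \<le> speed (Suc n) t f" for n f
    unfolding speed_def by (intro mult_left_mono cutoff_mono) simp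
  have SUP_speed: "(SUP n. ennreal (speed n t f)) = ennreal \<bar>deriv_along f t\<bar>" if f: "f \<in> C1_functions A" for f
  proof -
    have "(\<lambda>n. speed n t f) \<longlonglongrightarrow> \<bar>deriv_along f t\<bar>"
    \<comment> \<open>The weight tends to 1 only where the derivative is nonzero; at its zeros the
      truncated speed is 0 for every n, which is already the limit.\<close>
    proof (cases "deriv_along f t = 0")
      case False
      have "eventually (\<lambda>n. cutoff n (deriv_along f) t = 1) sequentially"
        by (rule eventually_cutoff_eq_1[OF continuous_on_deriv_along[OF f] t False])
      then have "eventually (\<lambda>n. speed n t f = \<bar>deriv_along f t\<bar>) sequentially"
        by eventually_elim (simp add: speed_def)
      then show ?thesis by (rule tendsto_eventually)
    qed (simp add: speed_def)
    then have "(\<lambda>n. ennreal (speed n t f)) \<longlonglongrightarrow> ennreal \<bar>deriv_along f t\<bar>" by (rule tendsto_ennrealI)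
    moreover have "incseq (\<lambda>n. ennreal (speed n t f))" by (intro incseq_SucI ennreal_leI mono)
    then have "(\<lambda>n. ennreal (speed n t f)) \<longlonglongrightarrow> (SUP n. ennreal (speed n t f))" by (rule LIMSEQ_SUP)
    ultimately show ?thesis using LIMSEQ_unique by blast
  qed
  have "(SUP n. ennreal (level_density n t 0))
      = (SUP n. ennreal (\<rho> (\<gamma> t) 0) * (\<integral>\<^sup>+f. ennreal (speed n t f) \<partial>\<mu> (\<gamma> t) 0))"
    unfolding nn_integral_speed[OF t] level_density_def by (simp add: ennreal_mult density_nonneg cond_speed_nonneg)
  also have "\<dots> = ennreal (\<rho> (\<gamma> t) 0) * (SUP n. \<integral>\<^sup>+f. ennreal (speed n t f) \<partial>\<mu> (\<gamma> t) 0)"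
    by (rule SUP_mult_left_ennreal[symmetric])
  also have "(SUP n. \<integral>\<^sup>+f. ennreal (speed n t f) \<partial>\<mu> (\<gamma> t) 0) = (\<integral>\<^sup>+f. (SUP n. ennreal (speed n t f)) \<partial>\<mu> (\<gamma> t) 0)"
    using speed_measurable[OF t]
    by (intro nn_integral_monotone_convergence_SUP[symmetric] incseq_SucI)
      (simp_all add: le_fun_def borel_measurable_kernel ennreal_leI mono)
  also have "\<dots> = (\<integral>\<^sup>+f. ennreal \<bar>deriv_along f t\<bar> \<partial>\<mu> (\<gamma> t) 0)"
    by (intro nn_integral_cong SUP_speed) (simp add: kernel)
  finally show ?thesis by (simp add: total_density_nn_integral[OF t])
qed

lemma level_density_mono:
  assumes "t \<in> {0..1}"
  shows "level_density n t 0 \<le> level_density (Suc n) t 0"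
proof -
  have "ennreal (cond_speed n t 0) \<le> ennreal (cond_speed (Suc n) t 0)"
    unfolding nn_integral_speed[OF assms, symmetric]
    by (intro nn_integral_mono ennreal_leI) (auto simp: speed_def intro!: mult_left_mono cutoff_mono)
  then show ?thesis
    unfolding level_density_def by (intro mult_left_mono density_nonneg) (simp add: cond_speed_nonneg)
qed

text \<open>Monotone convergence in t. The density without cutoff is not shown to be continuous; its
  measurability on [0,1] comes from being a supremum of densities that are continuous there.\<close>

lemma SUP_crossing_rate:
  "(SUP n. crossing_rate n) = (\<integral>\<^sup>+t. ennreal (total_density t) * indicator {0..1} t \<partial>lborel)"
  and total_density_measurable:
  "(\<lambda>t. ennreal (total_density t) * indicator {0..1} t) \<in> borel_measurable lborel"
proof -
  have SUP: "(SUP n. ennreal (level_density n t 0) * indicator {0..1} t) = ennreal (total_density t) * indicator {0..1} t" for t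
    by (cases "t \<in> {0..1}") (simp_all add: SUP_level_density)
  have "(SUP n. crossing_rate n) = (\<integral>\<^sup>+t. (SUP n. ennreal (level_density n t 0) * indicator {0..1} t) \<partial>lborel)"
    unfolding crossing_rate_def
  proof (rule nn_integral_monotone_convergence_SUP[symmetric])
    show "incseq (\<lambda>n t. ennreal (level_density n t 0) * indicator {0..1} t)"
    proof (intro incseq_SucI le_funI)
      fix n t
      show "ennreal (level_density n t 0) * indicator {0..1} t \<le> ennreal (level_density (Suc n) t 0) * indicator {0..1} t"
        by (cases "t \<in> {0..1}") (simp_all add: ennreal_leI level_density_mono)
    qed
  qed (rule level_density_indicator_measurable)
  then show "(SUP n. crossing_rate n) = (\<integral>\<^sup>+t. ennreal (total_density t) * indicator {0..1} t \<partial>lborel)"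
    by (simp only: SUP)
  have "(\<lambda>t. SUP n. ennreal (level_density n t 0) * indicator {0..1} t) \<in> borel_measurable lborel"
    by (intro borel_measurable_SUP level_density_indicator_measurable) simp
  then show "(\<lambda>t. ennreal (total_density t) * indicator {0..1} t) \<in> borel_measurable lborel"
    by (simp only: SUP)
qed

text \<open>The majorant is \<rho> L times the mass of J \<cdot> \<mu> at level 0. Testing the weak
  continuity with the constant 1 makes that mass continuous along the curve, hence bounded on
  [0,1].\<close>

lemma total_density_bounded:
  obtains M where "\<And>t. t \<in> {0..1} \<Longrightarrow> total_density t \<le> M"
proof -
  obtain L where L: "L > 0" "\<And>f t. f \<in> C1_functions A \<Longrightarrow> t \<in> {0..1} \<Longrightarrow> \<bar>deriv_along f t\<bar> \<le> L * jac_along f t"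
    using deriv_along_le_jac by blast
  define m where "m t x = (\<integral>f. (1::real) \<partial>J_measure A g (\<gamma> t) (\<mu> (\<gamma> t) x))" for t x
  have "((\<lambda>z. \<rho> (\<gamma> (fst z)) (snd z) * (L * m (fst z) (snd z))) \<longlongrightarrow> \<rho> (\<gamma> t0) 0 * (L * m t0 0))
      (inf (nhds t0) (principal {0..1}) \<times>\<^sub>F nhds 0)" if t0: "t0 \<in> {0..1}" for t0
  proof -
    have "isCont (\<lambda>(q, x). \<integral>f. (1::real) \<partial>J_measure A g q (\<mu> q x)) (\<gamma> t0, 0)"
      by (intro J_measure_isCont) (auto simp: bounded_iff)
    then have "((\<lambda>(q, x). \<integral>f. (1::real) \<partial>J_measure A g q (\<mu> q x)) \<longlongrightarrow> m t0 0) (nhds (\<gamma> t0, 0))"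
      by (simp add: isCont_def tendsto_nhds_iff m_def)
    from filterlim_compose[OF this curve_pair_tendsto[OF t0]] show ?thesis
      by (intro tendsto_mult density_along_tendsto t0 tendsto_const) (simp add: m_def)
  qed
  then have "continuous_on {0..1} (\<lambda>t. \<rho> (\<gamma> t) 0 * (L * m t 0))"
    unfolding continuous_on_def by (intro ballI tendsto_at_zero_level)
  then have "compact ((\<lambda>t. \<rho> (\<gamma> t) 0 * (L * m t 0)) ` {0..1})" by (intro compact_continuous_image) auto
  then obtain M where M: "\<And>t. t \<in> {0..1} \<Longrightarrow> \<rho> (\<gamma> t) 0 * (L * m t 0) \<le> M"
    using bounded_imp_bdd_above[OF compact_imp_bounded] unfolding bdd_above_def by fast
  show thesis
  proof
    fix t :: real assume t: "t \<in> {0..1}"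
    have "0 \<le> m t 0" unfolding m_def by simp
    have "ennreal (total_density t) \<le> ennreal (\<rho> (\<gamma> t) 0) * ennreal (L * m t 0)"
      unfolding total_density_nn_integral[OF t] m_def by (intro mult_left_mono nn_integral_deriv_along_le L t) simp_all
    also have "\<dots> = ennreal (\<rho> (\<gamma> t) 0 * (L * m t 0))"
      using L(1) \<open>0 \<le> m t 0\<close> by (simp add: ennreal_mult density_nonneg)
    finally have "total_density t \<le> \<rho> (\<gamma> t) 0 * (L * m t 0)"
      using L(1) \<open>0 \<le> m t 0\<close> by (simp add: density_nonneg)
    then show "total_density t \<le> M" using M[OF t] by simp
  qed
qed

text \<open>Boundedness makes the integrand integrable on [0,1], so that the real integral defining
  the length agrees with the extended one; the factor 2 undoes the 1/2 in the Finsler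
  structure.\<close>

lemma SUP_crossing_rate_eq_length:
  "(SUP n. crossing_rate n) = ennreal (2 * finsler_length A (finsler_of_field A \<rho> \<mu>) \<gamma>)"
proof -
  obtain M where M: "\<And>t. t \<in> {0..1} \<Longrightarrow> total_density t \<le> M" using total_density_bounded by blast
  let ?h = "\<lambda>t. indicator {0..1} t * total_density t"
  have eq: "ennreal (?h t) = ennreal (total_density t) * indicator {0..1} t" for t
    by (simp add: indicator_def)
  have meas: "?h \<in> borel_measurable lborel"
  proof -
    have "(\<lambda>t. enn2real (ennreal (total_density t) * indicator {0..1} t)) \<in> borel_measurable lborel"
      using total_density_measurable by measurable
    moreover have "enn2real (ennreal (total_density t) * indicator {0..1} t) = ?h t" for t
      unfolding eq[symmetric] using total_density_nonneg by simp
    ultimately show ?thesis by simp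
  qed
  have "(\<integral>\<^sup>+t. ennreal (?h t) \<partial>lborel) \<le> (\<integral>\<^sup>+t. ennreal M * indicator {0..1::real} t \<partial>lborel)"
    using M by (intro nn_integral_mono) (auto simp: indicator_def intro!: ennreal_leI)
  also have "\<dots> < \<infinity>" by (simp add: nn_integral_cmult_indicator ennreal_mult_less_top)
  finally have int: "integrable lborel ?h"
    using meas total_density_nonneg by (intro integrableI_nonneg) auto
  have "(SUP n. crossing_rate n) = (\<integral>\<^sup>+t. ennreal (?h t) \<partial>lborel)"
    by (simp only: SUP_crossing_rate eq)
  also have "\<dots> = ennreal (\<integral>t. ?h t \<partial>lborel)"
    using int total_density_nonneg by (intro nn_integral_eq_integral) auto
  also have "(\<integral>t. ?h t \<partial>lborel) = 2 * finsler_length A (finsler_of_field A \<rho> \<mu>) \<gamma>"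
    unfolding finsler_length_def set_lebesgue_integral_def finsler_velocity[symmetric]
    by (subst integral_mult_right_zero[symmetric]) (simp add: mult.left_commute)
  finally show ?thesis .
qed

end

theorem proposition9p4:
  fixes A :: "('m::{t2_space,second_countable_topology}, 'e::euclidean_space) chart set"
    and g :: "'m \<Rightarrow> ('m, 'e) tangent_vector \<Rightarrow> ('m, 'e) tangent_vector \<Rightarrow> real"
    and P :: "'w measure"
    and X :: "'w \<Rightarrow> 'm \<Rightarrow> real"
    and \<rho> :: "'m \<Rightarrow> real \<Rightarrow> real"
    and \<mu> :: "'m \<Rightarrow> real \<Rightarrow> ('m \<Rightarrow> real) measure"
    and \<gamma> :: "real \<Rightarrow> 'm"
  assumes "smooth_atlas A"
    and "riemannian_metric A g"
    and "zKROK A g P X \<rho> \<mu>"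
    and "Ck_curve_on \<infinity> A {0..1} \<gamma>"
    and "AE \<omega> in P. curve_transverse A \<gamma> (zero_set (X \<omega>))"
  shows "(\<integral>\<^sup>+\<omega>. curve_count \<gamma> (zero_set (X \<omega>)) \<partial>P)
    = ennreal (2 * finsler_length A (finsler_of_field A \<rho> \<mu>) \<gamma>)"
proof -
  interpret zkrok_on_curve A g \<gamma> P X \<rho> \<mu>
    by unfold_locales (fact assms)+
  show ?thesis using expected_count[OF assms(5)] by (simp only: SUP_crossing_rate_eq_length)
qed

end
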